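(* Let $(X,A,\mathcal{F})$ be a semi-uniform pair and $G$ an abelian group. Then there is a functorial (natural with respect to uniformly continuous maps of semi-uniform pairs) long exact sequence of the pair in Vietoris-Rips cohomology $$\cdots \to H^*_{VR}(X,A;G) \to H^*_{VR}(X;G) \to H^*_{VR}(A; G) \to H^{*+1}_{VR}(X,A;G) \to \cdots$$ and a functorial sequence of order two (i.e. the composition of any two consecutive maps is zero) in Vietoris-Rips homology $$\cdots \to H_*^{VR}(A;G) \to H_*^{VR}(X;G) \to H_*^{VR}(X,A;G) \to H_{*-1}^{VR}(A;G) \to \cdots$$
   Context: A semi-uniform structure on a set $X$ is a filter $\mathcal{F}$ on $X\times X$ (a nonempty collection of subsets, not containing $\emptyset$, closed under finite intersections and supersets) such that every member contains the diagonal and, for every $U\in\mathcal{F}$, $U^{-1}=\{(y,x)\mid (x,y)\in U\}$ contains a member of $\mathcal{F}$. The pair $(X,\mathcal{F})$ is a semi-uniform space. A map $f\colon(X,\mathcal{F}_X)\to(Y,\mathcal{F}_Y)$ is uniformly continuous if for each $V\in\mathcal{F}_Y$ there is $U\in\mathcal{F}_X$ such that $(x,y)\in U$ implies $(f(x),f(y))\in V$ (written $f(U)\subset V$). For $A\subset X$ and $U\in\mathcal{F}$ put $U_A=U\cap(A\times A)$ and $\mathcal{F}_A=\{U_A\mid U\in\mathcal{F},\,U_A\neq\emptyset\}$. A semi-uniform pair $(X,A,\mathcal{F})$ is the pair $((X,\mathcal{F}),(A,\mathcal{F}_A))$. A uniformly continuous map of semi-uniform pairs $(X,A,\mathcal{F}_X)\to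 (Y,B,\mathcal{F}_Y)$ is a uniformly continuous map $f\colon (X,\mathcal{F}_X)\to (Y,\mathcal{F}_Y)$ with $f(A)\subset B$. For a relation $U\subset X\times X$, the Vietoris-Rips complex $\Sigma^X_U$ is the simplicial complex with vertex set $X$ in which a finite nonempty set is a simplex iff its elements can be ordered as $x_0,\dots,x_q$ (distinct) so that $(x_i,x_j)\in U$ for all $i<j$. (If $U$ is symmetric this is the clique complex of the graph with edge relation $U$.) Put $H_*^{VR}(X,A\colon U;G)=H_*(\Sigma^X_U,\Sigma^A_{U_A};G)$ and $H^*_{VR}(X,A\colon U;G)=H^*(\Sigma^X_U,\Sigma^A_{U_A};G)$. For $U\subset U'$ in $\mathcal{F}$ the inclusion of simplicial pairs induces maps on homology and cohomology, and one defines $H_*^{VR}(X,A;G)=H_*^{VR}(X,A,\mathcal{F};G)=\varprojlim_{U\in\mathcal{F}}H_*^{VR}(X,A\colon U;G)$ and $H^*_{VR}(X,A;G)=H^*_{VR}(X,A,\mathcal{F};G)=\varinjlim_{U\in\mathcal{F}}H^*_{VR}(X,A\colon U;G)$. The groups of $X$ are those of the pair with $A=\emptyset$, and the groups of $A$ are those of $(A,\mathcal{F}_A)$; the (co)homology of the empty space is $0$. A uniformly continuous map of pairs induces maps on these groups via the simplicial maps $\tilde f_{VU}\colon(\Sigma^X_U,\Sigma^A_{U_A})\to(\Sigma^Y_V,\Sigma^B_{V_B})$, defined by $f$ on vertices whenever $f(U)\subset V$, by passing to the limit. The maps in the two sequences are those induced by the inclusions $A\to X$ and $(X,\emptyset)\to(X,A)$,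 together with the connecting homomorphisms obtained as the limits over $U\in\mathcal{F}$ of the simplicial connecting homomorphisms of the pairs $(\Sigma^X_U,\Sigma^A_{U_A})$. *)

theory Defs
  imports "HOL-Algebra.Exact_Sequence" "HOL-Algebra.Free_Abelian_Groups" "HOL-Combinatorics.Permutations"
begin

section \<open>Semi-uniform spaces and pairs\<close>

definition semi_uniform :: "'a set \<Rightarrow> ('a \<times> 'a) set set \<Rightarrow> bool" where
  "semi_uniform X F \<longleftrightarrow>
     F \<noteq> {} \<and> {} \<notin> F \<and> (\<forall>U\<in>F. U \<subseteq> X \<times> X) \<and>
     (\<forall>U\<in>F. \<forall>V\<in>F. U \<inter> V \<in> F) \<and>
     (\<forall>U\<in>F. \<forall>V. U \<subseteq> V \<and> V \<subseteq> X \<times> X \<longrightarrow> V \<in> F) \<and>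
     (\<forall>U\<in>F. Id_on X \<subseteq> U) \<and>
     (\<forall>U\<in>F. \<exists>V\<in>F. V \<subseteq> U\<inverse>)"

definition rel_maps :: "('a \<Rightarrow> 'b) \<Rightarrow> ('a \<times> 'a) set \<Rightarrow> ('b \<times> 'b) set \<Rightarrow> bool" where
  "rel_maps f U V \<longleftrightarrow> (\<forall>(x, y)\<in>U. (f x, f y) \<in> V)"

definition unif_cont ::
    "'a set \<Rightarrow> ('a \<times> 'a) set set \<Rightarrow> 'b set \<Rightarrow> ('b \<times> 'b) set set \<Rightarrow> ('a \<Rightarrow> 'b) \<Rightarrow> bool" where
  "unif_cont X F Y F' f \<longleftrightarrow> f \<in> X \<rightarrow> Y \<and> (\<forall>V\<in>F'. \<exists>U\<in>F. rel_maps f U V)"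

definition trace_rel :: "'a set \<Rightarrow> ('a \<times> 'a) set \<Rightarrow> ('a \<times> 'a) set" where
  "trace_rel A U = U \<inter> (A \<times> A)"

definition trace_family :: "'a set \<Rightarrow> ('a \<times> 'a) set set \<Rightarrow> ('a \<times> 'a) set set" where
  "trace_family A F = {trace_rel A U | U. U \<in> F \<and> trace_rel A U \<noteq> {}}"

text \<open>A pair is recorded as the triple \<open>(X, A, F)\<close>.\<close>

type_synonym 'a upair = "'a set \<times> 'a set \<times> ('a \<times> 'a) set set"

fun semi_uniform_pair :: "'a upair \<Rightarrow> bool" where
  "semi_uniform_pair (X, A, F) \<longleftrightarrow> semi_uniform X F \<and> A \<subseteq> X"

fun unif_cont_pair :: "'a upair \<Rightarrow> 'b upair \<Rightarrow> ('a \<Rightarrow> 'b) \<Rightarrow> bool" where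
  "unif_cont_pair (X, A, F) (Y, B, F') f \<longleftrightarrow> unif_cont X F Y F' f \<and> f ` A \<subseteq> B"

fun total_space :: "'a upair \<Rightarrow> 'a upair" where
  "total_space (X, A, F) = (X, {}, F)"

fun subspace :: "'a upair \<Rightarrow> 'a upair" where
  "subspace (X, A, F) = (A, {}, trace_family A F)"


section \<open>Simplicial homology and cohomology of a pair of simplicial complexes\<close>

text \<open>
  A simplicial complex is given by its set of simplices, which are finite and nonempty sets.
  A simplex with an ordering of its vertices is a distinct list.  Degrees are integers;
  as the empty set is not a simplex, everything in negative degrees is trivial.
\<close>

definition ordered_simplices :: "int \<Rightarrow> 'a set set \<Rightarrow> 'a list set" where
  "ordered_simplices n K = {xs. distinct xs \<and> set xs \<in> K \<and> int (length xs) = n + 1}"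

text \<open>
  Oriented \<open>n\<close>-chains with coefficients in \<open>G\<close> (written multiplicatively): finitely supported
  functions on the oriented simplices whose value is inverted when the orientation is reversed.
  The chain \<open>g [x\<^sub>0,\<dots>,x\<^sub>n]\<close> is the function with value \<open>g\<close> at even and
  \<open>inv g\<close> at odd reorderings of \<open>[x\<^sub>0,\<dots>,x\<^sub>n]\<close>, and \<open>\<one>\<close> elsewhere.
\<close>

definition chains :: "('g, 'm) monoid_scheme \<Rightarrow> int \<Rightarrow> 'a set set \<Rightarrow> ('a list \<Rightarrow> 'g) set" where
  "chains G n K = {c.
     (\<forall>xs. c xs \<in> carrier G) \<and>
     finite {xs. c xs \<noteq> \<one>\<^bsub>G\<^esub>} \<and>
     (\<forall>xs. xs \<notin> ordered_simplices n K \<longrightarrow> c xs = \<one>\<^bsub>G\<^esub>) \<and>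
     (\<forall>xs\<in>ordered_simplices n K. \<forall>p. p permutes {..<length xs} \<longrightarrow>
        c (permute_list p xs) = (if evenperm p then c xs else inv\<^bsub>G\<^esub> (c xs)))}"

definition chain_group ::
    "('g, 'm) monoid_scheme \<Rightarrow> int \<Rightarrow> 'a set set \<Rightarrow> ('a list \<Rightarrow> 'g) monoid" where
  "chain_group G n K =
     \<lparr>carrier = chains G n K, monoid.mult = (\<lambda>c d xs. c xs \<otimes>\<^bsub>G\<^esub> d xs), one = (\<lambda>xs. \<one>\<^bsub>G\<^esub>)\<rparr>"

text \<open>
  The boundary \<open>\<partial>[x\<^sub>0,\<dots>,x\<^sub>n] = \<Sum>i. (-1)\<^sup>i [x\<^sub>0,\<dots>,x\<^sub>i\<^sub>-\<^sub>1,x\<^sub>i\<^sub>+\<^sub>1,\<dots>,x\<^sub>n]\<close>, in terms of coefficients: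
  a simplex having the oriented simplex \<open>ys\<close> as a face can be oriented as \<open>v # ys\<close> for a unique
  vertex \<open>v\<close>, and then \<open>ys\<close> occurs in its boundary with sign \<open>+1\<close>.  The clause for
  \<open>[]\<close> makes the boundary of a \<open>0\<close>-chain trivial (no augmentation).
\<close>

definition boundary :: "('g, 'm) monoid_scheme \<Rightarrow> ('a list \<Rightarrow> 'g) \<Rightarrow> 'a list \<Rightarrow> 'g" where
  "boundary G c = (\<lambda>ys. if ys = [] then \<one>\<^bsub>G\<^esub> else gfinprod G (\<lambda>v. c (v # ys)) UNIV)"

text \<open>
  The chain map of a simplicial map, sending \<open>[x\<^sub>0,\<dots>,x\<^sub>n]\<close> to
  \<open>[f x\<^sub>0,\<dots>,f x\<^sub>n]\<close> if these vertices are distinct and to \<open>0\<close> otherwise.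
\<close>

definition chain_map ::
    "('g, 'm) monoid_scheme \<Rightarrow> ('a \<Rightarrow> 'b) \<Rightarrow> ('a list \<Rightarrow> 'g) \<Rightarrow> 'b list \<Rightarrow> 'g" where
  "chain_map G f c = (\<lambda>ys. if distinct ys then gfinprod G c {xs. map f xs = ys} else \<one>\<^bsub>G\<^esub>)"

text \<open>
  The homology of the quotient complex \<open>C(K)/C(L)\<close>, with the two successive quotients merged
  into one, as in \<open>HOL-Homology\<close>.
\<close>

definition rel_cycles ::
    "('g, 'm) monoid_scheme \<Rightarrow> int \<Rightarrow> 'a set set \<Rightarrow> 'a set set \<Rightarrow> ('a list \<Rightarrow> 'g) set" where
  "rel_cycles G n K L = {c \<in> chains G n K. boundary G c \<in> chains G (n - 1) L}"

definition rel_boundaries ::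
    "('g, 'm) monoid_scheme \<Rightarrow> int \<Rightarrow> 'a set set \<Rightarrow> 'a set set \<Rightarrow> ('a list \<Rightarrow> 'g) set" where
  "rel_boundaries G n K L =
     {boundary G d \<otimes>\<^bsub>chain_group G n K\<^esub> e | d e. d \<in> chains G (n + 1) K \<and> e \<in> chains G n L}"

definition homology_group ::
    "('g, 'm) monoid_scheme \<Rightarrow> int \<Rightarrow> 'a set set \<Rightarrow> 'a set set \<Rightarrow> ('a list \<Rightarrow> 'g) set monoid" where
  "homology_group G n K L =
     (chain_group G n K)\<lparr>carrier := rel_cycles G n K L\<rparr> Mod rel_boundaries G n K L"

text \<open>
  The map to \<open>H\<^sub>n(K, L; G)\<close> induced by a simplicial map \<open>f\<close> into \<open>(K, L)\<close>:
  a coset \<open>S\<close> goes to the coset containing its image.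
\<close>

definition homology_map ::
    "('g, 'm) monoid_scheme \<Rightarrow> int \<Rightarrow> 'b set set \<Rightarrow> 'b set set \<Rightarrow> ('a \<Rightarrow> 'b) \<Rightarrow>
     ('a list \<Rightarrow> 'g) set \<Rightarrow> ('b list \<Rightarrow> 'g) set" where
  "homology_map G n K L f S = rel_boundaries G n K L <#>\<^bsub>chain_group G n K\<^esub> (chain_map G f ` S)"

text \<open>
  The connecting homomorphism \<open>H\<^sub>n(K, L; G) \<rightarrow> H\<^sub>n\<^sub>-\<^sub>1(L; G)\<close>.  A class is closed under
  adding \<open>n\<close>-chains of \<open>L\<close>, so its image under the boundary is a full coset.
\<close>

definition homology_connecting ::
    "('g, 'm) monoid_scheme \<Rightarrow> ('a list \<Rightarrow> 'g) set \<Rightarrow> ('a list \<Rightarrow> 'g) set" where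
  "homology_connecting G S = boundary G ` S"

text \<open>
  Cochains are \<open>Hom(C\<^sub>n(K, L; \<int>), G)\<close>, that is, homomorphisms from
  \<open>C\<^sub>n(K; \<int>)\<close> to \<open>G\<close> that are trivial on \<open>C\<^sub>n(L; \<int>)\<close>.
\<close>

definition cochains ::
    "('g, 'm) monoid_scheme \<Rightarrow> int \<Rightarrow> 'a set set \<Rightarrow> 'a set set \<Rightarrow> (('a list \<Rightarrow> int) \<Rightarrow> 'g) set" where
  "cochains G n K L =
     {\<phi> \<in> hom (chain_group integer_group n K) G \<inter> extensional (chains integer_group n K).
        \<forall>c\<in>chains integer_group n L. \<phi> c = \<one>\<^bsub>G\<^esub>}"

definition cochain_group ::
    "('g, 'm) monoid_scheme \<Rightarrow> int \<Rightarrow> 'a set set \<Rightarrow> 'a set set \<Rightarrow> (('a list \<Rightarrow> int) \<Rightarrow> 'g) monoid" where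
  "cochain_group G n K L =
     \<lparr>carrier = cochains G n K L,
      monoid.mult = (\<lambda>\<phi> \<psi>. \<lambda>c\<in>chains integer_group n K. \<phi> c \<otimes>\<^bsub>G\<^esub> \<psi> c),
      one = (\<lambda>c\<in>chains integer_group n K. \<one>\<^bsub>G\<^esub>)\<rparr>"

definition coboundary ::
    "int \<Rightarrow> 'a set set \<Rightarrow> (('a list \<Rightarrow> int) \<Rightarrow> 'g) \<Rightarrow> ('a list \<Rightarrow> int) \<Rightarrow> 'g" where
  "coboundary n K \<phi> = (\<lambda>c\<in>chains integer_group (n + 1) K. \<phi> (boundary integer_group c))"

definition cochain_map ::
    "int \<Rightarrow> 'a set set \<Rightarrow> ('a \<Rightarrow> 'b) \<Rightarrow> (('b list \<Rightarrow> int) \<Rightarrow> 'g) \<Rightarrow> ('a list \<Rightarrow> int) \<Rightarrow> 'g" where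
  "cochain_map n K f \<phi> = (\<lambda>c\<in>chains integer_group n K. \<phi> (chain_map integer_group f c))"

definition rel_cocycles ::
    "('g, 'm) monoid_scheme \<Rightarrow> int \<Rightarrow> 'a set set \<Rightarrow> 'a set set \<Rightarrow> (('a list \<Rightarrow> int) \<Rightarrow> 'g) set" where
  "rel_cocycles G n K L =
     {\<phi> \<in> cochains G n K L. coboundary n K \<phi> = \<one>\<^bsub>cochain_group G (n + 1) K L\<^esub>}"

definition rel_coboundaries ::
    "('g, 'm) monoid_scheme \<Rightarrow> int \<Rightarrow> 'a set set \<Rightarrow> 'a set set \<Rightarrow> (('a list \<Rightarrow> int) \<Rightarrow> 'g) set" where
  "rel_coboundaries G n K L = coboundary (n - 1) K ` cochains G (n - 1) K L"

definition cohomology_group ::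
    "('g, 'm) monoid_scheme \<Rightarrow> int \<Rightarrow> 'a set set \<Rightarrow> 'a set set \<Rightarrow> (('a list \<Rightarrow> int) \<Rightarrow> 'g) set monoid" where
  "cohomology_group G n K L =
     (cochain_group G n K L)\<lparr>carrier := rel_cocycles G n K L\<rparr> Mod rel_coboundaries G n K L"

text \<open>
  The map to \<open>H\<^sup>n(K, L; G)\<close> induced by a simplicial map \<open>f\<close> out of \<open>(K, L)\<close>.
\<close>

definition cohomology_map ::
    "('g, 'm) monoid_scheme \<Rightarrow> int \<Rightarrow> 'a set set \<Rightarrow> 'a set set \<Rightarrow> ('a \<Rightarrow> 'b) \<Rightarrow>
     (('b list \<Rightarrow> int) \<Rightarrow> 'g) set \<Rightarrow> (('a list \<Rightarrow> int) \<Rightarrow> 'g) set" where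
  "cohomology_map G n K L f S =
     rel_coboundaries G n K L <#>\<^bsub>cochain_group G n K L\<^esub> (cochain_map n K f ` S)"

text \<open>
  The connecting homomorphism \<open>H\<^sup>n(L; G) \<rightarrow> H\<^sup>n\<^sup>+\<^sup>1(K, L; G)\<close>: extend the cocycles in
  the class to cochains on \<open>K\<close> in all possible ways and take coboundaries; these form a full coset.
\<close>

definition cohomology_connecting ::
    "('g, 'm) monoid_scheme \<Rightarrow> int \<Rightarrow> 'a set set \<Rightarrow> 'a set set \<Rightarrow>
     (('a list \<Rightarrow> int) \<Rightarrow> 'g) set \<Rightarrow> (('a list \<Rightarrow> int) \<Rightarrow> 'g) set" where
  "cohomology_connecting G n K L S =
     {coboundary n K \<psi> | \<psi>. \<psi> \<in> cochains G n K {} \<and> restrict \<psi> (chains integer_group n L) \<in> S}"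


section \<open>Limits of groups\<close>

text \<open>In both cases \<open>\<phi> i j\<close> is a map \<open>H i \<rightarrow> H j\<close> for \<open>r i j\<close>.\<close>

definition inverse_limit ::
    "'i set \<Rightarrow> ('i \<Rightarrow> 'i \<Rightarrow> bool) \<Rightarrow> ('i \<Rightarrow> 'h monoid) \<Rightarrow> ('i \<Rightarrow> 'i \<Rightarrow> 'h \<Rightarrow> 'h) \<Rightarrow> ('i \<Rightarrow> 'h) monoid" where
  "inverse_limit I r H \<phi> = (product_group I H)
     \<lparr>carrier := {z \<in> carrier (product_group I H). \<forall>i\<in>I. \<forall>j\<in>I. r i j \<longrightarrow> \<phi> i j (z i) = z j}\<rparr>"

definition germ_rel ::
    "'i set \<Rightarrow> ('i \<Rightarrow> 'i \<Rightarrow> bool) \<Rightarrow> ('i \<Rightarrow> 'h monoid) \<Rightarrow> ('i \<Rightarrow> 'i \<Rightarrow> 'h \<Rightarrow> 'h) \<Rightarrow>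
     (('i \<times> 'h) \<times> ('i \<times> 'h)) set" where
  "germ_rel I r H \<phi> = {((i, x), (j, y)).
     i \<in> I \<and> x \<in> carrier (H i) \<and> j \<in> I \<and> y \<in> carrier (H j) \<and>
     (\<exists>k\<in>I. r i k \<and> r j k \<and> \<phi> i k x = \<phi> j k y)}"

text \<open>The direct limit over a nonempty directed index set: the disjoint union modulo \<open>germ_rel\<close>.\<close>

definition direct_limit ::
    "'i set \<Rightarrow> ('i \<Rightarrow> 'i \<Rightarrow> bool) \<Rightarrow> ('i \<Rightarrow> 'h monoid) \<Rightarrow> ('i \<Rightarrow> 'i \<Rightarrow> 'h \<Rightarrow> 'h) \<Rightarrow> ('i \<times> 'h) set monoid" where
  "direct_limit I r H \<phi> =
     \<lparr>carrier = (SIGMA i:I. carrier (H i)) // germ_rel I r H \<phi>,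
      monoid.mult = (\<lambda>P Q. germ_rel I r H \<phi> `` {(i, x \<otimes>\<^bsub>H i\<^esub> y) | i x y. (i, x) \<in> P \<and> (i, y) \<in> Q}),
      one = germ_rel I r H \<phi> `` {(i, \<one>\<^bsub>H i\<^esub>) | i. i \<in> I}\<rparr>"


section \<open>Vietoris-Rips homology and cohomology\<close>

definition VR_complex :: "'a set \<Rightarrow> ('a \<times> 'a) set \<Rightarrow> 'a set set" where
  "VR_complex X U =
     {set xs | xs. xs \<noteq> [] \<and> set xs \<subseteq> X \<and> distinct xs \<and> sorted_wrt (\<lambda>x y. (x, y) \<in> U) xs}"

abbreviation VR_sub :: "'a set \<Rightarrow> ('a \<times> 'a) set \<Rightarrow> 'a set set" where
  "VR_sub A U \<equiv> VR_complex A (trace_rel A U)"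

text \<open>
  The empty space carries no semi-uniform structure, and \<open>trace_family {} F = {}\<close>.  Indexing the
  limits by the single relation \<open>{}\<close> in this case gives the (co)homology of the empty
  complex, so that the (co)homology of the empty space is \<open>0\<close>.
\<close>

definition indices :: "('a \<times> 'a) set set \<Rightarrow> ('a \<times> 'a) set set" where
  "indices F = (if F = {} then {{}} else F)"

fun VR_homology ::
    "('g, 'm) monoid_scheme \<Rightarrow> int \<Rightarrow> 'a upair \<Rightarrow> (('a \<times> 'a) set \<Rightarrow> ('a list \<Rightarrow> 'g) set) monoid" where
  "VR_homology G n (X, A, F) =
     inverse_limit (indices F) (\<subseteq>)
       (\<lambda>U. homology_group G n (VR_complex X U) (VR_sub A U))
       (\<lambda>U U'. homology_map G n (VR_complex X U') (VR_sub A U') id)"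

text \<open>The choice of \<open>U\<close> does not matter, since \<open>F\<close> is closed under intersections.\<close>

fun VR_homology_map ::
    "('g, 'm) monoid_scheme \<Rightarrow> int \<Rightarrow> 'a upair \<Rightarrow> 'b upair \<Rightarrow> ('a \<Rightarrow> 'b) \<Rightarrow>
     (('a \<times> 'a) set \<Rightarrow> ('a list \<Rightarrow> 'g) set) \<Rightarrow> ('b \<times> 'b) set \<Rightarrow> ('b list \<Rightarrow> 'g) set" where
  "VR_homology_map G n (X, A, F) (Y, B, F') f z =
     (\<lambda>V\<in>indices F'. homology_map G n (VR_complex Y V) (VR_sub B V) f
        (z (SOME U. U \<in> indices F \<and> rel_maps f U V)))"

fun VR_homology_connecting ::
    "('g, 'm) monoid_scheme \<Rightarrow> 'a upair \<Rightarrow>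
     (('a \<times> 'a) set \<Rightarrow> ('a list \<Rightarrow> 'g) set) \<Rightarrow> ('a \<times> 'a) set \<Rightarrow> ('a list \<Rightarrow> 'g) set" where
  "VR_homology_connecting G (X, A, F) z =
     (\<lambda>W\<in>indices (trace_family A F).
        homology_connecting G (z (SOME U. U \<in> F \<and> trace_rel A U = W)))"

text \<open>Smaller relations come later in the direct system.\<close>

fun VR_germ_rel ::
    "('g, 'm) monoid_scheme \<Rightarrow> int \<Rightarrow> 'a upair \<Rightarrow>
     ((('a \<times> 'a) set \<times> (('a list \<Rightarrow> int) \<Rightarrow> 'g) set) \<times> (('a \<times> 'a) set \<times> (('a list \<Rightarrow> int) \<Rightarrow> 'g) set)) set" where
  "VR_germ_rel G n (X, A, F) =
     germ_rel (indices F) (\<supseteq>)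
       (\<lambda>U. cohomology_group G n (VR_complex X U) (VR_sub A U))
       (\<lambda>U U'. cohomology_map G n (VR_complex X U') (VR_sub A U') id)"

fun VR_cohomology ::
    "('g, 'm) monoid_scheme \<Rightarrow> int \<Rightarrow> 'a upair \<Rightarrow>
     (('a \<times> 'a) set \<times> (('a list \<Rightarrow> int) \<Rightarrow> 'g) set) set monoid" where
  "VR_cohomology G n (X, A, F) =
     direct_limit (indices F) (\<supseteq>)
       (\<lambda>U. cohomology_group G n (VR_complex X U) (VR_sub A U))
       (\<lambda>U U'. cohomology_map G n (VR_complex X U') (VR_sub A U') id)"

fun VR_cohomology_map ::
    "('g, 'm) monoid_scheme \<Rightarrow> int \<Rightarrow> 'a upair \<Rightarrow> 'b upair \<Rightarrow> ('a \<Rightarrow> 'b) \<Rightarrow>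
     (('b \<times> 'b) set \<times> (('b list \<Rightarrow> int) \<Rightarrow> 'g) set) set \<Rightarrow>
     (('a \<times> 'a) set \<times> (('a list \<Rightarrow> int) \<Rightarrow> 'g) set) set" where
  "VR_cohomology_map G n (X, A, F) (Y, B, F') f z =
     VR_germ_rel G n (X, A, F) ``
       {(U, cohomology_map G n (VR_complex X U) (VR_sub A U) f h) | U V h.
          U \<in> indices F \<and> (V, h) \<in> z \<and> rel_maps f U V}"

fun VR_cohomology_connecting ::
    "('g, 'm) monoid_scheme \<Rightarrow> int \<Rightarrow> 'a upair \<Rightarrow>
     (('a \<times> 'a) set \<times> (('a list \<Rightarrow> int) \<Rightarrow> 'g) set) set \<Rightarrow>
     (('a \<times> 'a) set \<times> (('a list \<Rightarrow> int) \<Rightarrow> 'g) set) set" where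
  "VR_cohomology_connecting G n (X, A, F) z =
     VR_germ_rel G (n + 1) (X, A, F) ``
       {(U, cohomology_connecting G n (VR_complex X U) (VR_sub A U) h) | U h.
          U \<in> F \<and> (trace_rel A U, h) \<in> z}"


section \<open>Sequences of order two\<close>

text \<open>The analogue of \<open>exact_seq\<close>, with an inclusion in place of the equality.\<close>

inductive order_two_seq :: "'a monoid list \<times> ('a \<Rightarrow> 'a) list \<Rightarrow> bool" where
  unity: "group_hom G1 G2 f \<Longrightarrow> order_two_seq ([G2, G1], [f])"
| extension: "\<lbrakk>order_two_seq (G # K # l, g # q); group H; h \<in> hom G H;
     g ` carrier K \<subseteq> kernel G H h\<rbrakk> \<Longrightarrow> order_two_seq (H # G # K # l, h # g # q)"

end

theory Submission
  imports Defs
begin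

text \<open>
  At a fixed relation \<open>U\<close>, exactness of the cohomology sequence of the simplicial pair rests
  on extending cochains from the subcomplex: discarding the coefficients outside the subcomplex
  is a retraction of chain groups.  Directed limits are exact, and as the relations \<open>U \<inter> (A \<times> A)\<close> run through all indices of the
  subspace, kernels and images can be compared on representatives after shrinking \<open>U\<close>.  Inverse
  limits preserve only the vanishing of compositions.  The chain complex identities come from one
  cancellation principle: a finite product vanishes if a fixed point free involution of the
  index set inverts the factors.
\<close>

section \<open>Finitely supported functions\<close>

text \<open>Up to degenerate lists, \<open>boundary\<close> and \<open>chain_map\<close> are one
  construction: multiplication over the fibres of a map of lists (\<open>tl\<close> and
  \<open>map f\<close>). The vanishing of squared boundaries, functoriality and the compatibility of
  the two become statements about fibres of composites, and what does not match formally is what the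
  involutions cancel. Signs enter only through transpositions of list positions. The maps of the
  definitions act on whole cosets without choosing representatives, so each has to be computed on
  representatives before anything can be proved about it. One level up, limit maps and connecting
  maps use an arbitrary admissible index or all of them, and intersecting two relations shows that
  the index does not matter. For the subspace this works because the trace commutes with
  intersection: if the trace of \<open>U'\<close> is contained in that of \<open>U\<close>, then
  \<open>U \<inter> U'\<close> has exactly the trace of \<open>U'\<close>. Exactness does not pass
  to inverse limits in this way, because preimages found at each \<open>U\<close> need not form a
  compatible family.\<close>

definition fin_supp :: "('g, 'm) monoid_scheme \<Rightarrow> ('x \<Rightarrow> 'g) \<Rightarrow> bool" where
  "fin_supp G c \<longleftrightarrow> (\<forall>x. c x \<in> carrier G) \<and> finite {x. c x \<noteq> \<one>\<^bsub>G\<^esub>}"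

text \<open>The pushforward of \<open>c\<close> along \<open>\<pi>\<close>. \<open>gfinprod\<close>
  ignores the points where \<open>c\<close> is trivial, so infinite fibres such as that of all
  \<open>v # ys\<close> are harmless.\<close>

definition push :: "('g, 'm) monoid_scheme \<Rightarrow> ('x \<Rightarrow> 'y) \<Rightarrow> ('x \<Rightarrow> 'g) \<Rightarrow> 'y \<Rightarrow> 'g" where
  "push G \<pi> c y = gfinprod G c {x. \<pi> x = y}"

lemma chain_map_eq_push:
  "chain_map G f c = (\<lambda>ys. if distinct ys then push G (map f) c ys else \<one>\<^bsub>G\<^esub>)"
  by (auto simp: chain_map_def push_def fun_eq_iff)

context comm_group
begin

text \<open>A single finite \<open>S\<close> around the support serves all fibres at once, which
  turns them into disjoint pieces of one finite set.\<close>

lemma push_eq_finprod: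
  assumes "fin_supp G c" "finite S" "{x. c x \<noteq> \<one>} \<subseteq> S"
  shows "push G \<pi> c y = finprod G c {x \<in> S. \<pi> x = y}"
proof -
  have "push G \<pi> c y = finprod G c {x. \<pi> x = y \<and> c x \<noteq> \<one>}"
    using assms by (auto simp: push_def gfinprod_def fin_supp_def elim: rev_finite_subset)
  also have "\<dots> = finprod G c {x \<in> S. \<pi> x = y}"
    using assms by (intro finprod_mono_neutral_cong_left) (auto simp: fin_supp_def)
  finally show ?thesis .
qed

lemma push_closed: "fin_supp G c \<Longrightarrow> push G \<pi> c y \<in> carrier G"
  by (auto simp: push_def fin_supp_def)

lemma push_neq_oneD:
  assumes "push G \<pi> c y \<noteq> \<one>"
  obtains x where "\<pi> x = y" "c x \<noteq> \<one>"
proof -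
  have "\<exists>x. \<pi> x = y \<and> c x \<noteq> \<one>"
  proof (rule ccontr)
    assume *: "\<nexists>x. \<pi> x = y \<and> c x \<noteq> \<one>"
    then have "{x. \<pi> x = y \<and> c x \<noteq> \<one>} = {}" by blast
    then have "push G \<pi> c y = \<one>" by (auto simp: push_def gfinprod_def intro: finprod_one_eqI)
    with assms show False by simp
  qed
  with that show thesis by blast
qed

lemma fin_supp_push:
  assumes "fin_supp G c"
  shows "fin_supp G (push G \<pi> c)"
proof -
  have "{y. push G \<pi> c y \<noteq> \<one>} \<subseteq> \<pi> ` {x. c x \<noteq> \<one>}"
    by (auto elim!: push_neq_oneD)
  then have "finite {y. push G \<pi> c y \<noteq> \<one>}"
    using assms by (auto simp: fin_supp_def intro: finite_subset)
  then show ?thesis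
    by (simp add: fin_supp_def push_closed[OF assms])
qed

text \<open>The fibre of the composite over \<open>z\<close> is the disjoint union of the fibres of
  \<open>\<pi>\<close> over the points of the fibre of \<open>\<rho>\<close>.\<close>

lemma push_push:
  assumes c: "fin_supp G c"
  shows "push G \<rho> (push G \<pi> c) z = push G (\<lambda>x. \<rho> (\<pi> x)) c z"
proof -
  define S where "S = {x. c x \<noteq> \<one>}"
  have S: "finite S" "{x. c x \<noteq> \<one>} \<subseteq> S"
    using c by (auto simp: S_def fin_supp_def)
  have cl: "c x \<in> carrier G" for x
    using c by (simp add: fin_supp_def)
  \<comment> \<open>The inner pushforward is trivial outside the image of \<open>S\<close> under
    \<open>\<pi>\<close>, so this image can serve as the finite set for the outer product.\<close>
  have "push G \<rho> (push G \<pi> c) z = finprod G (push G \<pi> c) {y \<in> \<pi> ` S. \<rho> y = z}"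
    using S c by (intro push_eq_finprod fin_supp_push) (auto simp: S_def elim!: push_neq_oneD)
  also have "\<dots> = finprod G (\<lambda>y. finprod G c {x \<in> S. \<pi> x = y}) {y \<in> \<pi> ` S. \<rho> y = z}"
    using cl by (intro finprod_cong') (auto simp: push_eq_finprod[OF c S])
  also have "\<dots> = finprod G c (\<Union>y\<in>{y \<in> \<pi> ` S. \<rho> y = z}. {x \<in> S. \<pi> x = y})"
    using S cl by (intro finprod_UN_disjoint[symmetric]) (auto simp: pairwise_def disjnt_def)
  also have "(\<Union>y\<in>{y \<in> \<pi> ` S. \<rho> y = z}. {x \<in> S. \<pi> x = y}) = {x \<in> S. \<rho> (\<pi> x) = z}"
    by auto
  also have "finprod G c \<dots> = push G (\<lambda>x. \<rho> (\<pi> x)) c z"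
    by (rule push_eq_finprod[OF c S, symmetric])
  finally show ?thesis .
qed

lemma push_mult:
  assumes "fin_supp G c" "fin_supp G d"
  shows "push G \<pi> (\<lambda>x. c x \<otimes> d x) y = push G \<pi> c y \<otimes> push G \<pi> d y"
  unfolding push_def using assms
  by (intro gfinprod_distrib) (auto simp: fin_supp_def elim: rev_finite_subset)

text \<open>Lets a pushforward ignore case distinctions that do not occur in the fibre, such as the
  clauses for \<open>[]\<close> or for lists with repetitions.\<close>

lemma push_cong:
  assumes "\<And>x. \<pi> x = y \<Longrightarrow> c x = d x" "\<And>x. d x \<in> carrier G"
  shows "push G \<pi> c y = push G \<pi> d y"
proof -
  have "{x. \<pi> x = y \<and> c x \<noteq> \<one>} = {x. \<pi> x = y \<and> d x \<noteq> \<one>}"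
    using assms by auto
  moreover have "finprod G c {x. \<pi> x = y \<and> d x \<noteq> \<one>} = finprod G d {x. \<pi> x = y \<and> d x \<noteq> \<one>}"
    using assms by (intro finprod_cong') auto
  ultimately show ?thesis
    by (simp add: push_def gfinprod_def)
qed

text \<open>For \<open>ys \<noteq> []\<close> the lists with tail \<open>ys\<close> are exactly the
  \<open>v # ys\<close>. Over \<open>[]\<close> the fibre of \<open>tl\<close> also contains
  \<open>[]\<close> itself, but there the boundary is trivial by convention.\<close>

lemma boundary_eq_push:
  assumes "fin_supp G c"
  shows "boundary G c = (\<lambda>ys. if ys = [] then \<one> else push G tl c ys)"
proof
  fix ys
  show "boundary G c ys = (if ys = [] then \<one> else push G tl c ys)"
  proof (cases "ys = []")
    case False
    then have eq: "{x. tl x = ys \<and> c x \<noteq> \<one>} = (\<lambda>v. v # ys) ` {v. c (v # ys) \<noteq> \<one>}"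
      by (auto simp: image_iff) (metis list.collapse list.sel(2))
    have "finprod G c ((\<lambda>v. v # ys) ` {v. c (v # ys) \<noteq> \<one>}) =
        finprod G (\<lambda>v. c (v # ys)) {v. c (v # ys) \<noteq> \<one>}"
      using assms by (intro finprod_reindex) (auto simp: inj_on_def fin_supp_def)
    moreover have "finite {v. c (v # ys) \<noteq> \<one>}"
      using assms finite_vimageI[of "{x. c x \<noteq> \<one>}" "\<lambda>v. v # ys"]
      by (simp add: fin_supp_def inj_def vimage_def)
    ultimately show ?thesis
      using False by (simp add: boundary_def push_def gfinprod_def eq)
  qed (simp add: boundary_def)
qed

lemma push_one: "push G \<pi> (\<lambda>x. \<one>) y = \<one>"
  by (simp add: push_def gfinprod_def)

lemma finprod_inv:
  assumes "c \<in> S \<rightarrow> carrier G"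
  shows "finprod G (\<lambda>x. inv (c x)) S = inv (finprod G c S)"
proof (cases "finite S")
  case True
  then show ?thesis
    using assms by (induction S) (auto simp: inv_mult Pi_iff)
qed simp

text \<open>\<open>\<sigma>\<close> is a bijection from the support in the fibre over
  \<open>y\<close> to the support in the fibre over \<open>\<tau> y\<close>, and it inverts every
  factor. With swaps of list positions for \<open>\<sigma>\<close> and \<open>\<tau>\<close> this
  shows that pushforwards of alternating functions alternate.\<close>

lemma push_flip:
  assumes c: "fin_supp G c"
    and \<sigma>: "\<And>x. c x \<noteq> \<one> \<Longrightarrow> \<sigma> (\<sigma> x) = x \<and> \<pi> (\<sigma> x) = \<tau> (\<pi> x) \<and> c (\<sigma> x) = inv (c x)"
    and y: "\<tau> (\<tau> y) = y"
  shows "push G \<pi> c (\<tau> y) = inv (push G \<pi> c y)"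
proof -
  define S where "S = {x. c x \<noteq> \<one>}"
  have S: "finite S" "{x. c x \<noteq> \<one>} \<subseteq> S"
    using c by (auto simp: S_def fin_supp_def)
  have cl: "c x \<in> carrier G" for x
    using c by (simp add: fin_supp_def)
  \<comment> \<open>An inverse is trivial only if the element is, so \<open>\<sigma>\<close> stays
    inside the support.\<close>
  have \<sigma>S: "\<sigma> x \<in> S" if "x \<in> S" for x
    using \<sigma>[of x] that cl[of x] by (simp add: S_def inv_eq_1_iff)
  have inj: "inj_on \<sigma> {x \<in> S. \<pi> x = y}"
    by (rule inj_on_inverseI[of _ \<sigma>]) (use \<sigma> S_def in auto)
  have im: "\<sigma> ` {x \<in> S. \<pi> x = y} = {x \<in> S. \<pi> x = \<tau> y}"
  proof (intro equalityI subsetI)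
    fix x assume "x \<in> {x \<in> S. \<pi> x = \<tau> y}"
    then have "x = \<sigma> (\<sigma> x)" "\<sigma> x \<in> {x \<in> S. \<pi> x = y}"
      using \<sigma>[of x] \<sigma>S[of x] y by (auto simp: S_def)
    then show "x \<in> \<sigma> ` {x \<in> S. \<pi> x = y}" by blast
  qed (use \<sigma> \<sigma>S S_def in auto)
  have "push G \<pi> c (\<tau> y) = finprod G c (\<sigma> ` {x \<in> S. \<pi> x = y})"
    by (simp add: im push_eq_finprod[OF c S])
  also have "\<dots> = finprod G (\<lambda>x. c (\<sigma> x)) {x \<in> S. \<pi> x = y}"
    using cl inj by (intro finprod_reindex) auto
  also have "\<dots> = finprod G (\<lambda>x. inv (c x)) {x \<in> S. \<pi> x = y}"
    using \<sigma> cl by (intro finprod_cong') (auto simp: S_def)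
  also have "\<dots> = inv (push G \<pi> c y)"
    using cl by (simp add: finprod_inv push_eq_finprod[OF c S])
  finally show ?thesis .
qed

text \<open>Remove the points in pairs \<open>x\<close>, \<open>\<sigma> x\<close>, whose factors
  are mutually inverse. A fixed point would only satisfy \<open>c x = inv (c x)\<close>, which still
  allows elements of order two, so fixed points are excluded.\<close>

lemma finprod_involution:
  assumes "finite S" "c \<in> S \<rightarrow> carrier G"
    and "\<And>x. x \<in> S \<Longrightarrow> \<sigma> x \<in> S \<and> \<sigma> x \<noteq> x \<and> \<sigma> (\<sigma> x) = x \<and> c (\<sigma> x) = inv (c x)"
  shows "finprod G c S = \<one>"
  using assms
proof (induction S rule: finite_psubset_induct)
  case (psubset S)
  show ?case
  proof (cases "S = {}")
    case False
    then obtain x where x: "x \<in> S" by blast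
    define T where "T = S - {x, \<sigma> x}"
    have T: "finite T" "T \<subset> S" "c \<in> T \<rightarrow> carrier G"
      using psubset.hyps psubset.prems(1) x by (auto simp: T_def)
    have "\<sigma> z \<in> T" if "z \<in> T" for z
      using psubset.prems(2)[of z] psubset.prems(2)[OF x] that by (auto simp: T_def)
    then have one: "finprod G c T = \<one>"
      using psubset.prems(2) T by (intro psubset.IH) auto
    have \<sigma>x: "\<sigma> x \<in> S" "\<sigma> x \<noteq> x" "c (\<sigma> x) = inv (c x)"
      using psubset.prems(2)[OF x] by auto
    have "S = insert x (insert (\<sigma> x) T)" "x \<notin> insert (\<sigma> x) T" "\<sigma> x \<notin> T"
      using \<sigma>x x by (auto simp: T_def)
    then have "finprod G c S = c x \<otimes> (c (\<sigma> x) \<otimes> finprod G c T)"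
      using T \<sigma>x x psubset.prems(1) by (simp add: Pi_iff)
    also have "\<dots> = \<one>"
      using \<sigma>x x psubset.prems(1) by (simp add: one Pi_iff)
    finally show ?thesis .
  qed simp
qed

lemma push_cancel:
  assumes c: "fin_supp G c"
    and \<sigma>: "\<And>x. c x \<noteq> \<one> \<Longrightarrow> \<pi> x = y \<Longrightarrow> \<sigma> x \<noteq> x \<and> \<sigma> (\<sigma> x) = x \<and> \<pi> (\<sigma> x) = y \<and> c (\<sigma> x) = inv (c x)"
  shows "push G \<pi> c y = \<one>"
proof -
  define S where "S = {x. c x \<noteq> \<one>}"
  have S: "finite S" "{x. c x \<noteq> \<one>} \<subseteq> S"
    using c by (auto simp: S_def fin_supp_def)
  have cl: "c x \<in> carrier G" for x
    using c by (simp add: fin_supp_def)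
  show ?thesis
    unfolding push_eq_finprod[OF c S]
    by (rule finprod_involution[where \<sigma> = \<sigma>]) (use S cl \<sigma> in \<open>auto simp: S_def inv_eq_1_iff\<close>)
qed

end

section \<open>Chains\<close>

abbreviation swap_list :: "nat \<Rightarrow> nat \<Rightarrow> 'a list \<Rightarrow> 'a list" where
  "swap_list i j \<equiv> permute_list (Transposition.transpose i j)"

lemma transpose_permutes_lessThan: "i < n \<Longrightarrow> j < n \<Longrightarrow> Transposition.transpose i j permutes {..<n}"
  by (rule permutes_swap_id) auto

lemma swap_list_swap_list [simp]:
  "i < length xs \<Longrightarrow> j < length xs \<Longrightarrow> swap_list i j (swap_list i j xs) = xs"
  by (metis permute_list_compose permute_list_id transpose_comp_involutory transpose_permutes_lessThan length_permute_list)

lemma nth_swap_list: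
  "i < length xs \<Longrightarrow> j < length xs \<Longrightarrow> k < length xs \<Longrightarrow>
   swap_list i j xs ! k = xs ! Transposition.transpose i j k"
  by (simp add: permute_list_def)

lemma swap_list_neq:
  assumes "distinct xs" "i < length xs" "j < length xs" "i \<noteq> j"
  shows "swap_list i j xs \<noteq> xs"
proof
  assume "swap_list i j xs = xs"
  then have "xs ! j = xs ! i"
    using assms nth_swap_list[of i xs j i] by simp
  with assms show False
    by (simp add: nth_eq_iff_index_eq)
qed

text \<open>Transpositions generate all permutations and are odd, so alternation can be tested on
  one swap at a time, and only where \<open>c\<close> is nontrivial. This is the form in which
  closure properties of chains are checked.\<close>

lemma (in comm_group) chains_iff:
  "c \<in> chains G n K \<longleftrightarrow> fin_supp G c \<and> (\<forall>xs. c xs \<noteq> \<one> \<longrightarrow> xs \<in> ordered_simplices n K) \<and>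
    (\<forall>xs i j. c xs \<noteq> \<one> \<longrightarrow> i < length xs \<longrightarrow> j < length xs \<longrightarrow> i \<noteq> j \<longrightarrow> c (swap_list i j xs) = inv (c xs))"
    (is "?l \<longleftrightarrow> ?r")
proof
  assume ?l
  then show ?r
    by (auto simp: chains_def fin_supp_def)
      (metis evenperm_swap transpose_permutes_lessThan)
next
  assume r: ?r
  then have cl: "c xs \<in> carrier G" for xs
    by (simp add: fin_supp_def)
  have swap_inv: "c (swap_list i j xs) = inv (c xs)" if "i < length xs" "j < length xs" "i \<noteq> j" for xs i j
  proof (cases "c xs = \<one>")
    case True
    \<comment> \<open>If the swapped value were nontrivial, the hypothesis could be applied to the
      swapped list; swapping back would make \<open>c xs\<close> the inverse of a nontrivial
      element.\<close>
    have "c (swap_list i j xs) = \<one>"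
    proof (rule ccontr)
      assume *: "c (swap_list i j xs) \<noteq> \<one>"
      then have "c (swap_list i j (swap_list i j xs)) = inv (c (swap_list i j xs))"
        using r that by (metis length_permute_list)
      then have "c xs = inv (c (swap_list i j xs))"
        using that by simp
      with * True that cl show False by (simp add: inv_eq_1_iff)
    qed
    with True show ?thesis by simp
  qed (use r that in auto)
  have "c (permute_list p xs) = (if evenperm p then c xs else inv (c xs))"
    if "p permutes {..<length xs}" for p xs
    using finite_lessThan that
  proof (induction rule: permutes_rev_induct)
    case (swap a b p)
    \<comment> \<open>Composing the permutation with a transposition swaps two entries of the
      already permuted list, which matches the change of parity.\<close>
    have "c (permute_list (p \<circ> Transposition.transpose a b) xs) = c (swap_list a b (permute_list p xs))"
      using swap.hyps by (simp add: permute_list_compose transpose_permutes_lessThan)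
    also have "\<dots> = inv (c (permute_list p xs))"
      using swap.hyps by (intro swap_inv) auto
    finally have *: "c (permute_list (p \<circ> Transposition.transpose a b) xs) = inv (c (permute_list p xs))" .
    have "permutation p"
      using swap.hyps(4) finite_lessThan unfolding permutation_permutes by blast
    then have ev: "evenperm (p \<circ> Transposition.transpose a b) \<longleftrightarrow> \<not> evenperm p"
      using swap.hyps(3) by (simp add: evenperm_comp evenperm_swap permutation_swap_id)
    show ?case
      unfolding * ev swap.IH by (simp add: cl)
  qed simp
  with r show ?l
    unfolding chains_def fin_supp_def by blast
qed

lemma (in comm_group) chains_fin_supp: "c \<in> chains G n K \<Longrightarrow> fin_supp G c"
  by (simp add: chains_iff)

lemma (in comm_group) chainsD:
  assumes "c \<in> chains G n K" "c xs \<noteq> \<one>"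
  shows "xs \<in> ordered_simplices n K" "distinct xs" "set xs \<in> K" "int (length xs) = n + 1"
  using assms by (auto simp: chains_iff ordered_simplices_def)

lemma (in comm_group) chains_swap:
  assumes "c \<in> chains G n K" "c xs \<noteq> \<one>" "i < length xs" "j < length xs" "i \<noteq> j"
  shows "c (swap_list i j xs) = inv (c xs)"
  using assms by (auto simp: chains_iff)

section \<open>Complexes closed under faces, boundaries and induced chain maps\<close>

definition down_closed :: "'a set set \<Rightarrow> bool" where
  "down_closed K \<longleftrightarrow> (\<forall>s\<in>K. \<forall>t. t \<subseteq> s \<longrightarrow> t \<noteq> {} \<longrightarrow> t \<in> K)"

definition simp_map :: "('a \<Rightarrow> 'b) \<Rightarrow> 'a set set \<Rightarrow> 'b set set \<Rightarrow> bool" where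
  "simp_map f K K' \<longleftrightarrow> (\<forall>s\<in>K. f ` s \<in> K')"

context comm_group
begin

lemma chains_mono: "L \<subseteq> K \<Longrightarrow> chains G n L \<subseteq> chains G n K"
  by (fastforce simp: chains_iff ordered_simplices_def)

text \<open>A list \<open>ys\<close> in the support of the boundary is the tail of a simplex
  \<open>v # ys\<close> and is nonempty by the clause for \<open>[]\<close>, so it spans a face.
  Swapping positions of \<open>ys\<close> lifts to swapping the positions shifted by one.\<close>

lemma boundary_closed:
  assumes c: "c \<in> chains G n K" and K: "down_closed K"
  shows "boundary G c \<in> chains G (n - 1) K"
proof -
  note fs = chains_fin_supp[OF c]
  note eq = boundary_eq_push[OF fs]
  have "fin_supp G (push G tl c)"
    by (rule fin_supp_push[OF fs])
  then have "fin_supp G (boundary G c)"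
    unfolding eq fin_supp_def by (auto elim: rev_finite_subset)
  moreover have "ys \<in> ordered_simplices (n - 1) K" if "boundary G c ys \<noteq> \<one>" for ys
  proof -
    have ys: "ys \<noteq> []" "push G tl c ys \<noteq> \<one>"
      using that by (auto simp: eq split: if_splits)
    then obtain xs where xs: "tl xs = ys" "c xs \<noteq> \<one>"
      by (auto elim: push_neq_oneD)
    with ys obtain v where "xs = v # ys"
      by (cases xs) auto
    with chainsD[OF c xs(2)] ys K show ?thesis
      by (auto simp: ordered_simplices_def down_closed_def)
  qed
  moreover have "boundary G c (swap_list i j ys) = inv (boundary G c ys)"
    if "boundary G c ys \<noteq> \<one>" "i < length ys" "j < length ys" "i \<noteq> j" for ys i j
  proof -
    have ys: "ys \<noteq> []"
      using that by auto
    have lys: "int (length ys) = n"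
      using calculation(2)[OF that(1)] by (simp add: ordered_simplices_def)
    have "push G tl c (swap_list i j ys) = inv (push G tl c ys)"
    proof (rule push_flip[OF fs, where \<sigma> = "swap_list (Suc i) (Suc j)"])
      fix xs assume xs: "c xs \<noteq> \<one>"
      then have l: "length xs = Suc (length ys)"
        using chainsD(4)[OF c xs] lys by simp
      have "tl (swap_list (Suc i) (Suc j) xs) = swap_list i j (tl xs)"
        using l that by (intro nth_equalityI) (auto simp: nth_tl nth_swap_list Transposition.transpose_def)
      then show "swap_list (Suc i) (Suc j) (swap_list (Suc i) (Suc j) xs) = xs \<and>
          tl (swap_list (Suc i) (Suc j) xs) = swap_list i j (tl xs) \<and>
          c (swap_list (Suc i) (Suc j) xs) = inv (c xs)"
        using chains_swap[OF c xs, of "Suc i" "Suc j"] l that by simp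
    qed (use that in simp)
    moreover have "swap_list i j ys \<noteq> []"
      using ys by (metis length_permute_list length_0_conv)
    ultimately show ?thesis
      using ys by (simp add: eq)
  qed
  ultimately show ?thesis
    by (simp add: chains_iff)
qed

text \<open>The lists that end in \<open>ys\<close> after two leading vertices come in pairs
  \<open>u # v # ys\<close> and \<open>v # u # ys\<close>, on which an alternating function takes
  inverse values.\<close>

lemma boundary_boundary:
  assumes c: "c \<in> chains G n K"
  shows "boundary G (boundary G c) = (\<lambda>_. \<one>)"
proof
  fix ys :: "'c list"
  note fs = chains_fin_supp[OF c]
  note eq = boundary_eq_push[OF fs]
  have fs': "fin_supp G (boundary G c)"
    using fin_supp_push[OF fs, of tl] unfolding eq fin_supp_def by (auto elim: rev_finite_subset)
  show "boundary G (boundary G c) ys = \<one>"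
  proof (cases "ys = []")
    case False
    have "boundary G (boundary G c) ys = push G tl (boundary G c) ys"
      using False by (simp add: boundary_eq_push[OF fs'])
    \<comment> \<open>A list whose tail is the nonempty \<open>ys\<close> is itself nonempty, so the
      clause for \<open>[]\<close> never applies in this fibre.\<close>
    also have "\<dots> = push G tl (push G tl c) ys"
      using False fs by (intro push_cong push_closed) (auto simp: eq)
    also have "\<dots> = push G (\<lambda>xs. tl (tl xs)) c ys"
      by (rule push_push[OF fs])
    also have "\<dots> = \<one>"
    proof (rule push_cancel[OF fs, where \<sigma> = "swap_list 0 1"])
      fix xs assume xs: "c xs \<noteq> \<one>" "tl (tl xs) = ys"
      then obtain u v where uv: "xs = u # v # ys"
        using False by (metis list.collapse list.sel(2))
      have "tl (tl (swap_list 0 1 xs)) = ys"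
        by (intro nth_equalityI) (auto simp: uv nth_tl nth_swap_list Transposition.transpose_def)
      then show "swap_list 0 1 xs \<noteq> xs \<and> swap_list 0 1 (swap_list 0 1 xs) = xs \<and>
          tl (tl (swap_list 0 1 xs)) = ys \<and> c (swap_list 0 1 xs) = inv (c xs)"
        using chains_swap[OF c xs(1), of 0 1] swap_list_neq[of xs 0 1] chainsD(2)[OF c xs(1)] uv
        by simp
    qed
    finally show ?thesis .
  qed (simp add: boundary_def)
qed

text \<open>Lists in a fibre of \<open>map f\<close> have the length of their image, so the same
  swap of positions works on both sides. Since only images without repetitions are kept, they are
  simplices of the same dimension.\<close>

lemma chain_map_closed:
  assumes c: "c \<in> chains G n K" and f: "simp_map f K K'"
  shows "chain_map G f c \<in> chains G n K'"
proof -
  note fs = chains_fin_supp[OF c]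
  have "fin_supp G (push G (map f) c)"
    by (rule fin_supp_push[OF fs])
  then have "fin_supp G (chain_map G f c)"
    unfolding chain_map_eq_push fin_supp_def by (auto elim: rev_finite_subset)
  moreover have "ys \<in> ordered_simplices n K'" if "chain_map G f c ys \<noteq> \<one>" for ys
  proof -
    have ys: "distinct ys" "push G (map f) c ys \<noteq> \<one>"
      using that by (auto simp: chain_map_eq_push split: if_splits)
    then obtain xs where xs: "map f xs = ys" "c xs \<noteq> \<one>"
      by (auto elim: push_neq_oneD)
    with chainsD[OF c xs(2)] ys f show ?thesis
      by (auto simp: ordered_simplices_def simp_map_def)
  qed
  moreover have "chain_map G f c (swap_list i j ys) = inv (chain_map G f c ys)"
    if "chain_map G f c ys \<noteq> \<one>" "i < length ys" "j < length ys" "i \<noteq> j" for ys i j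
  proof -
    have ys: "distinct ys" "int (length ys) = n + 1"
      using calculation(2)[OF that(1)] by (auto simp add: ordered_simplices_def)
    have "push G (map f) c (swap_list i j ys) = inv (push G (map f) c ys)"
    proof (rule push_flip[OF fs, where \<sigma> = "swap_list i j"])
      fix xs assume xs: "c xs \<noteq> \<one>"
      then have l: "length xs = length ys"
        using chainsD(4)[OF c xs] ys by simp
      then show "swap_list i j (swap_list i j xs) = xs \<and>
          map f (swap_list i j xs) = swap_list i j (map f xs) \<and> c (swap_list i j xs) = inv (c xs)"
        using chains_swap[OF c xs, of i j] that
        by (simp add: permute_list_map transpose_permutes_lessThan)
    qed (use that in simp)
    then show ?thesis
      using ys that by (simp add: chain_map_eq_push transpose_permutes_lessThan)
  qed
  ultimately show ?thesis
    by (simp add: chains_iff)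
qed

text \<open>If \<open>map g zs\<close> has distinct entries, so does \<open>zs\<close>; discarding
  degenerate lists at the intermediate stage therefore loses nothing that survives to the
  end.\<close>

lemma chain_map_comp:
  assumes c: "c \<in> chains G n K"
  shows "chain_map G (g \<circ> f) c = chain_map G g (chain_map G f c)"
proof
  fix ys
  note fs = chains_fin_supp[OF c]
  have "push G (map g) (chain_map G f c) ys = push G (map (g \<circ> f)) c ys" if "distinct ys"
  proof -
    have "push G (map g) (chain_map G f c) ys = push G (map g) (push G (map f) c) ys"
      using that fs by (intro push_cong push_closed) (auto simp: chain_map_eq_push distinct_map)
    also have "\<dots> = push G (map (g \<circ> f)) c ys"
      by (simp add: push_push[OF fs] comp_def)
    finally show ?thesis .
  qed
  then show "chain_map G (g \<circ> f) c ys = chain_map G g (chain_map G f c) ys"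
    unfolding chain_map_eq_push[of G g] chain_map_eq_push[of G "g \<circ> f"] by auto
qed

lemma chain_map_id:
  assumes c: "c \<in> chains G n K"
  shows "chain_map G id c = c"
proof
  fix ys
  have "push G (map id) c ys = c ys"
    using chains_fin_supp[OF c] by (simp add: push_def fin_supp_def)
  then show "chain_map G id c ys = c ys"
    using chainsD(2)[OF c, of ys] by (cases "c ys = \<one>") (auto simp: chain_map_eq_push)
qed

text \<open>
  A simplex of the form \<open>u # us\<close> whose image is degenerate only because \<open>f u = f (us ! i)\<close>
  cancels against the one with \<open>u\<close> and \<open>us ! i\<close> interchanged.
\<close>

lemma boundary_chain_map:
  assumes c: "c \<in> chains G n K"
  shows "boundary G (chain_map G f c) = chain_map G f (boundary G c)"
proof
  fix ys
  note fs = chains_fin_supp[OF c]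
  have cl: "c x \<in> carrier G" for x
    using fs by (simp add: fin_supp_def)
  have fs': "fin_supp G (chain_map G f c)"
    using fin_supp_push[OF fs, of "map f"] unfolding chain_map_eq_push fin_supp_def
    by (auto elim: rev_finite_subset)
  \<comment> \<open>\<open>c1\<close> carries the simplices with nondegenerate image and
    \<open>c2\<close> those that \<open>f\<close> collapses; together they recover \<open>c\<close>.
    The plain pushforward of \<open>c1\<close> is already the whole chain map.\<close>
  define c1 where "c1 = (\<lambda>xs. if distinct (map f xs) then c xs else \<one>)"
  define c2 where "c2 = (\<lambda>xs. if distinct (map f xs) then \<one> else c xs)"
  have fs1: "fin_supp G c1" "fin_supp G c2"
    using fs by (auto simp: fin_supp_def c1_def c2_def elim: rev_finite_subset)
  have f1: "chain_map G f c = push G (map f) c1"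
  proof
    fix zs
    show "chain_map G f c zs = push G (map f) c1 zs"
    proof (cases "distinct zs")
      case True
      then show ?thesis
        using fs1 by (auto simp: chain_map_eq_push c1_def intro!: push_cong cl)
    next
      case False
      then have "push G (map f) c1 zs = push G (map f) (\<lambda>_. \<one>) zs"
        by (intro push_cong) (auto simp: c1_def)
      with False show ?thesis
        by (simp add: chain_map_eq_push push_one)
    qed
  qed
  show "boundary G (chain_map G f c) ys = chain_map G f (boundary G c) ys"
  proof (cases "ys = [] \<or> \<not> distinct ys")
    case True
    \<comment> \<open>Both sides are trivial on these lists: on \<open>[]\<close> by convention, and
      if \<open>ys\<close> has a repetition then so has every list with tail
      \<open>ys\<close>.\<close>
    have "push G (map f) (boundary G c) [] = \<one>"
    proof -
      have "push G (map f) (boundary G c) [] = push G (map f) (\<lambda>_. \<one>) []"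
        by (intro push_cong) (auto simp: boundary_def)
      then show ?thesis by (simp add: push_one)
    qed
    moreover have "push G tl (chain_map G f c) ys = \<one>" if "\<not> distinct ys"
    proof -
      have "push G tl (chain_map G f c) ys = push G tl (\<lambda>_. \<one>) ys"
        using that by (intro push_cong) (auto simp: chain_map_def distinct_tl)
      then show ?thesis by (simp add: push_one)
    qed
    ultimately show ?thesis
      using True by (auto simp: boundary_eq_push[OF fs'] chain_map_eq_push[of G f "boundary G c"])
  next
    case False
    have "boundary G (chain_map G f c) ys = push G tl (push G (map f) c1) ys"
      using False by (simp add: boundary_eq_push[OF fs'[unfolded f1]] f1)
    also have "\<dots> = push G (\<lambda>xs. tl (map f xs)) c1 ys"
      by (rule push_push[OF fs1(1)])
    \<comment> \<open>The collapsed simplices may be added back, because they contribute nothing to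
      the coefficient of \<open>ys\<close>.\<close>
    also have "\<dots> = push G (\<lambda>xs. tl (map f xs)) c1 ys \<otimes> push G (\<lambda>xs. tl (map f xs)) c2 ys"
    proof -
      \<comment> \<open>The least later position whose vertex has the same image as the first one.
        It depends only on \<open>map f xs\<close>, which the swap leaves fixed, and this makes the
        swap an involution.\<close>
      define k where "k xs = (LEAST k. 0 < k \<and> k < length (map f xs) \<and> map f xs ! k = map f xs ! 0)" for xs
      have "push G (\<lambda>xs. tl (map f xs)) c2 ys = \<one>"
      proof (rule push_cancel[OF fs1(2), where \<sigma> = "\<lambda>xs. swap_list 0 (k xs) xs"])
        fix xs assume xs: "c2 xs \<noteq> \<one>" "tl (map f xs) = ys"
        then have nd: "\<not> distinct (map f xs)" and cx: "c xs \<noteq> \<one>"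
          by (auto simp: c2_def split: if_splits)
        obtain u us where u: "xs = u # us"
          using nd by (cases xs) auto
        \<comment> \<open>The tail of the image is \<open>ys\<close>, which has no repetition, so
          the repetition must involve the first vertex.\<close>
        with nd xs False have "f u \<in> set (map f us)"
          by auto
        then obtain i where i: "i < length us" "f u = f (us ! i)"
          by (auto simp: in_set_conv_nth)
        have ne: "xs \<noteq> []"
          by (simp add: u)
        have h0: "map f xs ! 0 = f (xs ! 0)"
          by (simp add: u)
        from i have "\<exists>k. 0 < k \<and> k < length (map f xs) \<and> map f xs ! k = map f xs ! 0"
          by (intro exI[of _ "Suc i"]) (auto simp: u)
        from LeastI_ex[OF this] have k: "0 < k xs" "k xs < length xs" "f (xs ! k xs) = f (xs ! 0)"
          unfolding k_def[symmetric] by (auto simp: h0)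
        let ?xs = "swap_list 0 (k xs) xs"
        have m: "map f ?xs = map f xs"
        proof (rule nth_equalityI)
          fix i assume "i < length (map f ?xs)"
          then show "map f ?xs ! i = map f xs ! i"
            using k nth_swap_list[of 0 xs "k xs" i] by (cases "xs = []"; cases "i = 0"; cases "i = k xs") auto
        qed simp
        have "k zs = k xs" if "map f zs = map f xs" for zs
          by (simp only: k_def that)
        from this[OF m] have "k ?xs = k xs" .
        moreover have "c ?xs = inv (c xs)"
          using chains_swap[OF c cx, of 0 "k xs"] k ne by auto
        moreover have "?xs \<noteq> xs"
          using swap_list_neq[of xs 0 "k xs"] chainsD(2)[OF c cx] k ne by auto
        ultimately show "?xs \<noteq> xs \<and> swap_list 0 (k ?xs) ?xs = xs \<and> tl (map f ?xs) = ys \<and> c2 ?xs = inv (c2 xs)"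
          using k m nd xs(2) ne by (simp add: c2_def)
      qed
      then show ?thesis
        by (simp add: push_closed[OF fs1(1)])
    qed
    also have "\<dots> = push G (\<lambda>xs. tl (map f xs)) (\<lambda>xs. c1 xs \<otimes> c2 xs) ys"
      by (rule push_mult[OF fs1, symmetric])
    also have "(\<lambda>xs. c1 xs \<otimes> c2 xs) = c"
      using cl by (auto simp: c1_def c2_def)
    also have "push G (\<lambda>xs. tl (map f xs)) c ys = push G (map f) (push G tl c) ys"
      by (simp add: push_push[OF fs] map_tl)
    also have "\<dots> = push G (map f) (boundary G c) ys"
      using False fs by (intro push_cong[symmetric] push_closed[OF fs])
        (auto simp: boundary_eq_push[OF fs])
    also have "\<dots> = chain_map G f (boundary G c) ys"
      using False by (simp add: chain_map_eq_push)
    finally show ?thesis .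
  qed
qed

section \<open>Additivity, the chain groups and truncation to a subcomplex\<close>

lemma boundary_mult:
  assumes "c \<in> chains G n K" "d \<in> chains G m L"
  shows "boundary G (\<lambda>xs. c xs \<otimes> d xs) = (\<lambda>xs. boundary G c xs \<otimes> boundary G d xs)"
proof -
  have fs: "fin_supp G c" "fin_supp G d"
    using assms by (auto intro: chains_fin_supp)
  have "{x. c x \<otimes> d x \<noteq> \<one>} \<subseteq> {x. c x \<noteq> \<one>} \<union> {x. d x \<noteq> \<one>}"
    by auto
  then have "fin_supp G (\<lambda>xs. c xs \<otimes> d xs)"
    using fs by (auto simp: fin_supp_def intro: finite_subset)
  with fs show ?thesis
    by (auto simp: boundary_eq_push push_mult)
qed

lemma chain_map_mult:
  assumes "c \<in> chains G n K" "d \<in> chains G m L"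
  shows "chain_map G f (\<lambda>xs. c xs \<otimes> d xs) = (\<lambda>xs. chain_map G f c xs \<otimes> chain_map G f d xs)"
  using assms[THEN chains_fin_supp] by (auto simp: chain_map_eq_push push_mult)

lemma chain_group_simps [simp]:
  "carrier (chain_group G n K) = chains G n K"
  "c \<otimes>\<^bsub>chain_group G n K\<^esub> d = (\<lambda>xs. c xs \<otimes> d xs)"
  "\<one>\<^bsub>chain_group G n K\<^esub> = (\<lambda>_. \<one>)"
  by (simp_all add: chain_group_def)

lemma chains_mult_closed:
  assumes "c \<in> chains G n K" "d \<in> chains G n K"
  shows "(\<lambda>xs. c xs \<otimes> d xs) \<in> chains G n K"
proof -
  have "{x. c x \<otimes> d x \<noteq> \<one>} \<subseteq> {x. c x \<noteq> \<one>} \<union> {x. d x \<noteq> \<one>}"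
    by auto
  then have "finite {x. c x \<otimes> d x \<noteq> \<one>}"
    using assms by (auto simp: chains_def intro: finite_subset)
  with assms show ?thesis
    by (auto simp: chains_def inv_mult)
qed

lemma one_chain: "(\<lambda>_. \<one>) \<in> chains G n K"
  by (simp add: chains_def)

lemma inv_chain:
  assumes "c \<in> chains G n K"
  shows "(\<lambda>xs. inv (c xs)) \<in> chains G n K"
  using assms by (auto simp: chains_def inv_eq_1_iff)

lemma comm_group_chain_group: "comm_group (chain_group G n K)"
proof (rule comm_groupI)
  fix c d
  assume "c \<in> carrier (chain_group G n K)" "d \<in> carrier (chain_group G n K)"
  then show "c \<otimes>\<^bsub>chain_group G n K\<^esub> d \<in> carrier (chain_group G n K)"
    by (simp add: chains_mult_closed)
next
  have cl: "c xs \<in> carrier G" if "c \<in> chains G n K" for c xs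
    using that by (simp add: chains_def)
  fix c d e
  assume "c \<in> carrier (chain_group G n K)" "d \<in> carrier (chain_group G n K)" "e \<in> carrier (chain_group G n K)"
  then show "c \<otimes>\<^bsub>chain_group G n K\<^esub> d \<otimes>\<^bsub>chain_group G n K\<^esub> e =
      c \<otimes>\<^bsub>chain_group G n K\<^esub> (d \<otimes>\<^bsub>chain_group G n K\<^esub> e)"
    by (simp add: m_assoc cl)
next
  fix c
  assume "c \<in> carrier (chain_group G n K)"
  then show "\<exists>d\<in>carrier (chain_group G n K). d \<otimes>\<^bsub>chain_group G n K\<^esub> c = \<one>\<^bsub>chain_group G n K\<^esub>"
    by (intro bexI[of _ "\<lambda>xs. inv (c xs)"]) (auto simp: inv_chain chains_def)
qed (auto simp: one_chain m_comm chains_def)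

text \<open>Splits the inclusion of chains degree by degree, but is in general not compatible with
  \<open>boundary\<close>: a simplex outside \<open>L\<close> can have faces in \<open>L\<close>.
  Hence a cocycle extended in this way need not be a cocycle, and the connecting homomorphism
  measures the failure.\<close>

definition proj :: "'c set set \<Rightarrow> ('c list \<Rightarrow> 'a) \<Rightarrow> 'c list \<Rightarrow> 'a" where
  "proj L c = (\<lambda>xs. if set xs \<in> L then c xs else \<one>)"

text \<open>Membership of \<open>set xs\<close> in \<open>L\<close> ignores the order of the
  vertices, so the truncated function still alternates.\<close>

lemma proj_closed: "c \<in> chains G n K \<Longrightarrow> proj L c \<in> chains G n L"
  by (auto simp: chains_iff proj_def ordered_simplices_def fin_supp_def transpose_permutes_lessThan
      split: if_splits elim: rev_finite_subset)

lemma proj_eq: "c \<in> chains G n L \<Longrightarrow> proj L c = c"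
  by (auto simp: chains_def proj_def ordered_simplices_def fun_eq_iff)

lemma proj_mult: "c \<in> chains G n K \<Longrightarrow> d \<in> chains G m K \<Longrightarrow>
    proj L (\<lambda>xs. c xs \<otimes> d xs) = (\<lambda>xs. proj L c xs \<otimes> proj L d xs)"
  by (auto simp: proj_def)

lemma chains_empty: "chains G n {} = {\<lambda>_. \<one>}"
  by (auto simp: chains_def ordered_simplices_def)

end

section \<open>Subquotients of commutative groups\<close>

text \<open>Homology and cohomology are both quotients of a subgroup \<open>Z\<close> by a subgroup
  \<open>B\<close> inside a commutative group of chains or cochains, so coset computations and
  induced homomorphisms are treated once for both.\<close>

locale subquotient = comm_group C for C (structure) +
  fixes Z B
  assumes Z: "subgroup Z C" and B: "subgroup B C" and BZ: "B \<subseteq> Z"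
begin

abbreviation quot where "quot \<equiv> C\<lparr>carrier := Z\<rparr> Mod B"

lemma ZD: "z \<in> Z \<Longrightarrow> z \<in> carrier C"
  using Z subgroup.mem_carrier by metis

lemma carrier_quot: "carrier quot = (\<lambda>z. B #> z) ` Z"
  by (auto simp: FactGroup_def RCOSETS_def r_coset_def)

lemma coset_mult:
  assumes "x \<in> Z" "y \<in> Z"
  shows "(B #> x) <#> (B #> y) = B #> (x \<otimes> y)"
proof -
  have "B \<lhd> C"
    using B by (rule subgroup_imp_normal)
  then have "(B #> x) <#> (B #> y) = B #> (x \<otimes> y)"
    using assms by (intro normal.rcos_sum ZD)
  then show ?thesis
    by simp
qed

lemma one_quot: "\<one>\<^bsub>quot\<^esub> = B"
  by (simp add: FactGroup_def)

lemma group_quot: "group quot"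
proof -
  have "comm_group (C\<lparr>carrier := Z\<rparr>)"
    using subgroup.subgroup_is_group[OF Z is_group] ZD
    by (intro group.group_comm_groupI) (auto simp: m_comm)
  moreover have "subgroup B (C\<lparr>carrier := Z\<rparr>)"
    using subgroup_incl[OF B Z BZ] .
  ultimately show ?thesis
    by (intro normal.factorgroup_is_group comm_group.subgroup_imp_normal)
qed

lemma coset_eq_one_iff: "x \<in> Z \<Longrightarrow> B #> x = B \<longleftrightarrow> x \<in> B"
  using B ZD by (metis coset_join1 coset_join2)

text \<open>Elements of the image of \<open>B #> z\<close> differ from \<open>m z\<close> by
  elements of \<open>B'\<close>, but they need not fill its coset; multiplying by \<open>B'\<close>
  completes it. This is the shape of \<open>homology_map\<close> and
  \<open>cohomology_map\<close>.\<close>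

lemma coset_image:
  assumes "subquotient C' Z' B'" "\<And>x. x \<in> Z \<Longrightarrow> m x \<in> Z'"
    and "\<And>x y. x \<in> Z \<Longrightarrow> y \<in> Z \<Longrightarrow> m (x \<otimes> y) = m x \<otimes>\<^bsub>C'\<^esub> m y"
    and "\<And>x. x \<in> B \<Longrightarrow> m x \<in> B'" and z: "z \<in> Z"
  shows "B' <#>\<^bsub>C'\<^esub> (m ` (B #> z)) = B' #>\<^bsub>C'\<^esub> m z"
proof -
  interpret Q: subquotient C' Z' B' by fact
  have B'D: "b \<in> carrier C'" if "b \<in> B'" for b
    using that Q.BZ Q.ZD by blast
  show ?thesis
  proof (intro equalityI subsetI)
    fix w assume "w \<in> B' <#>\<^bsub>C'\<^esub> (m ` (B #> z))"
    then obtain b' b where b: "b' \<in> B'" "b \<in> B" "w = b' \<otimes>\<^bsub>C'\<^esub> m (b \<otimes> z)"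
      by (auto simp: set_mult_def r_coset_def)
    then have "w = (b' \<otimes>\<^bsub>C'\<^esub> m b) \<otimes>\<^bsub>C'\<^esub> m z"
      using assms BZ B'D Q.ZD by (auto simp: Q.m_assoc subset_iff)
    moreover have "b' \<otimes>\<^bsub>C'\<^esub> m b \<in> B'"
      using b assms Q.B by (auto intro: subgroup.m_closed)
    ultimately show "w \<in> B' #>\<^bsub>C'\<^esub> m z"
      by (auto simp: r_coset_def)
  next
    fix w assume "w \<in> B' #>\<^bsub>C'\<^esub> m z"
    then obtain b' where b': "b' \<in> B'" "w = b' \<otimes>\<^bsub>C'\<^esub> m z"
      by (auto simp: r_coset_def)
    have "z \<in> B #> z"
      using B z ZD by (simp add: rcos_self)
    with b' show "w \<in> B' <#>\<^bsub>C'\<^esub> (m ` (B #> z))"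
      by (auto simp: set_mult_def)
  qed
qed

text \<open>Here \<open>q\<close> is any map on cosets that \<open>m\<close> computes on
  representatives; well-definedness is contained in the last assumption. This also covers the
  connecting maps, whose shape differs from that of induced maps.\<close>

lemma quot_hom:
  assumes "subquotient C' Z' B'" "\<And>x. x \<in> Z \<Longrightarrow> m x \<in> Z'"
    and "\<And>x y. x \<in> Z \<Longrightarrow> y \<in> Z \<Longrightarrow> m (x \<otimes> y) = m x \<otimes>\<^bsub>C'\<^esub> m y"
    and "\<And>z. z \<in> Z \<Longrightarrow> q (B #> z) = B' #>\<^bsub>C'\<^esub> m z"
  shows "q \<in> hom quot (C'\<lparr>carrier := Z'\<rparr> Mod B')"
proof -
  interpret Q: subquotient C' Z' B' by fact
  have "x \<otimes> y \<in> Z" if "x \<in> Z" "y \<in> Z" for x y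
    using Z that by (rule subgroup.m_closed)
  then show ?thesis
    using assms(2-) by (auto simp: hom_def carrier_quot Q.carrier_quot coset_mult Q.coset_mult)
qed

end

section \<open>Homology of a simplicial pair\<close>

definition simp_pair :: "'a set set \<Rightarrow> 'a set set \<Rightarrow> bool" where
  "simp_pair K L \<longleftrightarrow> down_closed K \<and> down_closed L \<and> L \<subseteq> K"

definition homology_class ::
  "('g, 'm) monoid_scheme \<Rightarrow> int \<Rightarrow> 'a set set \<Rightarrow> 'a set set \<Rightarrow> ('a list \<Rightarrow> 'g) \<Rightarrow> ('a list \<Rightarrow> 'g) set" where
  "homology_class G n K L c = rel_boundaries G n K L #>\<^bsub>chain_group G n K\<^esub> c"

lemma simp_pair_empty: "simp_pair K L \<Longrightarrow> simp_pair K {}" "simp_pair K L \<Longrightarrow> simp_pair L {}"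
  by (auto simp: simp_pair_def down_closed_def)

lemma simp_map_empty [simp]: "simp_map f {} L"
  by (simp add: simp_map_def)

lemma simp_map_id [simp]: "simp_map id K L \<longleftrightarrow> K \<subseteq> L"
  by (auto simp: simp_map_def)

context comm_group
begin

lemma subgroup_chains:
  assumes "H \<subseteq> chains G n K" "(\<lambda>_. \<one>) \<in> H"
    and "\<And>c d. c \<in> H \<Longrightarrow> d \<in> H \<Longrightarrow> (\<lambda>xs. c xs \<otimes> inv (d xs)) \<in> H"
  shows "subgroup H (chain_group G n K)"
proof -
  interpret C: comm_group "chain_group G n K" by (rule comm_group_chain_group)
  have inv_eq: "inv\<^bsub>chain_group G n K\<^esub> c = (\<lambda>xs. inv (c xs))" if "c \<in> chains G n K" for c
    using that inv_chain[OF that] by (intro C.inv_equality) (auto simp: chains_def)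
  have inv: "(\<lambda>xs. inv (c xs)) \<in> H" if "c \<in> H" for c
  proof -
    have "(\<lambda>xs. \<one> \<otimes> inv (c xs)) = (\<lambda>xs. inv (c xs))"
      using assms(1) that by (auto simp: chains_def)
    then show ?thesis
      using assms(3)[OF assms(2) that] by simp
  qed
  show ?thesis
  proof (rule C.subgroupI)
    fix c d assume cd: "c \<in> H" "d \<in> H"
    have "(\<lambda>xs. c xs \<otimes> inv (inv (d xs))) = (\<lambda>xs. c xs \<otimes> d xs)"
      using assms(1) cd by (auto simp: chains_def)
    then show "c \<otimes>\<^bsub>chain_group G n K\<^esub> d \<in> H"
      using assms(3)[OF cd(1) inv[OF cd(2)]] by simp
  next
    fix c assume "c \<in> H"
    then show "inv\<^bsub>chain_group G n K\<^esub> c \<in> H"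
      using inv assms(1) by (simp add: inv_eq subset_iff)
  qed (use assms in auto)
qed

lemma boundary_one: "boundary G (\<lambda>_. \<one>) = (\<lambda>_. \<one>)"
  by (auto simp: boundary_def gfinprod_def fun_eq_iff)

lemma boundary_inv:
  assumes "c \<in> chains G n K"
  shows "boundary G (\<lambda>xs. inv (c xs)) = (\<lambda>xs. inv (boundary G c xs))"
proof
  fix ys :: "'c list"
  have "boundary G (\<lambda>xs. c xs \<otimes> inv (c xs)) = (\<lambda>xs. boundary G c xs \<otimes> boundary G (\<lambda>xs. inv (c xs)) xs)"
    by (rule boundary_mult[OF assms inv_chain[OF assms]])
  moreover have "(\<lambda>xs. c xs \<otimes> inv (c xs)) = (\<lambda>_. \<one>)"
    using assms by (auto simp: chains_def)
  ultimately have "boundary G c ys \<otimes> boundary G (\<lambda>xs. inv (c xs)) ys = \<one>"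
    by (simp add: boundary_one fun_eq_iff)
  moreover have "boundary G c ys \<in> carrier G" "boundary G (\<lambda>xs. inv (c xs)) ys \<in> carrier G"
    using assms by (auto simp: boundary_def chains_def)
  ultimately show "boundary G (\<lambda>xs. inv (c xs)) ys = inv (boundary G c ys)"
    using inv_equality m_comm by metis
qed

lemma boundary_div:
  assumes "c \<in> chains G n K" "d \<in> chains G n K"
  shows "boundary G (\<lambda>xs. c xs \<otimes> inv (d xs)) = (\<lambda>xs. boundary G c xs \<otimes> inv (boundary G d xs))"
  using boundary_mult[OF assms(1) inv_chain[OF assms(2)]] boundary_inv[OF assms(2)] by simp

lemma chains_div_closed:
  assumes "c \<in> chains G n K" "d \<in> chains G n K"
  shows "(\<lambda>xs. c xs \<otimes> inv (d xs)) \<in> chains G n K"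
  by (rule chains_mult_closed[OF assms(1) inv_chain[OF assms(2)]])

lemma boundary_carrier: "c \<in> chains G n K \<Longrightarrow> boundary G c xs \<in> carrier G"
  by (auto simp: boundary_def chains_def)

lemma rel_boundaries_eq:
  "rel_boundaries G n K L = {\<lambda>xs. boundary G d xs \<otimes> e xs | d e. d \<in> chains G (n + 1) K \<and> e \<in> chains G n L}"
  by (simp add: rel_boundaries_def)

lemma rel_boundariesI:
  "d \<in> chains G (n + 1) K \<Longrightarrow> e \<in> chains G n L \<Longrightarrow> c = (\<lambda>xs. boundary G d xs \<otimes> e xs) \<Longrightarrow>
   c \<in> rel_boundaries G n K L"
  by (auto simp: rel_boundaries_eq)

text \<open>The boundary of \<open>boundary G d\<close> vanishes, so only the boundary of
  \<open>e\<close> remains, and that is a chain of \<open>L\<close>.\<close>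

lemma rel_boundaries_subset_cycles:
  assumes "simp_pair K L"
  shows "rel_boundaries G n K L \<subseteq> rel_cycles G n K L"
proof
  fix c assume "c \<in> rel_boundaries G n K L"
  then obtain d e where de: "d \<in> chains G (n + 1) K" "e \<in> chains G n L"
    and c: "c = (\<lambda>xs. boundary G d xs \<otimes> e xs)"
    by (auto simp: rel_boundaries_eq)
  have bd: "boundary G d \<in> chains G n K"
    using boundary_closed[OF de(1)] assms by (simp add: simp_pair_def)
  have be: "boundary G e \<in> chains G (n - 1) L"
    using boundary_closed[OF de(2)] assms by (simp add: simp_pair_def)
  have eK: "e \<in> chains G n K"
    using chains_mono[of L K n] assms de by (auto simp: simp_pair_def)
  have "boundary G c = boundary G e"
    using boundary_mult[OF bd eK] boundary_boundary[OF de(1)] boundary_carrier[OF eK]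
    by (simp add: c)
  then show "c \<in> rel_cycles G n K L"
    using chains_mult_closed[OF bd eK] be by (simp add: rel_cycles_def c)
qed

lemma subquotient_homology:
  assumes "simp_pair K L"
  shows "subquotient (chain_group G n K) (rel_cycles G n K L) (rel_boundaries G n K L)"
proof -
  interpret C: comm_group "chain_group G n K" by (rule comm_group_chain_group)
  note bc = rel_boundaries_subset_cycles[OF assms, of n]
  show ?thesis
  proof (intro subquotient.intro subquotient_axioms.intro comm_group_chain_group)
    show "subgroup (rel_cycles G n K L) (chain_group G n K)"
    proof (rule subgroup_chains)
      fix c d assume "c \<in> rel_cycles G n K L" "d \<in> rel_cycles G n K L"
      then show "(\<lambda>xs. c xs \<otimes> inv (d xs)) \<in> rel_cycles G n K L"
        by (auto simp: rel_cycles_def boundary_div intro: chains_div_closed)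
    qed (auto simp: rel_cycles_def one_chain boundary_one)
    show "subgroup (rel_boundaries G n K L) (chain_group G n K)"
    proof (rule subgroup_chains)
      show "rel_boundaries G n K L \<subseteq> chains G n K"
        using bc by (auto simp: rel_cycles_def)
      show "(\<lambda>_. \<one>) \<in> rel_boundaries G n K L"
        by (auto simp: rel_boundaries_eq intro!: exI[of _ "\<lambda>_. \<one>"] simp: one_chain boundary_one)
      fix c c' assume "c \<in> rel_boundaries G n K L" "c' \<in> rel_boundaries G n K L"
      then obtain d e d' e' where de: "d \<in> chains G (n + 1) K" "e \<in> chains G n L"
          "d' \<in> chains G (n + 1) K" "e' \<in> chains G n L"
        and c: "c = (\<lambda>xs. boundary G d xs \<otimes> e xs)" "c' = (\<lambda>xs. boundary G d' xs \<otimes> e' xs)"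
        by (auto simp: rel_boundaries_eq)
      have e: "e xs \<in> carrier G" "e' xs \<in> carrier G" for xs
        using de by (auto simp: chains_def)
      have "(\<lambda>xs. c xs \<otimes> inv (c' xs)) =
          (\<lambda>xs. boundary G (\<lambda>xs. d xs \<otimes> inv (d' xs)) xs \<otimes> (e xs \<otimes> inv (e' xs)))"
        using e boundary_carrier[OF de(1)] boundary_carrier[OF de(3)]
        by (auto simp: c boundary_div[OF de(1,3)] inv_mult m_ac)
      then show "(\<lambda>xs. c xs \<otimes> inv (c' xs)) \<in> rel_boundaries G n K L"
        by (rule rel_boundariesI[OF chains_div_closed[OF de(1,3)] chains_div_closed[OF de(2,4)]])
    qed
  qed (use bc in auto)
qed

lemma group_homology: "simp_pair K L \<Longrightarrow> group (homology_group G n K L)"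
  unfolding homology_group_def by (intro subquotient.group_quot subquotient_homology)

lemma homology_carrierE:
  assumes "simp_pair K L" "S \<in> carrier (homology_group G n K L)"
  obtains c where "c \<in> rel_cycles G n K L" "S = homology_class G n K L c"
  using assms subquotient.carrier_quot[OF subquotient_homology[OF assms(1)]]
  unfolding homology_group_def homology_class_def by blast

lemma homology_one: "simp_pair K L \<Longrightarrow> \<one>\<^bsub>homology_group G n K L\<^esub> = rel_boundaries G n K L"
  unfolding homology_group_def by (intro subquotient.one_quot subquotient_homology)

lemma homology_class_one:
  assumes "simp_pair K L" "c \<in> rel_boundaries G n K L"
  shows "homology_class G n K L c = \<one>\<^bsub>homology_group G n K L\<^esub>"
proof -
  have "c \<in> rel_cycles G n K L"
    using assms rel_boundaries_subset_cycles by blast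
  then show ?thesis
    using assms subquotient.coset_eq_one_iff[OF subquotient_homology[OF assms(1)]]
    by (simp add: homology_class_def homology_one)
qed

lemma chain_map_rel_cycles:
  assumes "c \<in> rel_cycles G n K L" "simp_map f K K'" "simp_map f L L'"
  shows "chain_map G f c \<in> rel_cycles G n K' L'"
  using assms chain_map_closed by (auto simp: rel_cycles_def boundary_chain_map)

lemma chain_map_rel_boundaries:
  assumes "simp_pair K L" "c \<in> rel_boundaries G n K L" "simp_map f K K'" "simp_map f L L'"
  shows "chain_map G f c \<in> rel_boundaries G n K' L'"
proof -
  obtain d e where de: "d \<in> chains G (n + 1) K" "e \<in> chains G n L"
    and c: "c = (\<lambda>xs. boundary G d xs \<otimes> e xs)"
    using assms by (auto simp: rel_boundaries_eq)
  have bd: "boundary G d \<in> chains G n K"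
    using boundary_closed[OF de(1)] assms by (simp add: simp_pair_def)
  have "chain_map G f c = (\<lambda>xs. boundary G (chain_map G f d) xs \<otimes> chain_map G f e xs)"
    by (simp add: c chain_map_mult[OF bd de(2)] boundary_chain_map[OF de(1)])
  then show ?thesis
    by (rule rel_boundariesI[OF chain_map_closed[OF de(1) assms(3)] chain_map_closed[OF de(2) assms(4)]])
qed

lemma homology_map_class:
  assumes "simp_pair K L" "simp_pair K' L'" "simp_map f K K'" "simp_map f L L'"
    and "c \<in> rel_cycles G n K L"
  shows "homology_map G n K' L' f (homology_class G n K L c) = homology_class G n K' L' (chain_map G f c)"
  unfolding homology_map_def homology_class_def
proof (rule subquotient.coset_image[OF subquotient_homology[OF assms(1)] subquotient_homology[OF assms(2)]])
  fix c d assume "c \<in> rel_cycles G n K L" "d \<in> rel_cycles G n K L"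
  then show "chain_map G f (c \<otimes>\<^bsub>chain_group G n K\<^esub> d) =
      chain_map G f c \<otimes>\<^bsub>chain_group G n K'\<^esub> chain_map G f d"
    by (auto simp: rel_cycles_def chain_map_mult)
qed (use assms chain_map_rel_cycles chain_map_rel_boundaries in blast)+

lemma homology_map_hom:
  assumes "simp_pair K L" "simp_pair K' L'" "simp_map f K K'" "simp_map f L L'"
  shows "homology_map G n K' L' f \<in> hom (homology_group G n K L) (homology_group G n K' L')"
  unfolding homology_group_def
proof (rule subquotient.quot_hom[OF subquotient_homology[OF assms(1)] subquotient_homology[OF assms(2)]])
  show "homology_map G n K' L' f (rel_boundaries G n K L #>\<^bsub>chain_group G n K\<^esub> c) =
      rel_boundaries G n K' L' #>\<^bsub>chain_group G n K'\<^esub> chain_map G f c"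
    if "c \<in> rel_cycles G n K L" for c
    using homology_map_class[OF assms that] by (simp add: homology_class_def)
  fix c d assume "c \<in> rel_cycles G n K L" "d \<in> rel_cycles G n K L"
  then show "chain_map G f (c \<otimes>\<^bsub>chain_group G n K\<^esub> d) =
      chain_map G f c \<otimes>\<^bsub>chain_group G n K'\<^esub> chain_map G f d"
    by (auto simp: rel_cycles_def chain_map_mult)
qed (use assms chain_map_rel_cycles in blast)

lemma homology_map_id:
  assumes "simp_pair K L" "S \<in> carrier (homology_group G n K L)"
  shows "homology_map G n K L id S = S"
proof -
  obtain c where c: "c \<in> rel_cycles G n K L" "S = homology_class G n K L c"
    using homology_carrierE[OF assms] .
  with assms show ?thesis
    by (auto simp: homology_map_class chain_map_id rel_cycles_def)
qed

lemma homology_map_comp: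
  assumes "simp_pair K L" "simp_pair K' L'" "simp_pair K'' L''"
    and "simp_map f K K'" "simp_map f L L'" "simp_map g K' K''" "simp_map g L' L''"
    and "S \<in> carrier (homology_group G n K L)"
  shows "homology_map G n K'' L'' (g \<circ> f) S = homology_map G n K'' L'' g (homology_map G n K' L' f S)"
proof -
  obtain c where c: "c \<in> rel_cycles G n K L" "S = homology_class G n K L c"
    using homology_carrierE[OF assms(1,8)] .
  have "simp_map (g \<circ> f) K K''" "simp_map (g \<circ> f) L L''"
    using assms(4-7) unfolding simp_map_def image_comp[symmetric] by blast+
  moreover have "chain_map G (g \<circ> f) c = chain_map G g (chain_map G f c)"
    using c by (auto simp: rel_cycles_def intro: chain_map_comp)
  moreover have "chain_map G f c \<in> rel_cycles G n K' L'"
    using c assms by (intro chain_map_rel_cycles)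
  ultimately show ?thesis
    using assms(1-7) c by (simp add: homology_map_class)
qed

lemma rel_boundaries_empty: "rel_boundaries G n K {} = boundary G ` chains G (n + 1) K"
proof -
  have *: "(\<lambda>xs. boundary G d xs \<otimes> \<one>) = boundary G d" if "d \<in> chains G (n + 1) K" for d
    using boundary_carrier[OF that] by auto
  show ?thesis
  proof (intro equalityI subsetI)
    fix c assume "c \<in> boundary G ` chains G (n + 1) K"
    then obtain d where d: "d \<in> chains G (n + 1) K" "c = boundary G d"
      by blast
    with * show "c \<in> rel_boundaries G n K {}"
      by (intro rel_boundariesI[OF d(1) one_chain]) simp
  next
    fix c assume "c \<in> rel_boundaries G n K {}"
    then obtain d where d: "d \<in> chains G (n + 1) K" "c = (\<lambda>xs. boundary G d xs \<otimes> \<one>)"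
      by (auto simp: rel_boundaries_eq chains_empty)
    then show "c \<in> boundary G ` chains G (n + 1) K"
      by (simp add: *)
  qed
qed

section \<open>The connecting homomorphism in homology\<close>

lemma boundary_rel_cycle:
  assumes "c \<in> rel_cycles G n K L"
  shows "boundary G c \<in> rel_cycles G (n - 1) L {}"
proof -
  have "boundary G (boundary G c) = (\<lambda>_. \<one>)"
    using assms boundary_boundary unfolding rel_cycles_def by blast
  with assms show ?thesis
    by (simp add: rel_cycles_def one_chain)
qed

text \<open>An element of the class is the product of \<open>boundary G d\<close>, \<open>e\<close>
  and \<open>c\<close>, and its boundary is that of \<open>e\<close> times that of \<open>c\<close>.
  As \<open>e\<close> runs through all chains of \<open>L\<close>, this fills the coset of
  \<open>boundary G c\<close> without any saturation.\<close>

lemma homology_connecting_class: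
  assumes "simp_pair K L" "c \<in> rel_cycles G n K L"
  shows "homology_connecting G (homology_class G n K L c) = homology_class G (n - 1) L {} (boundary G c)"
proof -
  have c: "c \<in> chains G n K"
    using assms by (simp add: rel_cycles_def)
  have *: "boundary G (\<lambda>xs. (boundary G d xs \<otimes> e xs) \<otimes> c xs) = (\<lambda>xs. boundary G e xs \<otimes> boundary G c xs)"
    if de: "d \<in> chains G (n + 1) K" "e \<in> chains G n L" for d e
  proof -
    have bd: "boundary G d \<in> chains G n K"
      using boundary_closed[OF de(1)] assms by (simp add: simp_pair_def)
    have eK: "e \<in> chains G n K"
      using chains_mono[of L K n] assms de by (auto simp: simp_pair_def)
    show ?thesis
      using boundary_boundary[OF de(1)] boundary_carrier[OF eK]
      by (simp add: boundary_mult[OF chains_mult_closed[OF bd eK] c] boundary_mult[OF bd eK])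
  qed
  show ?thesis
  proof (intro equalityI subsetI)
    fix w assume "w \<in> homology_connecting G (homology_class G n K L c)"
    then obtain d e where "d \<in> chains G (n + 1) K" "e \<in> chains G n L"
      and w: "w = boundary G (\<lambda>xs. (boundary G d xs \<otimes> e xs) \<otimes> c xs)"
      by (auto simp: homology_connecting_def homology_class_def r_coset_def rel_boundaries_eq)
    with * have "w = (\<lambda>xs. boundary G e xs \<otimes> boundary G c xs)" "e \<in> chains G n L"
      by auto
    then show "w \<in> homology_class G (n - 1) L {} (boundary G c)"
      by (auto simp: homology_class_def rel_boundaries_empty r_coset_def)
  next
    fix w assume "w \<in> homology_class G (n - 1) L {} (boundary G c)"
    then obtain e where e: "e \<in> chains G n L" "w = (\<lambda>xs. boundary G e xs \<otimes> boundary G c xs)"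
      by (auto simp: homology_class_def rel_boundaries_empty r_coset_def)
    \<comment> \<open>A representative with trivial \<open>d\<close> already realises the prescribed
      element.\<close>
    then have "w = boundary G (\<lambda>xs. (boundary G (\<lambda>_. \<one>) xs \<otimes> e xs) \<otimes> c xs)"
      using *[OF one_chain e(1)] by simp
    then show "w \<in> homology_connecting G (homology_class G n K L c)"
      using e(1) one_chain[of "n + 1" K]
      by (auto simp: homology_connecting_def homology_class_def rel_boundaries_eq r_coset_def)
  qed
qed

lemma homology_connecting_hom:
  assumes "simp_pair K L"
  shows "homology_connecting G \<in> hom (homology_group G n K L) (homology_group G (n - 1) L {})"
  unfolding homology_group_def
proof (rule subquotient.quot_hom[OF subquotient_homology[OF assms]
      subquotient_homology[OF simp_pair_empty(2)[OF assms]], where m = "boundary G"])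
  show "homology_connecting G (rel_boundaries G n K L #>\<^bsub>chain_group G n K\<^esub> c) =
      rel_boundaries G (n - 1) L {} #>\<^bsub>chain_group G (n - 1) L\<^esub> boundary G c"
    if "c \<in> rel_cycles G n K L" for c
    using homology_connecting_class[OF assms that] by (simp add: homology_class_def)
  fix c d assume "c \<in> rel_cycles G n K L" "d \<in> rel_cycles G n K L"
  then show "boundary G (c \<otimes>\<^bsub>chain_group G n K\<^esub> d) =
      boundary G c \<otimes>\<^bsub>chain_group G (n - 1) L\<^esub> boundary G d"
    by (auto simp: rel_cycles_def boundary_mult)
qed (use boundary_rel_cycle in blast)

lemma homology_connecting_natural:
  assumes "simp_pair K L" "simp_pair K' L'" "simp_map f K K'" "simp_map f L L'"
    and "S \<in> carrier (homology_group G n K L)"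
  shows "homology_connecting G (homology_map G n K' L' f S) =
    homology_map G (n - 1) L' {} f (homology_connecting G S)"
proof -
  obtain c where c: "c \<in> rel_cycles G n K L" "S = homology_class G n K L c"
    using homology_carrierE[OF assms(1,5)] .
  have "homology_connecting G (homology_map G n K' L' f S) =
      homology_class G (n - 1) L' {} (boundary G (chain_map G f c))"
    using assms c by (simp add: homology_map_class homology_connecting_class chain_map_rel_cycles)
  also have "boundary G (chain_map G f c) = chain_map G f (boundary G c)"
    using c by (auto simp: rel_cycles_def boundary_chain_map)
  also have "homology_class G (n - 1) L' {} \<dots> = homology_map G (n - 1) L' {} f (homology_connecting G S)"
    using assms c boundary_rel_cycle[OF c(1)] simp_pair_empty(2)[OF assms(1)] simp_pair_empty(2)[OF assms(2)]
    by (simp add: homology_map_class homology_connecting_class)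
  finally show ?thesis .
qed

section \<open>Vanishing compositions in the homology of a simplicial pair\<close>

lemma homology_sub_total_rel:
  assumes "simp_pair K L" "S \<in> carrier (homology_group G n L {})"
  shows "homology_map G n K L id (homology_map G n K {} id S) = \<one>\<^bsub>homology_group G n K L\<^esub>"
proof -
  note p = simp_pair_empty[OF assms(1)]
  obtain c where c: "c \<in> rel_cycles G n L {}" "S = homology_class G n L {} c"
    using homology_carrierE[OF p(2) assms(2)] .
  have LK: "L \<subseteq> K"
    using assms by (simp add: simp_pair_def)
  have cL: "c \<in> chains G n L"
    using c by (simp add: rel_cycles_def)
  have cK: "c \<in> rel_cycles G n K {}"
    using c chains_mono[OF LK] by (auto simp: rel_cycles_def)
  have id: "chain_map G id c = c"
    using cL by (rule chain_map_id)
  \<comment> \<open>A chain of \<open>L\<close> is a relative boundary with trivial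
    \<open>d\<close>; this is what kills its class in the quotient.\<close>
  have "(\<lambda>xs. boundary G (\<lambda>_. \<one>) xs \<otimes> c xs) \<in> rel_boundaries G n K L"
    by (rule rel_boundariesI[OF one_chain cL refl])
  then have "c \<in> rel_boundaries G n K L"
    using cL by (simp add: boundary_one chains_def)
  then show ?thesis
    using p assms(1) LK cK c by (simp add: homology_map_class id homology_class_one)
qed

lemma homology_total_rel_connecting:
  assumes "simp_pair K L" "S \<in> carrier (homology_group G n K {})"
  shows "homology_connecting G (homology_map G n K L id S) = \<one>\<^bsub>homology_group G (n - 1) L {}\<^esub>"
proof -
  note p = simp_pair_empty[OF assms(1)]
  obtain c where c: "c \<in> rel_cycles G n K {}" "S = homology_class G n K {} c"
    using homology_carrierE[OF p(1) assms(2)] .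
  have cL: "c \<in> rel_cycles G n K L"
    using c chains_mono[of "{}" L "n - 1"] by (auto simp: rel_cycles_def)
  have id: "chain_map G id c = c"
    using c by (auto simp: rel_cycles_def intro: chain_map_id)
  \<comment> \<open>An absolute cycle, read as a relative one, has boundary trivial as a chain and
    not merely contained in \<open>L\<close>.\<close>
  have "boundary G c = (\<lambda>_. \<one>)"
    using c by (simp add: rel_cycles_def chains_empty)
  then have "boundary G c \<in> rel_boundaries G (n - 1) L {}"
    unfolding rel_boundaries_empty by (intro image_eqI[OF _ one_chain]) (simp add: boundary_one)
  then show ?thesis
    using p assms(1) cL c by (simp add: homology_map_class id homology_class_one homology_connecting_class)
qed

lemma homology_connecting_sub:
  assumes "simp_pair K L" "S \<in> carrier (homology_group G n K L)"
  shows "homology_map G (n - 1) K {} id (homology_connecting G S) = \<one>\<^bsub>homology_group G (n - 1) K {}\<^esub>"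
proof -
  note p = simp_pair_empty[OF assms(1)]
  obtain c where c: "c \<in> rel_cycles G n K L" "S = homology_class G n K L c"
    using homology_carrierE[OF assms] .
  have LK: "L \<subseteq> K"
    using assms by (simp add: simp_pair_def)
  have id: "chain_map G id (boundary G c) = boundary G c"
    using c by (auto simp: rel_cycles_def intro: chain_map_id)
  \<comment> \<open>In \<open>K\<close> the chain \<open>c\<close> itself bounds
    \<open>boundary G c\<close>, although \<open>c\<close> need not be a chain of
    \<open>L\<close>.\<close>
  have "boundary G c \<in> rel_boundaries G (n - 1) K {}"
    using c by (auto simp: rel_boundaries_empty rel_cycles_def)
  then show ?thesis
    using p assms(1) LK c boundary_rel_cycle[OF c(1)]
    by (simp add: homology_map_class homology_class_one homology_connecting_class id)
qed

end

section \<open>Cohomology of a simplicial pair\<close>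

text \<open>Cochains are homomorphisms on integral chains, so the results on chains are needed for
  the integers as well as for \<open>G\<close>.\<close>

interpretation ints: comm_group integer_group
  by (rule abelian_integer_group)

abbreviation int_chains :: "int \<Rightarrow> 'a set set \<Rightarrow> ('a list \<Rightarrow> int) set" where
  "int_chains \<equiv> chains integer_group"

lemmas int_boundary_closed = ints.boundary_closed
  and int_chain_map_closed = ints.chain_map_closed
  and int_chains_mono = ints.chains_mono

lemma int_chains_add: "c \<in> int_chains n K \<Longrightarrow> d \<in> int_chains n K \<Longrightarrow> (\<lambda>xs. c xs + d xs) \<in> int_chains n K"
  using ints.chains_mult_closed[of c n K d] by simp

lemma int_boundary_add:
  "c \<in> int_chains n K \<Longrightarrow> d \<in> int_chains n K \<Longrightarrow>
   boundary integer_group (\<lambda>xs. c xs + d xs) = (\<lambda>xs. boundary integer_group c xs + boundary integer_group d xs)"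
  using ints.boundary_mult[of c n K d n K] by simp

lemma int_chain_map_add:
  "c \<in> int_chains n K \<Longrightarrow> d \<in> int_chains n K \<Longrightarrow>
   chain_map integer_group f (\<lambda>xs. c xs + d xs) =
   (\<lambda>xs. chain_map integer_group f c xs + chain_map integer_group f d xs)"
  using ints.chain_map_mult[of c n K d n K] by simp

lemma int_proj_add:
  "c \<in> int_chains n K \<Longrightarrow> d \<in> int_chains n K \<Longrightarrow>
   ints.proj L (\<lambda>xs. c xs + d xs) = (\<lambda>xs. ints.proj L c xs + ints.proj L d xs)"
  using ints.proj_mult[of c n K d n L] by simp

lemma int_zero_chain: "(\<lambda>_. 0) \<in> int_chains n K"
  using ints.one_chain by simp

definition cohomology_class ::
  "('g, 'm) monoid_scheme \<Rightarrow> int \<Rightarrow> 'a set set \<Rightarrow> 'a set set \<Rightarrow>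
   (('a list \<Rightarrow> int) \<Rightarrow> 'g) \<Rightarrow> (('a list \<Rightarrow> int) \<Rightarrow> 'g) set" where
  "cohomology_class G n K L \<phi> = rel_coboundaries G n K L #>\<^bsub>cochain_group G n K L\<^esub> \<phi>"

text \<open>Extension by trivial values on the simplices outside \<open>L\<close>; the result is a
  homomorphism because \<open>proj\<close> is one.\<close>

definition extend_cochain ::
  "int \<Rightarrow> 'a set set \<Rightarrow> 'a set set \<Rightarrow> (('a list \<Rightarrow> int) \<Rightarrow> 'g) \<Rightarrow> ('a list \<Rightarrow> int) \<Rightarrow> 'g" where
  "extend_cochain n K L \<phi> = (\<lambda>c\<in>int_chains n K. \<phi> (ints.proj L c))"

context comm_group
begin

section \<open>Cochain groups and cochain maps\<close>

lemma cochains_iff: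
  "\<phi> \<in> cochains G n K L \<longleftrightarrow>
    (\<forall>c\<in>int_chains n K. \<phi> c \<in> carrier G) \<and>
    (\<forall>c\<in>int_chains n K. \<forall>d\<in>int_chains n K. \<phi> (\<lambda>xs. c xs + d xs) = \<phi> c \<otimes> \<phi> d) \<and>
    \<phi> \<in> extensional (int_chains n K) \<and> (\<forall>c\<in>int_chains n L. \<phi> c = \<one>)"
  by (auto simp: cochains_def hom_def)

lemma cochains_closed: "\<phi> \<in> cochains G n K L \<Longrightarrow> c \<in> int_chains n K \<Longrightarrow> \<phi> c \<in> carrier G"
  by (simp add: cochains_iff)

lemma cochains_vanish: "\<phi> \<in> cochains G n K L \<Longrightarrow> c \<in> int_chains n L \<Longrightarrow> \<phi> c = \<one>"
  by (simp add: cochains_iff)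

lemma cochains_zero:
  assumes "\<phi> \<in> cochains G n K L"
  shows "\<phi> (\<lambda>_. 0) = \<one>"
  using cochains_vanish[OF assms] int_zero_chain by blast

text \<open>The only chain of the empty complex is zero, and there additivity alone forces the
  value: an element equal to its own square is trivial.\<close>

lemma cochains_empty_iff:
  "\<phi> \<in> cochains G n K {} \<longleftrightarrow>
    (\<forall>c\<in>int_chains n K. \<phi> c \<in> carrier G) \<and>
    (\<forall>c\<in>int_chains n K. \<forall>d\<in>int_chains n K. \<phi> (\<lambda>xs. c xs + d xs) = \<phi> c \<otimes> \<phi> d) \<and>
    \<phi> \<in> extensional (int_chains n K)" (is "_ \<longleftrightarrow> ?r")
proof -
  have "\<phi> (\<lambda>_. 0) = \<one>" if r: ?r
  proof -
    have cl: "\<phi> (\<lambda>_. 0) \<in> carrier G"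
      using r int_zero_chain[of n K] by blast
    have "\<phi> (\<lambda>_. 0) = \<phi> (\<lambda>_. 0) \<otimes> \<phi> (\<lambda>_. 0)"
      using r[THEN conjunct2, THEN conjunct1, rule_format, OF int_zero_chain int_zero_chain] by simp
    then show ?thesis
      using cl by (metis l_cancel_one)
  qed
  then show ?thesis
    by (auto simp: cochains_iff ints.chains_empty)
qed

lemma cochains_subset: "cochains G n K L \<subseteq> cochains G n K {}"
  by (auto simp: cochains_iff ints.chains_empty int_zero_chain)

lemma cochain_group_simps [simp]:
  "carrier (cochain_group G n K L) = cochains G n K L"
  "\<phi> \<otimes>\<^bsub>cochain_group G n K L\<^esub> \<psi> = (\<lambda>c\<in>int_chains n K. \<phi> c \<otimes> \<psi> c)"
  "\<one>\<^bsub>cochain_group G n K L\<^esub> = (\<lambda>c\<in>int_chains n K. \<one>)"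
  by (simp_all add: cochain_group_def)

lemma cochains_mult_closed:
  assumes "\<phi> \<in> cochains G n K L" "\<psi> \<in> cochains G n K L" "L \<subseteq> K"
  shows "(\<lambda>c\<in>int_chains n K. \<phi> c \<otimes> \<psi> c) \<in> cochains G n K L"
  using assms ints.chains_mono[OF assms(3), of n]
  by (auto simp: cochains_iff int_chains_add m_ac)

lemma one_cochain: "L \<subseteq> K \<Longrightarrow> (\<lambda>c\<in>int_chains n K. \<one>) \<in> cochains G n K L"
  using ints.chains_mono[of L K n] by (auto simp: cochains_iff int_chains_add)

lemma inv_cochain:
  assumes "\<phi> \<in> cochains G n K L" "L \<subseteq> K"
  shows "(\<lambda>c\<in>int_chains n K. inv (\<phi> c)) \<in> cochains G n K L"
  using assms ints.chains_mono[OF assms(2), of n]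
  by (auto simp: cochains_iff int_chains_add inv_mult)

lemma comm_group_cochain_group:
  assumes "L \<subseteq> K"
  shows "comm_group (cochain_group G n K L)"
proof (rule comm_groupI)
  fix \<phi> \<psi>
  assume "\<phi> \<in> carrier (cochain_group G n K L)" "\<psi> \<in> carrier (cochain_group G n K L)"
  then show "\<phi> \<otimes>\<^bsub>cochain_group G n K L\<^esub> \<psi> \<in> carrier (cochain_group G n K L)"
    using assms by (simp add: cochains_mult_closed)
next
  fix \<phi> \<psi> \<theta>
  assume "\<phi> \<in> carrier (cochain_group G n K L)" "\<psi> \<in> carrier (cochain_group G n K L)"
    "\<theta> \<in> carrier (cochain_group G n K L)"
  then show "\<phi> \<otimes>\<^bsub>cochain_group G n K L\<^esub> \<psi> \<otimes>\<^bsub>cochain_group G n K L\<^esub> \<theta> =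
      \<phi> \<otimes>\<^bsub>cochain_group G n K L\<^esub> (\<psi> \<otimes>\<^bsub>cochain_group G n K L\<^esub> \<theta>)"
    by (auto simp: m_assoc cochains_iff intro!: restrict_ext)
next
  fix \<phi>
  assume "\<phi> \<in> carrier (cochain_group G n K L)"
  then show "\<exists>\<psi>\<in>carrier (cochain_group G n K L).
      \<psi> \<otimes>\<^bsub>cochain_group G n K L\<^esub> \<phi> = \<one>\<^bsub>cochain_group G n K L\<^esub>"
    using assms inv_cochain[of \<phi> n K L]
    by (intro bexI[of _ "\<lambda>c\<in>int_chains n K. inv (\<phi> c)"])
      (auto simp: cochains_closed intro!: restrict_ext)
next
  fix \<phi>
  assume "\<phi> \<in> carrier (cochain_group G n K L)"
  then show "\<one>\<^bsub>cochain_group G n K L\<^esub> \<otimes>\<^bsub>cochain_group G n K L\<^esub> \<phi> = \<phi>"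
    by (intro extensionalityI[of _ "int_chains n K"]) (auto simp: cochains_iff)
qed (use assms in \<open>auto simp: one_cochain m_comm cochains_closed intro!: restrict_ext\<close>)

lemma cochain_map_closed:
  assumes "\<phi> \<in> cochains G n K' L'" "simp_map f K K'" "simp_map f L L'" "L \<subseteq> K"
  shows "cochain_map n K f \<phi> \<in> cochains G n K L"
proof -
  note [simp] = int_chain_map_closed[OF _ assms(2), of _ n] int_chain_map_closed[OF _ assms(3), of _ n]
  have "c \<in> int_chains n K" if "c \<in> int_chains n L" for c
    using that int_chains_mono[OF assms(4)] by blast
  with assms(1) show ?thesis
    by (auto simp: cochains_iff cochain_map_def int_chains_add int_chain_map_add)
qed

lemma coboundary_closed:
  assumes "\<phi> \<in> cochains G n K L" "simp_pair K L"
  shows "coboundary n K \<phi> \<in> cochains G (n + 1) K L"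
proof -
  have K: "down_closed K" "down_closed L" "L \<subseteq> K"
    using assms by (auto simp: simp_pair_def)
  have b: "boundary integer_group c \<in> int_chains n M" if "c \<in> int_chains (n + 1) M" "down_closed M"
    for c and M :: "'c set set"
    using int_boundary_closed[OF that] by simp
  have "c \<in> int_chains (n + 1) K" if "c \<in> int_chains (n + 1) L" for c
    using that int_chains_mono[OF K(3)] by blast
  with assms(1) K b show ?thesis
    by (auto simp: cochains_iff coboundary_def int_chains_add int_boundary_add)
qed

lemma coboundary_coboundary:
  assumes "\<phi> \<in> cochains G n K L" "simp_pair K L"
  shows "coboundary (n + 1) K (coboundary n K \<phi>) = (\<lambda>c\<in>int_chains (n + 1 + 1) K. \<one>)"
proof -
  have "boundary integer_group c \<in> int_chains (n + 1) K" if "c \<in> int_chains (n + 1 + 1) K" for c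
    using int_boundary_closed[OF that] assms by (simp add: simp_pair_def ac_simps)
  then show ?thesis
    using cochains_zero[OF assms(1)] ints.boundary_boundary[of _ "n + 1 + 1" K]
    by (auto simp: coboundary_def intro!: restrict_ext)
qed

lemma coboundary_mult:
  assumes "down_closed K"
  shows "coboundary n K (\<lambda>c\<in>int_chains n K. \<phi> c \<otimes> \<psi> c) =
    (\<lambda>c\<in>int_chains (n + 1) K. coboundary n K \<phi> c \<otimes> coboundary n K \<psi> c)"
  using int_boundary_closed[OF _ assms, of _ "n + 1"]
  by (auto simp: coboundary_def intro!: restrict_ext)

lemma coboundary_inv:
  assumes "down_closed K"
  shows "coboundary n K (\<lambda>c\<in>int_chains n K. inv (\<phi> c)) =
    (\<lambda>c\<in>int_chains (n + 1) K. inv (coboundary n K \<phi> c))"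
  using int_boundary_closed[OF _ assms, of _ "n + 1"]
  by (auto simp: coboundary_def intro!: restrict_ext)

lemma coboundary_one:
  assumes "down_closed K"
  shows "coboundary n K (\<lambda>c\<in>int_chains n K. \<one>) = (\<lambda>c\<in>int_chains (n + 1) K. \<one>)"
  using int_boundary_closed[OF _ assms, of _ "n + 1"]
  by (auto simp: coboundary_def intro!: restrict_ext)

lemma cochain_map_mult:
  assumes "simp_map f K K'"
  shows "cochain_map n K f (\<lambda>c\<in>int_chains n K'. \<phi> c \<otimes> \<psi> c) =
    (\<lambda>c\<in>int_chains n K. cochain_map n K f \<phi> c \<otimes> cochain_map n K f \<psi> c)"
  using int_chain_map_closed[OF _ assms]
  by (auto simp: cochain_map_def intro!: restrict_ext)

lemma coboundary_cochain_map:
  assumes "simp_map f K K'" "down_closed K"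
  shows "coboundary n K (cochain_map n K f \<phi>) = cochain_map (n + 1) K f (coboundary n K' \<phi>)"
  using int_chain_map_closed[OF _ assms(1)] int_boundary_closed[OF _ assms(2), of _ "n + 1"]
  by (auto simp: cochain_map_def coboundary_def ints.boundary_chain_map intro!: restrict_ext)

lemma cochain_map_id:
  assumes "\<phi> \<in> cochains G n K L"
  shows "cochain_map n K id \<phi> = \<phi>"
  using assms ints.chain_map_id[of _ n K]
  by (intro extensionalityI[of _ "int_chains n K"]) (auto simp: cochain_map_def cochains_iff)

lemma cochain_map_id_restrict:
  "cochain_map n L id \<phi> = restrict \<phi> (int_chains n L)"
  using ints.chain_map_id[of _ n L] by (auto simp: cochain_map_def intro!: restrict_ext)

lemma cochain_map_comp:
  assumes "simp_map f K K'"
  shows "cochain_map n K (g \<circ> f) \<phi> = cochain_map n K f (cochain_map n K' g \<phi>)"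
  using int_chain_map_closed[OF _ assms]
  by (auto simp: cochain_map_def ints.chain_map_comp intro!: restrict_ext)

lemma coboundary_restrict:
  assumes "down_closed L" "L \<subseteq> K"
  shows "coboundary n L (restrict \<phi> (int_chains n L)) = restrict (coboundary n K \<phi>) (int_chains (n + 1) L)"
proof -
  have "c \<in> int_chains (n + 1) K" if "c \<in> int_chains (n + 1) L" for c
    using that int_chains_mono[OF assms(2)] by blast
  then show ?thesis
    using int_boundary_closed[OF _ assms(1), of _ "n + 1"]
    by (auto simp: coboundary_def intro!: restrict_ext)
qed

lemma restrict_cochain:
  assumes "\<phi> \<in> cochains G n K {}" "L \<subseteq> K"
  shows "restrict \<phi> (int_chains n L) \<in> cochains G n L {}"
  using assms int_chains_mono[OF assms(2), of n]
  by (auto simp: cochains_empty_iff int_chains_add subset_iff)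

lemma extend_cochain_closed:
  assumes "\<phi> \<in> cochains G n L {}"
  shows "extend_cochain n K L \<phi> \<in> cochains G n K {}"
  using assms ints.proj_closed[of _ n K L]
  by (auto simp: cochains_empty_iff extend_cochain_def int_chains_add int_proj_add)

lemma restrict_extend_cochain:
  assumes "\<phi> \<in> cochains G n L {}" "L \<subseteq> K"
  shows "restrict (extend_cochain n K L \<phi>) (int_chains n L) = \<phi>"
  using assms int_chains_mono[OF assms(2), of n] ints.proj_eq[of _ n L]
  by (intro extensionalityI[of _ "int_chains n L"])
    (auto simp: cochains_iff extend_cochain_def subset_iff)

section \<open>Cohomology groups and induced maps\<close>

lemma rel_cocycles_iff:
  "\<phi> \<in> rel_cocycles G n K L \<longleftrightarrow>
   \<phi> \<in> cochains G n K L \<and> coboundary n K \<phi> = (\<lambda>c\<in>int_chains (n + 1) K. \<one>)"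
  by (simp add: rel_cocycles_def)

lemma subgroup_cochains:
  assumes "L \<subseteq> K" "H \<subseteq> cochains G n K L" "(\<lambda>c\<in>int_chains n K. \<one>) \<in> H"
    and "\<And>\<phi> \<psi>. \<phi> \<in> H \<Longrightarrow> \<psi> \<in> H \<Longrightarrow> (\<lambda>c\<in>int_chains n K. \<phi> c \<otimes> \<psi> c) \<in> H"
    and "\<And>\<phi>. \<phi> \<in> H \<Longrightarrow> (\<lambda>c\<in>int_chains n K. inv (\<phi> c)) \<in> H"
  shows "subgroup H (cochain_group G n K L)"
proof -
  interpret C: comm_group "cochain_group G n K L"
    by (rule comm_group_cochain_group[OF assms(1)])
  have inv_eq: "inv\<^bsub>cochain_group G n K L\<^esub> \<phi> = (\<lambda>c\<in>int_chains n K. inv (\<phi> c))"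
    if "\<phi> \<in> cochains G n K L" for \<phi>
    using that inv_cochain[OF that assms(1)]
    by (intro C.inv_equality) (auto simp: cochains_closed intro!: restrict_ext)
  show ?thesis
    by (rule C.subgroupI) (use assms inv_eq in auto)
qed

lemma rel_coboundaries_subset_cocycles:
  assumes "simp_pair K L"
  shows "rel_coboundaries G n K L \<subseteq> rel_cocycles G n K L"
  using assms coboundary_closed[of _ "n - 1" K L] coboundary_coboundary[of _ "n - 1" K L]
  by (auto simp: rel_coboundaries_def rel_cocycles_iff)

lemma subquotient_cohomology:
  assumes "simp_pair K L"
  shows "subquotient (cochain_group G n K L) (rel_cocycles G n K L) (rel_coboundaries G n K L)"
proof -
  have K: "down_closed K" "L \<subseteq> K"
    using assms by (auto simp: simp_pair_def)
  note bc = rel_coboundaries_subset_cocycles[OF assms, of n]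
  show ?thesis
  proof (intro subquotient.intro subquotient_axioms.intro comm_group_cochain_group K bc)
    show "subgroup (rel_cocycles G n K L) (cochain_group G n K L)"
    proof (rule subgroup_cochains[OF K(2)])
      show "(\<lambda>c\<in>int_chains n K. \<phi> c \<otimes> \<psi> c) \<in> rel_cocycles G n K L"
        if "\<phi> \<in> rel_cocycles G n K L" "\<psi> \<in> rel_cocycles G n K L" for \<phi> \<psi>
        using that K by (auto simp: rel_cocycles_iff coboundary_mult cochains_mult_closed intro!: restrict_ext)
      show "(\<lambda>c\<in>int_chains n K. inv (\<phi> c)) \<in> rel_cocycles G n K L"
        if "\<phi> \<in> rel_cocycles G n K L" for \<phi>
        using that K by (auto simp: rel_cocycles_iff coboundary_inv inv_cochain intro!: restrict_ext)
    qed (use K in \<open>auto simp: rel_cocycles_iff one_cochain coboundary_one\<close>)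
    show "subgroup (rel_coboundaries G n K L) (cochain_group G n K L)"
    proof (rule subgroup_cochains[OF K(2)])
      show "rel_coboundaries G n K L \<subseteq> cochains G n K L"
        using bc by (auto simp: rel_cocycles_iff)
      show "(\<lambda>c\<in>int_chains n K. \<one>) \<in> rel_coboundaries G n K L"
        unfolding rel_coboundaries_def
        using coboundary_one[OF K(1), of "n - 1"] by (intro image_eqI[OF _ one_cochain[OF K(2)]]) simp
      show "(\<lambda>c\<in>int_chains n K. \<phi> c \<otimes> \<psi> c) \<in> rel_coboundaries G n K L"
        if \<phi>: "\<phi> \<in> rel_coboundaries G n K L" and \<psi>: "\<psi> \<in> rel_coboundaries G n K L" for \<phi> \<psi>
      proof -
        obtain \<alpha> \<beta> where ab: "\<alpha> \<in> cochains G (n - 1) K L" "\<beta> \<in> cochains G (n - 1) K L"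
          and eq: "\<phi> = coboundary (n - 1) K \<alpha>" "\<psi> = coboundary (n - 1) K \<beta>"
          using \<phi> \<psi> by (auto simp: rel_coboundaries_def)
        show ?thesis
          unfolding rel_coboundaries_def
          using coboundary_mult[OF K(1), of "n - 1" \<alpha> \<beta>]
          by (intro image_eqI[OF _ cochains_mult_closed[OF ab K(2)]]) (simp add: eq)
      qed
      show "(\<lambda>c\<in>int_chains n K. inv (\<phi> c)) \<in> rel_coboundaries G n K L"
        if \<phi>: "\<phi> \<in> rel_coboundaries G n K L" for \<phi>
      proof -
        obtain \<alpha> where a: "\<alpha> \<in> cochains G (n - 1) K L" and eq: "\<phi> = coboundary (n - 1) K \<alpha>"
          using \<phi> by (auto simp: rel_coboundaries_def)
        show ?thesis
          unfolding rel_coboundaries_def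
          using coboundary_inv[OF K(1), of "n - 1" \<alpha>]
          by (intro image_eqI[OF _ inv_cochain[OF a K(2)]]) (simp add: eq)
      qed
    qed
  qed
qed

lemma group_cohomology: "simp_pair K L \<Longrightarrow> group (cohomology_group G n K L)"
  unfolding cohomology_group_def by (intro subquotient.group_quot subquotient_cohomology)

lemma cohomology_carrierE:
  assumes "simp_pair K L" "S \<in> carrier (cohomology_group G n K L)"
  obtains \<phi> where "\<phi> \<in> rel_cocycles G n K L" "S = cohomology_class G n K L \<phi>"
  using assms subquotient.carrier_quot[OF subquotient_cohomology[OF assms(1)]]
  unfolding cohomology_group_def cohomology_class_def by blast

lemma cohomology_class_carrier:
  assumes "simp_pair K L" "\<phi> \<in> rel_cocycles G n K L"
  shows "cohomology_class G n K L \<phi> \<in> carrier (cohomology_group G n K L)"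
  using assms subquotient.carrier_quot[OF subquotient_cohomology[OF assms(1)]]
  unfolding cohomology_group_def cohomology_class_def by blast

lemma cohomology_one: "simp_pair K L \<Longrightarrow> \<one>\<^bsub>cohomology_group G n K L\<^esub> = rel_coboundaries G n K L"
  unfolding cohomology_group_def by (intro subquotient.one_quot subquotient_cohomology)

lemma cohomology_class_one_iff:
  assumes "simp_pair K L" "\<phi> \<in> rel_cocycles G n K L"
  shows "cohomology_class G n K L \<phi> = \<one>\<^bsub>cohomology_group G n K L\<^esub> \<longleftrightarrow> \<phi> \<in> rel_coboundaries G n K L"
  using assms subquotient.coset_eq_one_iff[OF subquotient_cohomology[OF assms(1)]]
  by (simp add: cohomology_class_def cohomology_one)

text \<open>For replacing a cocycle by a cohomologous one that is prescribed by its values on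
  chains, as when a cocycle is adjusted to vanish on a subcomplex.\<close>

lemma cohomology_class_eqI:
  assumes "simp_pair K L" "\<phi> \<in> rel_cocycles G n K L" "\<chi> \<in> cochains G (n - 1) K L"
    and "\<And>c. c \<in> int_chains n K \<Longrightarrow> \<psi> c = coboundary (n - 1) K \<chi> c \<otimes> \<phi> c"
    and "\<psi> \<in> extensional (int_chains n K)"
  shows "cohomology_class G n K L \<psi> = cohomology_class G n K L \<phi>" "\<psi> \<in> rel_cocycles G n K L"
proof -
  interpret Q: subquotient "cochain_group G n K L" "rel_cocycles G n K L" "rel_coboundaries G n K L"
    by (rule subquotient_cohomology[OF assms(1)])
  let ?d = "coboundary (n - 1) K \<chi>"
  have d: "?d \<in> rel_coboundaries G n K L"
    using assms(3) by (simp add: rel_coboundaries_def)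
  have eq: "\<psi> = ?d \<otimes>\<^bsub>cochain_group G n K L\<^esub> \<phi>"
    using assms(4,5) by (intro extensionalityI[of _ "int_chains n K"]) auto
  have c: "?d \<in> carrier (cochain_group G n K L)" "\<phi> \<in> carrier (cochain_group G n K L)"
    using d assms(2) Q.BZ Q.ZD by blast+
  show "\<psi> \<in> rel_cocycles G n K L"
    unfolding eq by (rule subgroup.m_closed[OF Q.Z subsetD[OF Q.BZ d] assms(2)])
  have "rel_coboundaries G n K L #>\<^bsub>cochain_group G n K L\<^esub> ?d = rel_coboundaries G n K L"
    using d Q.B c by (intro Q.coset_join2)
  then show "cohomology_class G n K L \<psi> = cohomology_class G n K L \<phi>"
    unfolding cohomology_class_def eq
    using Q.coset_mult_assoc[OF subgroup.subset[OF Q.B] c] by simp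
qed

lemma cochain_map_rel_cocycles:
  assumes "simp_pair K L" "\<phi> \<in> rel_cocycles G n K' L'" "simp_map f K K'" "simp_map f L L'"
  shows "cochain_map n K f \<phi> \<in> rel_cocycles G n K L"
proof -
  have K: "down_closed K" "L \<subseteq> K"
    using assms by (auto simp: simp_pair_def)
  have "coboundary n K (cochain_map n K f \<phi>) = cochain_map (n + 1) K f (\<lambda>c\<in>int_chains (n + 1) K'. \<one>)"
    using assms K by (simp add: coboundary_cochain_map rel_cocycles_iff)
  also have "\<dots> = (\<lambda>c\<in>int_chains (n + 1) K. \<one>)"
    using int_chain_map_closed[OF _ assms(3)] by (auto simp: cochain_map_def intro!: restrict_ext)
  finally show ?thesis
    using assms K by (auto simp: rel_cocycles_iff intro: cochain_map_closed)
qed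

lemma cochain_map_rel_coboundaries:
  assumes "simp_pair K L" "\<phi> \<in> rel_coboundaries G n K' L'" "simp_map f K K'" "simp_map f L L'"
  shows "cochain_map n K f \<phi> \<in> rel_coboundaries G n K L"
proof -
  have K: "down_closed K" "L \<subseteq> K"
    using assms by (auto simp: simp_pair_def)
  obtain \<alpha> where "\<alpha> \<in> cochains G (n - 1) K' L'" "\<phi> = coboundary (n - 1) K' \<alpha>"
    using assms by (auto simp: rel_coboundaries_def)
  then show ?thesis
    unfolding rel_coboundaries_def using assms K
    by (intro image_eqI[of _ _ "cochain_map (n - 1) K f \<alpha>"])
      (auto simp: coboundary_cochain_map intro: cochain_map_closed)
qed

lemma cohomology_map_class:
  assumes "simp_pair K L" "simp_pair K' L'" "simp_map f K K'" "simp_map f L L'"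
    and "\<phi> \<in> rel_cocycles G n K' L'"
  shows "cohomology_map G n K L f (cohomology_class G n K' L' \<phi>) =
    cohomology_class G n K L (cochain_map n K f \<phi>)"
  unfolding cohomology_map_def cohomology_class_def
proof (rule subquotient.coset_image[OF subquotient_cohomology[OF assms(2)] subquotient_cohomology[OF assms(1)]])
  fix \<phi> \<psi> assume "\<phi> \<in> rel_cocycles G n K' L'" "\<psi> \<in> rel_cocycles G n K' L'"
  then show "cochain_map n K f (\<phi> \<otimes>\<^bsub>cochain_group G n K' L'\<^esub> \<psi>) =
      cochain_map n K f \<phi> \<otimes>\<^bsub>cochain_group G n K L\<^esub> cochain_map n K f \<psi>"
    using assms by (simp add: cochain_map_mult)
qed (use assms cochain_map_rel_cocycles cochain_map_rel_coboundaries in blast)+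

lemma cohomology_map_hom:
  assumes "simp_pair K L" "simp_pair K' L'" "simp_map f K K'" "simp_map f L L'"
  shows "cohomology_map G n K L f \<in> hom (cohomology_group G n K' L') (cohomology_group G n K L)"
  unfolding cohomology_group_def
proof (rule subquotient.quot_hom[OF subquotient_cohomology[OF assms(2)] subquotient_cohomology[OF assms(1)]])
  show "cohomology_map G n K L f (rel_coboundaries G n K' L' #>\<^bsub>cochain_group G n K' L'\<^esub> \<phi>) =
      rel_coboundaries G n K L #>\<^bsub>cochain_group G n K L\<^esub> cochain_map n K f \<phi>"
    if "\<phi> \<in> rel_cocycles G n K' L'" for \<phi>
    using cohomology_map_class[OF assms that] by (simp add: cohomology_class_def)
  fix \<phi> \<psi> assume "\<phi> \<in> rel_cocycles G n K' L'" "\<psi> \<in> rel_cocycles G n K' L'"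
  then show "cochain_map n K f (\<phi> \<otimes>\<^bsub>cochain_group G n K' L'\<^esub> \<psi>) =
      cochain_map n K f \<phi> \<otimes>\<^bsub>cochain_group G n K L\<^esub> cochain_map n K f \<psi>"
    using assms by (simp add: cochain_map_mult)
qed (use assms cochain_map_rel_cocycles in blast)

lemma cohomology_map_id:
  assumes "simp_pair K L" "S \<in> carrier (cohomology_group G n K L)"
  shows "cohomology_map G n K L id S = S"
proof -
  obtain \<phi> where \<phi>: "\<phi> \<in> rel_cocycles G n K L" "S = cohomology_class G n K L \<phi>"
    using cohomology_carrierE[OF assms] .
  moreover have "cochain_map n K id \<phi> = \<phi>"
    using \<phi> by (auto simp: rel_cocycles_iff intro: cochain_map_id)
  ultimately show ?thesis
    using assms by (simp add: cohomology_map_class)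
qed

lemma cohomology_map_comp:
  assumes "simp_pair K L" "simp_pair K' L'" "simp_pair K'' L''"
    and "simp_map f K K'" "simp_map f L L'" "simp_map g K' K''" "simp_map g L' L''"
    and "S \<in> carrier (cohomology_group G n K'' L'')"
  shows "cohomology_map G n K L (g \<circ> f) S = cohomology_map G n K L f (cohomology_map G n K' L' g S)"
proof -
  obtain \<phi> where \<phi>: "\<phi> \<in> rel_cocycles G n K'' L''" "S = cohomology_class G n K'' L'' \<phi>"
    using cohomology_carrierE[OF assms(3,8)] .
  have "simp_map (g \<circ> f) K K''" "simp_map (g \<circ> f) L L''"
    using assms(4-7) unfolding simp_map_def image_comp[symmetric] by blast+
  moreover have "cochain_map n K (g \<circ> f) \<phi> = cochain_map n K f (cochain_map n K' g \<phi>)"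
    using assms by (intro cochain_map_comp)
  moreover have "cochain_map n K' g \<phi> \<in> rel_cocycles G n K' L'"
    using \<phi> assms by (intro cochain_map_rel_cocycles)
  ultimately show ?thesis
    using assms(1-7) \<phi> by (simp add: cohomology_map_class)
qed

section \<open>The connecting homomorphism in cohomology\<close>

lemma coboundary_rel_cocycle:
  assumes "simp_pair K L" "\<psi> \<in> cochains G n K {}"
    and "restrict \<psi> (int_chains n L) \<in> rel_cocycles G n L {}"
  shows "coboundary n K \<psi> \<in> rel_cocycles G (n + 1) K L"
proof -
  have K: "down_closed K" "down_closed L" "L \<subseteq> K"
    using assms by (auto simp: simp_pair_def)
  \<comment> \<open>On chains of \<open>L\<close> the coboundary depends only on the restriction of
    \<open>\<psi>\<close> to \<open>L\<close>, which is a cocycle.\<close>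
  have "restrict (coboundary n K \<psi>) (int_chains (n + 1) L) = (\<lambda>c\<in>int_chains (n + 1) L. \<one>)"
    using assms(3) coboundary_restrict[OF K(2,3), of n \<psi>] by (simp add: rel_cocycles_iff)
  then have "coboundary n K \<psi> c = \<one>" if "c \<in> int_chains (n + 1) L" for c
    using that by (metis restrict_apply')
  moreover have "coboundary n K \<psi> \<in> cochains G (n + 1) K {}"
    using assms by (intro coboundary_closed simp_pair_empty(1))
  ultimately have "coboundary n K \<psi> \<in> cochains G (n + 1) K L"
    by (simp add: cochains_iff)
  with assms coboundary_coboundary[OF assms(2)] simp_pair_empty(1)[OF assms(1)] show ?thesis
    by (simp add: rel_cocycles_iff)
qed

text \<open>Extensions of two cohomologous cocycles differ, up to the coboundary of a cochain on
  \<open>K\<close>, by a cochain vanishing on \<open>L\<close>. So the coboundaries of all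
  extensions lie in one coset. Conversely, adding a relative cochain to \<open>\<psi>\<close>
  changes the extension but not its restriction, so the coset is filled.\<close>

lemma cohomology_connecting_class:
  assumes "simp_pair K L" "\<psi> \<in> cochains G n K {}"
    and "restrict \<psi> (int_chains n L) \<in> rel_cocycles G n L {}"
  shows "cohomology_connecting G n K L (cohomology_class G n L {} (restrict \<psi> (int_chains n L))) =
    cohomology_class G (n + 1) K L (coboundary n K \<psi>)"
proof -
  have K: "down_closed K" "down_closed L" "L \<subseteq> K"
    using assms by (auto simp: simp_pair_def)
  have LK: "int_chains m L \<subseteq> int_chains m K" for m
    by (rule int_chains_mono[OF K(3)])
  show ?thesis
  proof (intro equalityI subsetI)
    fix \<theta> assume "\<theta> \<in> cohomology_connecting G n K L (cohomology_class G n L {} (restrict \<psi> (int_chains n L)))"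
    then obtain \<psi>' \<alpha> where \<psi>': "\<psi>' \<in> cochains G n K {}" "\<theta> = coboundary n K \<psi>'"
      and \<alpha>: "\<alpha> \<in> cochains G (n - 1) L {}"
      and eq: "restrict \<psi>' (int_chains n L) = (\<lambda>c\<in>int_chains n L. coboundary (n - 1) L \<alpha> c \<otimes> restrict \<psi> (int_chains n L) c)"
      by (auto simp: cohomology_connecting_def cohomology_class_def r_coset_def rel_coboundaries_def)
    \<comment> \<open>The restrictions of \<open>\<psi>'\<close> and \<open>\<psi>\<close> differ by
      the coboundary of \<open>\<alpha>\<close>; extending \<open>\<alpha>\<close> to
      \<open>K\<close> exhibits this difference as the restriction of the coboundary
      \<open>\<chi>\<close>.\<close>
    define \<alpha>' where "\<alpha>' = extend_cochain (n - 1) K L \<alpha>"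
    have \<alpha>': "\<alpha>' \<in> cochains G (n - 1) K {}" "restrict \<alpha>' (int_chains (n - 1) L) = \<alpha>"
      using \<alpha> K by (auto simp: \<alpha>'_def extend_cochain_closed restrict_extend_cochain)
    define \<chi> where "\<chi> = coboundary (n - 1) K \<alpha>'"
    have \<chi>: "\<chi> \<in> cochains G n K {}"
      using coboundary_closed[OF \<alpha>'(1) simp_pair_empty(1)[OF assms(1)]] by (simp add: \<chi>_def)
    have \<chi>L: "\<chi> c = coboundary (n - 1) L \<alpha> c" if "c \<in> int_chains n L" for c
    proof -
      have "coboundary (n - 1) L \<alpha> = restrict \<chi> (int_chains n L)"
        using coboundary_restrict[OF K(2,3), of "n - 1" \<alpha>'] \<alpha>' by (simp add: \<chi>_def)
      with that show ?thesis by simp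
    qed
    \<comment> \<open>What remains of \<open>\<psi>'\<close> after removing \<open>\<chi>\<close>
      and \<open>\<psi>\<close>; it vanishes on \<open>L\<close> and is therefore a relative
      cochain.\<close>
    define \<beta> where "\<beta> = (\<lambda>c\<in>int_chains n K. \<psi>' c \<otimes> inv (\<chi> c \<otimes> \<psi> c))"
    have \<beta>0: "\<beta> \<in> cochains G n K {}"
    proof -
      have "\<beta> = (\<lambda>c\<in>int_chains n K. \<psi>' c \<otimes> (\<lambda>c\<in>int_chains n K. inv ((\<lambda>c\<in>int_chains n K. \<chi> c \<otimes> \<psi> c) c)) c)"
        by (auto simp: \<beta>_def intro!: restrict_ext)
      also have "\<dots> \<in> cochains G n K {}"
        using \<psi>' \<chi> assms(2) by (intro cochains_mult_closed inv_cochain) auto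
      finally show ?thesis .
    qed
    have "\<beta> c = \<one>" if c: "c \<in> int_chains n L" for c
    proof -
      have "\<psi>' c = coboundary (n - 1) L \<alpha> c \<otimes> \<psi> c"
        using fun_cong[OF eq, of c] c by simp
      moreover have "c \<in> int_chains n K"
        using c LK by blast
      ultimately show ?thesis
        using c cochains_closed[OF \<chi>] cochains_closed[OF assms(2)] by (simp add: \<beta>_def \<chi>L[symmetric])
    qed
    with \<beta>0 have \<beta>: "\<beta> \<in> cochains G n K L"
      by (simp add: cochains_iff)
    \<comment> \<open>Being itself a coboundary, \<open>\<chi>\<close> can be removed without
      affecting the coboundary of \<open>\<psi>'\<close>.\<close>
    have "coboundary n K \<chi> = (\<lambda>c\<in>int_chains (n + 1) K. \<one>)"
      using coboundary_coboundary[OF \<alpha>'(1) simp_pair_empty(1)[OF assms(1)]] by (simp add: \<chi>_def)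
    then have \<delta>\<chi>: "\<chi> (boundary integer_group c) = \<one>" if "c \<in> int_chains (n + 1) K" for c
      using that by (metis coboundary_def restrict_apply')
    have "\<theta> = (\<lambda>c\<in>int_chains (n + 1) K. coboundary n K \<beta> c \<otimes> coboundary n K \<psi> c)"
    proof (intro extensionalityI[of _ "int_chains (n + 1) K"])
      fix c assume c: "c \<in> int_chains (n + 1) K"
      then have b: "boundary integer_group c \<in> int_chains n K"
        using int_boundary_closed[OF c K(1)] by simp
      have cl: "\<psi>' (boundary integer_group c) \<in> carrier G" "\<psi> (boundary integer_group c) \<in> carrier G"
        using b \<psi>' assms(2) by (auto intro: cochains_closed)
      show "\<theta> c = (\<lambda>c\<in>int_chains (n + 1) K. coboundary n K \<beta> c \<otimes> coboundary n K \<psi> c) c"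
        using c b cl by (simp add: \<psi>'(2) coboundary_def \<beta>_def \<delta>\<chi> m_assoc)
    qed (auto simp: \<psi>'(2) coboundary_def)
    then show "\<theta> \<in> cohomology_class G (n + 1) K L (coboundary n K \<psi>)"
      using \<beta> by (auto simp: cohomology_class_def r_coset_def rel_coboundaries_def)
  next
    fix \<theta> assume "\<theta> \<in> cohomology_class G (n + 1) K L (coboundary n K \<psi>)"
    then obtain \<beta> where \<beta>: "\<beta> \<in> cochains G n K L"
      and \<theta>: "\<theta> = (\<lambda>c\<in>int_chains (n + 1) K. coboundary n K \<beta> c \<otimes> coboundary n K \<psi> c)"
      by (auto simp: cohomology_class_def r_coset_def rel_coboundaries_def)
    define \<psi>' where "\<psi>' = (\<lambda>c\<in>int_chains n K. \<beta> c \<otimes> \<psi> c)"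
    have "\<psi>' \<in> cochains G n K {}"
      using \<beta> assms(2) cochains_subset unfolding \<psi>'_def by (intro cochains_mult_closed) auto
    moreover have "\<theta> = coboundary n K \<psi>'"
      by (simp add: \<theta> \<psi>'_def coboundary_mult[OF K(1)])
    moreover have "restrict \<psi>' (int_chains n L) =
        (\<lambda>c\<in>int_chains n L. coboundary (n - 1) L (\<lambda>c\<in>int_chains (n - 1) L. \<one>) c \<otimes> restrict \<psi> (int_chains n L) c)"
      using LK[of n] cochains_vanish[OF \<beta>] cochains_closed[OF assms(2)] coboundary_one[OF K(2), of "n - 1"]
      by (auto simp: \<psi>'_def subset_iff intro!: restrict_ext)
    moreover have "(\<lambda>c\<in>int_chains (n - 1) L. \<one>) \<in> cochains G (n - 1) L {}"
      by (simp add: one_cochain)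
    ultimately show "\<theta> \<in> cohomology_connecting G n K L (cohomology_class G n L {} (restrict \<psi> (int_chains n L)))"
      unfolding cohomology_connecting_def cohomology_class_def r_coset_def rel_coboundaries_def by auto
  qed
qed

text \<open>Supplies representatives in the form on which \<open>cohomology_connecting_class\<close>
  computes.\<close>

lemma cocycle_extension:
  assumes "simp_pair K L" "S \<in> carrier (cohomology_group G n L {})"
  obtains \<psi> where "\<psi> \<in> cochains G n K {}" "restrict \<psi> (int_chains n L) \<in> rel_cocycles G n L {}"
    "S = cohomology_class G n L {} (restrict \<psi> (int_chains n L))"
proof -
  obtain \<phi> where \<phi>: "\<phi> \<in> rel_cocycles G n L {}" "S = cohomology_class G n L {} \<phi>"
    using cohomology_carrierE[OF simp_pair_empty(2)[OF assms(1)] assms(2)] .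
  then have "\<phi> \<in> cochains G n L {}" "L \<subseteq> K"
    using assms by (auto simp: rel_cocycles_iff simp_pair_def)
  then show thesis
    using \<phi> by (intro that[of "extend_cochain n K L \<phi>"])
      (auto simp: extend_cochain_closed restrict_extend_cochain)
qed

text \<open>On representatives the connecting map is the coboundary of the extension by
  \<open>proj\<close>. This fixed extension is multiplicative in the cocycle, which an arbitrary
  choice of extensions would not guarantee.\<close>

lemma cohomology_connecting_hom:
  assumes "simp_pair K L"
  shows "cohomology_connecting G n K L \<in> hom (cohomology_group G n L {}) (cohomology_group G (n + 1) K L)"
  unfolding cohomology_group_def
proof (rule subquotient.quot_hom[OF subquotient_cohomology[OF simp_pair_empty(2)[OF assms]]
      subquotient_cohomology[OF assms], where m = "\<lambda>\<phi>. coboundary n K (extend_cochain n K L \<phi>)"])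
  have K: "down_closed K" "down_closed L" "L \<subseteq> K"
    using assms by (auto simp: simp_pair_def)
  show "coboundary n K (extend_cochain n K L \<phi>) \<in> rel_cocycles G (n + 1) K L"
    if "\<phi> \<in> rel_cocycles G n L {}" for \<phi>
    using that assms K by (intro coboundary_rel_cocycle)
      (auto simp: rel_cocycles_iff extend_cochain_closed restrict_extend_cochain)
  show "cohomology_connecting G n K L (rel_coboundaries G n L {} #>\<^bsub>cochain_group G n L {}\<^esub> \<phi>) =
      rel_coboundaries G (n + 1) K L #>\<^bsub>cochain_group G (n + 1) K L\<^esub> coboundary n K (extend_cochain n K L \<phi>)"
    if "\<phi> \<in> rel_cocycles G n L {}" for \<phi>
  proof -
    have "\<phi> \<in> cochains G n L {}"
      using that by (simp add: rel_cocycles_iff)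
    then show ?thesis
      using cohomology_connecting_class[OF assms extend_cochain_closed[where L = L], of \<phi> n] that K
      by (simp add: cohomology_class_def restrict_extend_cochain)
  qed
  fix \<phi> \<psi> assume "\<phi> \<in> rel_cocycles G n L {}" "\<psi> \<in> rel_cocycles G n L {}"
  have "extend_cochain n K L (\<lambda>c\<in>int_chains n L. \<phi> c \<otimes> \<psi> c) =
      (\<lambda>c\<in>int_chains n K. extend_cochain n K L \<phi> c \<otimes> extend_cochain n K L \<psi> c)"
    using ints.proj_closed[of _ n K L] by (auto simp: extend_cochain_def intro!: restrict_ext)
  then show "coboundary n K (extend_cochain n K L (\<phi> \<otimes>\<^bsub>cochain_group G n L {}\<^esub> \<psi>)) =
      coboundary n K (extend_cochain n K L \<phi>) \<otimes>\<^bsub>cochain_group G (n + 1) K L\<^esub> coboundary n K (extend_cochain n K L \<psi>)"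
    by (simp add: coboundary_mult[OF K(1)])
qed

lemma cohomology_connecting_natural:
  assumes "simp_pair K L" "simp_pair K' L'" "simp_map f K K'" "simp_map f L L'"
    and "S \<in> carrier (cohomology_group G n L' {})"
  shows "cohomology_connecting G n K L (cohomology_map G n L {} f S) =
    cohomology_map G (n + 1) K L f (cohomology_connecting G n K' L' S)"
proof -
  note p = simp_pair_empty[OF assms(1)] simp_pair_empty[OF assms(2)]
  have sub: "L \<subseteq> K" "L' \<subseteq> K'" "down_closed K"
    using assms by (auto simp: simp_pair_def)
  obtain \<psi> where \<psi>: "\<psi> \<in> cochains G n K' {}" "restrict \<psi> (int_chains n L') \<in> rel_cocycles G n L' {}"
      "S = cohomology_class G n L' {} (restrict \<psi> (int_chains n L'))"
    using cocycle_extension[OF assms(2,5)] .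
  \<comment> \<open>Pulling back an extension of a cocycle gives an extension of the pulled back
    cocycle.\<close>
  have res: "cochain_map n L f (restrict \<psi> (int_chains n L')) =
      restrict (cochain_map n K f \<psi>) (int_chains n L)"
    using int_chains_mono[OF sub(1), of n] int_chain_map_closed[OF _ assms(4)]
    by (auto simp: cochain_map_def restrict_def fun_eq_iff)
  have \<psi>f: "cochain_map n K f \<psi> \<in> cochains G n K {}"
    using \<psi> assms by (intro cochain_map_closed[of _ _ K']) auto
  have coc: "restrict (cochain_map n K f \<psi>) (int_chains n L) \<in> rel_cocycles G n L {}"
    unfolding res[symmetric] using p \<psi> assms by (intro cochain_map_rel_cocycles) auto
  have "cohomology_connecting G n K L (cohomology_map G n L {} f S) =
      cohomology_connecting G n K L (cohomology_class G n L {} (restrict (cochain_map n K f \<psi>) (int_chains n L)))"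
    using p \<psi> assms by (simp add: cohomology_map_class res)
  also have "\<dots> = cohomology_class G (n + 1) K L (coboundary n K (cochain_map n K f \<psi>))"
    by (rule cohomology_connecting_class[OF assms(1) \<psi>f coc])
  also have "\<dots> = cohomology_class G (n + 1) K L (cochain_map (n + 1) K f (coboundary n K' \<psi>))"
    using assms sub by (simp add: coboundary_cochain_map)
  also have "\<dots> = cohomology_map G (n + 1) K L f (cohomology_class G (n + 1) K' L' (coboundary n K' \<psi>))"
    using assms \<psi> by (simp add: cohomology_map_class coboundary_rel_cocycle)
  also have "\<dots> = cohomology_map G (n + 1) K L f (cohomology_connecting G n K' L' S)"
    using cohomology_connecting_class[OF assms(2) \<psi>(1,2)] \<psi>(3) by simp
  finally show ?thesis .
qed

section \<open>Exactness of the cohomology sequence of a simplicial pair\<close>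

lemma cohomology_map_id_class:
  assumes "simp_pair K L" "simp_pair K' L'" "K \<subseteq> K'" "L \<subseteq> L'" "\<phi> \<in> rel_cocycles G n K' L'"
  shows "cohomology_map G n K L id (cohomology_class G n K' L' \<phi>) =
      cohomology_class G n K L (restrict \<phi> (int_chains n K))"
    "restrict \<phi> (int_chains n K) \<in> rel_cocycles G n K L"
  using assms cochain_map_rel_cocycles[OF assms(1,5), of id]
  by (simp_all add: cohomology_map_class cochain_map_id_restrict)

lemma restrict_cochain_self: "\<phi> \<in> cochains G n K L \<Longrightarrow> restrict \<phi> (int_chains n K) = \<phi>"
  by (simp add: cochains_iff extensional_restrict)

lemma cohomology_rel_total_sub:
  assumes "simp_pair K L" "S \<in> carrier (cohomology_group G n K L)"
  shows "cohomology_map G n L {} id (cohomology_map G n K {} id S) = \<one>\<^bsub>cohomology_group G n L {}\<^esub>"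
proof -
  note p = simp_pair_empty[OF assms(1)]
  have K: "down_closed K" "down_closed L" "L \<subseteq> K"
    using assms by (auto simp: simp_pair_def)
  obtain \<phi> where \<phi>: "\<phi> \<in> rel_cocycles G n K L" "S = cohomology_class G n K L \<phi>"
    using cohomology_carrierE[OF assms] .
  then have c: "\<phi> \<in> cochains G n K L"
    by (simp add: rel_cocycles_iff)
  note 1 = cohomology_map_id_class[OF p(1) assms(1) subset_refl empty_subsetI \<phi>(1)]
  note 2 = cohomology_map_id_class[OF p(2) p(1) K(3) subset_refl 1(2)]
  \<comment> \<open>A relative cochain is trivial on \<open>L\<close>, so its restriction is the
    coboundary of the trivial cochain.\<close>
  have "restrict \<phi> (int_chains n L) = coboundary (n - 1) L (\<lambda>c\<in>int_chains (n - 1) L. \<one>)"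
    using cochains_vanish[OF c] coboundary_one[OF K(2), of "n - 1"] by (auto intro!: restrict_ext)
  then have "restrict \<phi> (int_chains n L) \<in> rel_coboundaries G n L {}"
    unfolding rel_coboundaries_def by (intro image_eqI[OF _ one_cochain]) auto
  then show ?thesis
    using 1 2 p \<phi> by (simp add: restrict_cochain_self[OF c] cohomology_class_one_iff)
qed

text \<open>A cocycle on \<open>K\<close> is an extension of its own restriction, and its coboundary
  is trivial.\<close>

lemma cohomology_total_sub_connecting:
  assumes "simp_pair K L" "S \<in> carrier (cohomology_group G n K {})"
  shows "cohomology_connecting G n K L (cohomology_map G n L {} id S) = \<one>\<^bsub>cohomology_group G (n + 1) K L\<^esub>"
proof -
  note p = simp_pair_empty[OF assms(1)]
  have K: "down_closed K" "L \<subseteq> K"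
    using assms by (auto simp: simp_pair_def)
  obtain \<phi> where \<phi>: "\<phi> \<in> rel_cocycles G n K {}" "S = cohomology_class G n K {} \<phi>"
    using cohomology_carrierE[OF p(1) assms(2)] .
  then have c: "\<phi> \<in> cochains G n K {}" "coboundary n K \<phi> = (\<lambda>c\<in>int_chains (n + 1) K. \<one>)"
    by (simp_all add: rel_cocycles_iff)
  note 1 = cohomology_map_id_class[OF p(2) p(1) K(2) subset_refl \<phi>(1)]
  have "coboundary n K (\<lambda>c\<in>int_chains n K. \<one>) \<in> rel_coboundaries G (n + 1) K L"
    unfolding rel_coboundaries_def using one_cochain[OF K(2)] by simp
  then have "coboundary n K \<phi> \<in> rel_coboundaries G (n + 1) K L"
    by (simp add: c(2) coboundary_one[OF K(1)])
  then show ?thesis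
    using 1 \<phi> cohomology_connecting_class[OF assms(1) c(1) 1(2)]
      coboundary_rel_cocycle[OF assms(1) c(1) 1(2)] assms(1)
    by (simp add: cohomology_class_one_iff)
qed

text \<open>The connecting class is represented by the coboundary of \<open>\<psi>\<close>, which
  becomes a coboundary in the absolute sense since \<open>\<psi>\<close> is defined on all of
  \<open>K\<close> but need not vanish on \<open>L\<close>.\<close>

lemma cohomology_connecting_total:
  assumes "simp_pair K L" "S \<in> carrier (cohomology_group G n L {})"
  shows "cohomology_map G (n + 1) K {} id (cohomology_connecting G n K L S) = \<one>\<^bsub>cohomology_group G (n + 1) K {}\<^esub>"
proof -
  note p = simp_pair_empty[OF assms(1)]
  obtain \<psi> where \<psi>: "\<psi> \<in> cochains G n K {}" "restrict \<psi> (int_chains n L) \<in> rel_cocycles G n L {}"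
      "S = cohomology_class G n L {} (restrict \<psi> (int_chains n L))"
    using cocycle_extension[OF assms] .
  note d = coboundary_rel_cocycle[OF assms(1) \<psi>(1,2)]
  note 1 = cohomology_map_id_class[OF p(1) assms(1) subset_refl empty_subsetI d]
  have "restrict (coboundary n K \<psi>) (int_chains (n + 1) K) = coboundary n K \<psi>"
    using d by (auto simp: rel_cocycles_iff intro: restrict_cochain_self)
  moreover have "coboundary n K \<psi> \<in> rel_coboundaries G (n + 1) K {}"
    using \<psi> by (simp add: rel_coboundaries_def)
  ultimately show ?thesis
    using 1 \<psi>(3) cohomology_connecting_class[OF assms(1) \<psi>(1,2)] p
    by (simp add: cohomology_class_one_iff)
qed

text \<open>If the restriction to \<open>L\<close> is the coboundary of \<open>\<alpha>\<close>,
  remove from the cocycle the coboundary of an extension of \<open>\<alpha>\<close>: the class is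
  unchanged and the new representative vanishes on \<open>L\<close>.\<close>

lemma cohomology_exact_total:
  assumes "simp_pair K L" "S \<in> carrier (cohomology_group G n K {})"
    and "cohomology_map G n L {} id S = \<one>\<^bsub>cohomology_group G n L {}\<^esub>"
  obtains T where "T \<in> carrier (cohomology_group G n K L)" "S = cohomology_map G n K {} id T"
proof -
  note p = simp_pair_empty[OF assms(1)]
  have K: "down_closed K" "down_closed L" "L \<subseteq> K"
    using assms by (auto simp: simp_pair_def)
  obtain \<phi> where \<phi>: "\<phi> \<in> rel_cocycles G n K {}" "S = cohomology_class G n K {} \<phi>"
    using cohomology_carrierE[OF p(1) assms(2)] .
  then have c: "\<phi> \<in> cochains G n K {}"
    by (simp add: rel_cocycles_iff)
  note 1 = cohomology_map_id_class[OF p(2) p(1) K(3) subset_refl \<phi>(1)]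
  have "restrict \<phi> (int_chains n L) \<in> rel_coboundaries G n L {}"
    using assms(3) 1 \<phi>(2) cohomology_class_one_iff[OF p(2) 1(2)] by simp
  then obtain \<alpha> where \<alpha>: "\<alpha> \<in> cochains G (n - 1) L {}" "restrict \<phi> (int_chains n L) = coboundary (n - 1) L \<alpha>"
    by (auto simp: rel_coboundaries_def)
  define \<alpha>' where "\<alpha>' = extend_cochain (n - 1) K L \<alpha>"
  have \<alpha>': "\<alpha>' \<in> cochains G (n - 1) K {}" "restrict \<alpha>' (int_chains (n - 1) L) = \<alpha>"
    using \<alpha> K by (auto simp: \<alpha>'_def extend_cochain_closed restrict_extend_cochain)
  \<comment> \<open>Inverted, so that multiplying by its coboundary cancels \<open>\<phi>\<close> on
    \<open>L\<close>.\<close>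
  define \<chi> where "\<chi> = (\<lambda>c\<in>int_chains (n - 1) K. inv (\<alpha>' c))"
  have \<chi>: "\<chi> \<in> cochains G (n - 1) K {}"
    unfolding \<chi>_def by (rule inv_cochain[OF \<alpha>'(1)]) simp
  have d\<chi>: "coboundary (n - 1) K \<chi> c = inv (coboundary (n - 1) K \<alpha>' c)" if "c \<in> int_chains n K" for c
    using that coboundary_inv[OF K(1), of "n - 1" \<alpha>'] by (simp add: \<chi>_def)
  define \<phi>' where "\<phi>' = (\<lambda>c\<in>int_chains n K. coboundary (n - 1) K \<chi> c \<otimes> \<phi> c)"
  have eq: "cohomology_class G n K {} \<phi>' = cohomology_class G n K {} \<phi>" "\<phi>' \<in> rel_cocycles G n K {}"
    by (rule cohomology_class_eqI[OF p(1) \<phi>(1) \<chi>]; simp add: \<phi>'_def)+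
  have "\<phi>' c = \<one>" if c': "c \<in> int_chains n L" for c
  proof -
    have cK: "c \<in> int_chains n K"
      using c' int_chains_mono[OF K(3)] by blast
    have "\<phi> c = coboundary (n - 1) L \<alpha> c"
      using fun_cong[OF \<alpha>(2), of c] c' by simp
    also have "\<dots> = coboundary (n - 1) K \<alpha>' c"
      using coboundary_restrict[OF K(2,3), of "n - 1" \<alpha>'] \<alpha>'(2) c' by simp
    finally have "\<phi> c = coboundary (n - 1) K \<alpha>' c" .
    then show ?thesis
      using d\<chi>[OF cK] cK cochains_closed[OF c cK] by (simp add: \<phi>'_def)
  qed
  with eq(2) have \<phi>': "\<phi>' \<in> rel_cocycles G n K L"
    by (simp add: rel_cocycles_iff cochains_iff)
  show thesis
  proof (rule that)
    show "cohomology_class G n K L \<phi>' \<in> carrier (cohomology_group G n K L)"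
      by (rule cohomology_class_carrier[OF assms(1) \<phi>'])
    have "restrict \<phi>' (int_chains n K) = \<phi>'"
      by (simp add: \<phi>'_def)
    then show "S = cohomology_map G n K {} id (cohomology_class G n K L \<phi>')"
      using cohomology_map_id_class(1)[OF p(1) assms(1) subset_refl empty_subsetI \<phi>'] eq(1) \<phi>(2) by simp
  qed
qed

text \<open>A trivial connecting class gives a cochain \<open>\<chi>\<close> that vanishes on
  \<open>L\<close> and has the same coboundary as the extension \<open>\<psi>\<close>; the quotient
  of the two is a cocycle on \<open>K\<close> with the restriction of \<open>\<psi>\<close>.\<close>

lemma cohomology_exact_sub:
  assumes "simp_pair K L" "S \<in> carrier (cohomology_group G n L {})"
    and "cohomology_connecting G n K L S = \<one>\<^bsub>cohomology_group G (n + 1) K L\<^esub>"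
  obtains T where "T \<in> carrier (cohomology_group G n K {})" "S = cohomology_map G n L {} id T"
proof -
  note p = simp_pair_empty[OF assms(1)]
  have K: "down_closed K" "down_closed L" "L \<subseteq> K"
    using assms by (auto simp: simp_pair_def)
  obtain \<psi> where \<psi>: "\<psi> \<in> cochains G n K {}" "restrict \<psi> (int_chains n L) \<in> rel_cocycles G n L {}"
      "S = cohomology_class G n L {} (restrict \<psi> (int_chains n L))"
    using cocycle_extension[OF assms(1,2)] .
  have "coboundary n K \<psi> \<in> rel_coboundaries G (n + 1) K L"
    using assms(3) \<psi>(3) cohomology_connecting_class[OF assms(1) \<psi>(1,2)]
      cohomology_class_one_iff[OF assms(1) coboundary_rel_cocycle[OF assms(1) \<psi>(1,2)]] by simp
  then obtain \<chi> where \<chi>: "\<chi> \<in> cochains G n K L" "coboundary n K \<psi> = coboundary n K \<chi>"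
    by (auto simp: rel_coboundaries_def)
  have \<chi>0: "\<chi> \<in> cochains G n K {}"
    using \<chi> cochains_subset by blast
  define \<phi> where "\<phi> = (\<lambda>c\<in>int_chains n K. \<psi> c \<otimes> (\<lambda>c\<in>int_chains n K. inv (\<chi> c)) c)"
  have \<phi>0: "\<phi> \<in> cochains G n K {}"
    unfolding \<phi>_def using \<psi>(1) \<chi>0 by (intro cochains_mult_closed inv_cochain) auto
  have "coboundary n K \<phi> = (\<lambda>c\<in>int_chains (n + 1) K. coboundary n K \<psi> c \<otimes> inv (coboundary n K \<chi> c))"
    unfolding \<phi>_def coboundary_mult[OF K(1)] coboundary_inv[OF K(1)] by (auto intro!: restrict_ext)
  also have "\<dots> = (\<lambda>c\<in>int_chains (n + 1) K. \<one>)"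
    using coboundary_closed[OF \<chi>0 p(1)] by (auto simp: \<chi>(2) cochains_closed intro!: restrict_ext)
  finally have \<phi>: "\<phi> \<in> rel_cocycles G n K {}"
    using \<phi>0 by (simp add: rel_cocycles_iff)
  have "restrict \<phi> (int_chains n L) = restrict \<psi> (int_chains n L)"
  proof (rule restrict_ext)
    fix c assume c: "c \<in> int_chains n L"
    then have cK: "c \<in> int_chains n K"
      using int_chains_mono[OF K(3)] by blast
    then show "\<phi> c = \<psi> c"
      using c cochains_vanish[OF \<chi>(1) c] cochains_closed[OF \<psi>(1) cK] by (simp add: \<phi>_def)
  qed
  then have "S = cohomology_map G n L {} id (cohomology_class G n K {} \<phi>)"
    using \<psi>(3) cohomology_map_id_class(1)[OF p(2) p(1) K(3) subset_refl \<phi>] by simp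
  then show thesis
    using that cohomology_class_carrier[OF p(1) \<phi>] by blast
qed

text \<open>If \<open>\<theta>\<close> is the coboundary of an absolute cochain
  \<open>\<psi>\<close>, then the vanishing of \<open>\<theta>\<close> on \<open>L\<close> says that
  \<open>\<psi>\<close> restricts to a cocycle there, and \<open>\<psi>\<close> is an extension that
  computes the connecting map.\<close>

lemma cohomology_exact_rel:
  assumes "simp_pair K L" "S \<in> carrier (cohomology_group G (n + 1) K L)"
    and "cohomology_map G (n + 1) K {} id S = \<one>\<^bsub>cohomology_group G (n + 1) K {}\<^esub>"
  obtains T where "T \<in> carrier (cohomology_group G n L {})" "S = cohomology_connecting G n K L T"
proof -
  note p = simp_pair_empty[OF assms(1)]
  have K: "down_closed K" "down_closed L" "L \<subseteq> K"
    using assms by (auto simp: simp_pair_def)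
  obtain \<theta> where \<theta>: "\<theta> \<in> rel_cocycles G (n + 1) K L" "S = cohomology_class G (n + 1) K L \<theta>"
    using cohomology_carrierE[OF assms(1,2)] .
  then have c: "\<theta> \<in> cochains G (n + 1) K L"
    by (simp add: rel_cocycles_iff)
  note 1 = cohomology_map_id_class[OF p(1) assms(1) subset_refl empty_subsetI \<theta>(1)]
  have "\<theta> \<in> rel_coboundaries G (n + 1) K {}"
    using assms(3) 1 \<theta>(2) cohomology_class_one_iff[OF p(1) 1(2)] by (simp add: restrict_cochain_self[OF c])
  then obtain \<psi> where \<psi>: "\<psi> \<in> cochains G n K {}" "\<theta> = coboundary n K \<psi>"
    by (auto simp: rel_coboundaries_def)
  have "coboundary n L (restrict \<psi> (int_chains n L)) = restrict \<theta> (int_chains (n + 1) L)"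
    using coboundary_restrict[OF K(2,3), of n \<psi>] \<psi>(2) by simp
  also have "\<dots> = (\<lambda>c\<in>int_chains (n + 1) L. \<one>)"
    using cochains_vanish[OF c] by (auto intro!: restrict_ext)
  finally have r: "restrict \<psi> (int_chains n L) \<in> rel_cocycles G n L {}"
    using restrict_cochain[OF \<psi>(1) K(3)] by (simp add: rel_cocycles_iff)
  have "S = cohomology_connecting G n K L (cohomology_class G n L {} (restrict \<psi> (int_chains n L)))"
    using cohomology_connecting_class[OF assms(1) \<psi>(1) r] \<theta>(2) \<psi>(2) by simp
  then show thesis
    using that cohomology_class_carrier[OF p(2) r] by blast
qed

end

section \<open>Direct limits\<close>

locale directed_system =
  fixes I :: "'i set" and r :: "'i \<Rightarrow> 'i \<Rightarrow> bool" and H :: "'i \<Rightarrow> 'h monoid" and \<phi> :: "'i \<Rightarrow> 'i \<Rightarrow> 'h \<Rightarrow> 'h"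
  assumes index_nonempty: "I \<noteq> {}"
    and index_refl: "\<And>i. i \<in> I \<Longrightarrow> r i i"
    and index_trans: "\<And>i j k. r i j \<Longrightarrow> r j k \<Longrightarrow> r i k"
    and index_directed: "\<And>i j. i \<in> I \<Longrightarrow> j \<in> I \<Longrightarrow> \<exists>k\<in>I. r i k \<and> r j k"
    and group_at: "\<And>i. i \<in> I \<Longrightarrow> group (H i)"
    and trans_hom: "\<And>i j. i \<in> I \<Longrightarrow> j \<in> I \<Longrightarrow> r i j \<Longrightarrow> \<phi> i j \<in> hom (H i) (H j)"
    and trans_id: "\<And>i x. i \<in> I \<Longrightarrow> x \<in> carrier (H i) \<Longrightarrow> \<phi> i i x = x"
    and trans_comp: "\<And>i j k x. i \<in> I \<Longrightarrow> j \<in> I \<Longrightarrow> k \<in> I \<Longrightarrow> r i j \<Longrightarrow> r j k \<Longrightarrow> x \<in> carrier (H i) \<Longrightarrow>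
      \<phi> j k (\<phi> i j x) = \<phi> i k x"
begin

abbreviation limit where "limit \<equiv> direct_limit I r H \<phi>"

definition germ :: "'i \<Rightarrow> 'h \<Rightarrow> ('i \<times> 'h) set" where
  "germ i x = germ_rel I r H \<phi> `` {(i, x)}"

lemma trans_closed: "i \<in> I \<Longrightarrow> j \<in> I \<Longrightarrow> r i j \<Longrightarrow> x \<in> carrier (H i) \<Longrightarrow> \<phi> i j x \<in> carrier (H j)"
  using trans_hom by (auto simp: hom_def)

lemma trans_mult:
  "i \<in> I \<Longrightarrow> j \<in> I \<Longrightarrow> r i j \<Longrightarrow> x \<in> carrier (H i) \<Longrightarrow> y \<in> carrier (H i) \<Longrightarrow>
   \<phi> i j (x \<otimes>\<^bsub>H i\<^esub> y) = \<phi> i j x \<otimes>\<^bsub>H j\<^esub> \<phi> i j y"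
  using trans_hom by (auto simp: hom_def)

lemma trans_one: "i \<in> I \<Longrightarrow> j \<in> I \<Longrightarrow> r i j \<Longrightarrow> \<phi> i j \<one>\<^bsub>H i\<^esub> = \<one>\<^bsub>H j\<^esub>"
  by (rule hom_one[OF trans_hom group_at group_at])

text \<open>For transitivity, the two stages at which neighbouring elements agree are joined at a
  common later stage, which directedness provides.\<close>

lemma equiv_germ_rel: "equiv (SIGMA i:I. carrier (H i)) (germ_rel I r H \<phi>)"
proof (rule equivI)
  show "germ_rel I r H \<phi> \<subseteq> (SIGMA i:I. carrier (H i)) \<times> (SIGMA i:I. carrier (H i))"
    by (auto simp: germ_rel_def)
  show "refl_on (SIGMA i:I. carrier (H i)) (germ_rel I r H \<phi>)"
    using index_refl by (auto simp: refl_on_def germ_rel_def)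
  show "sym (germ_rel I r H \<phi>)"
    by (fastforce simp: sym_def germ_rel_def)
  show "trans (germ_rel I r H \<phi>)"
  proof (rule transI)
    fix p q s assume "(p, q) \<in> germ_rel I r H \<phi>" "(q, s) \<in> germ_rel I r H \<phi>"
    then obtain i x j y k z a b where p: "p = (i, x)" "q = (j, y)" "s = (k, z)"
      and x: "i \<in> I" "x \<in> carrier (H i)" "j \<in> I" "y \<in> carrier (H j)" "k \<in> I" "z \<in> carrier (H k)"
      and a: "a \<in> I" "r i a" "r j a" "\<phi> i a x = \<phi> j a y"
      and b: "b \<in> I" "r j b" "r k b" "\<phi> j b y = \<phi> k b z"
      by (auto simp: germ_rel_def)
    obtain c where c: "c \<in> I" "r a c" "r b c"
      using index_directed[OF a(1) b(1)] by blast
    have "\<phi> i c x = \<phi> a c (\<phi> i a x)"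
      by (rule trans_comp[OF x(1) a(1) c(1) a(2) c(2) x(2), symmetric])
    also have "\<dots> = \<phi> j c y"
      unfolding a(4) by (rule trans_comp[OF x(3) a(1) c(1) a(3) c(2) x(4)])
    also have "\<dots> = \<phi> b c (\<phi> j b y)"
      by (rule trans_comp[OF x(3) b(1) c(1) b(2) c(3) x(4), symmetric])
    also have "\<dots> = \<phi> k c z"
      unfolding b(4) by (rule trans_comp[OF x(5) b(1) c(1) b(3) c(3) x(6)])
    finally have "\<phi> i c x = \<phi> k c z" .
    moreover have "r i c" "r k c"
      using a b c index_trans by blast+
    ultimately show "(p, s) \<in> germ_rel I r H \<phi>"
      using p x c(1) by (auto simp: germ_rel_def)
  qed
qed

lemma germ_eq_iff:
  assumes "i \<in> I" "x \<in> carrier (H i)" "j \<in> I" "y \<in> carrier (H j)"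
  shows "germ i x = germ j y \<longleftrightarrow> (\<exists>k\<in>I. r i k \<and> r j k \<and> \<phi> i k x = \<phi> j k y)"
proof -
  have "germ i x = germ j y \<longleftrightarrow> ((i, x), (j, y)) \<in> germ_rel I r H \<phi>"
    unfolding germ_def using assms by (intro eq_equiv_class_iff[OF equiv_germ_rel]) auto
  then show ?thesis
    using assms by (auto simp: germ_rel_def)
qed

lemma mem_germ_iff:
  assumes "i \<in> I" "x \<in> carrier (H i)"
  shows "(j, y) \<in> germ i x \<longleftrightarrow> j \<in> I \<and> y \<in> carrier (H j) \<and> germ j y = germ i x"
proof -
  have "(j, y) \<in> germ i x \<longleftrightarrow> j \<in> I \<and> y \<in> carrier (H j) \<and> ((i, x), (j, y)) \<in> germ_rel I r H \<phi>"
    by (auto simp: germ_def germ_rel_def)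
  also have "\<dots> \<longleftrightarrow> j \<in> I \<and> y \<in> carrier (H j) \<and> germ i x = germ j y"
    unfolding germ_def using assms eq_equiv_class_iff[OF equiv_germ_rel, of "(i, x)" "(j, y)"] by auto
  finally show ?thesis by auto
qed

lemma germ_trans:
  assumes "i \<in> I" "j \<in> I" "r i j" "x \<in> carrier (H i)"
  shows "germ j (\<phi> i j x) = germ i x"
proof (rule iffD2[OF germ_eq_iff])
  have "\<phi> j j (\<phi> i j x) = \<phi> i j x"
    using assms by (intro trans_id trans_closed)
  then show "\<exists>k\<in>I. r j k \<and> r i k \<and> \<phi> j k (\<phi> i j x) = \<phi> i k x"
    using assms index_refl by blast
qed (use assms trans_closed in auto)

lemma germ_carrier: "i \<in> I \<Longrightarrow> x \<in> carrier (H i) \<Longrightarrow> germ i x \<in> carrier limit"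
  by (auto simp: direct_limit_def germ_def intro!: quotientI)

lemma limit_carrierE:
  assumes "z \<in> carrier limit"
  obtains i x where "i \<in> I" "x \<in> carrier (H i)" "z = germ i x"
  using assms by (auto simp: direct_limit_def germ_def elim!: quotientE)

lemma limit_carrierE2:
  assumes "z \<in> carrier limit" "w \<in> carrier limit"
  obtains i x y where "i \<in> I" "x \<in> carrier (H i)" "y \<in> carrier (H i)" "z = germ i x" "w = germ i y"
proof -
  obtain i x where x: "i \<in> I" "x \<in> carrier (H i)" "z = germ i x"
    using limit_carrierE[OF assms(1)] .
  obtain j y where y: "j \<in> I" "y \<in> carrier (H j)" "w = germ j y"
    using limit_carrierE[OF assms(2)] .
  obtain k where k: "k \<in> I" "r i k" "r j k"
    using index_directed[OF x(1) y(1)] by blast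
  show thesis
    by (rule that[of k "\<phi> i k x" "\<phi> j k y"]) (use x y k in \<open>auto simp: trans_closed germ_trans\<close>)
qed

text \<open>Products, the unit and induced maps on the limit are defined by saturating a set of
  candidates; the result is a single germ once all candidates define it. An empty set of candidates
  would give the empty set instead.\<close>

lemma Image_germ_rel:
  assumes "S \<noteq> {}" "\<And>p. p \<in> S \<Longrightarrow> germ (fst p) (snd p) = g"
  shows "germ_rel I r H \<phi> `` S = g"
proof -
  have "germ_rel I r H \<phi> `` S = (\<Union>p\<in>S. germ (fst p) (snd p))"
    by (auto simp: germ_def)
  with assms show ?thesis by auto
qed

lemma limit_mult_germ:
  assumes "i \<in> I" "x \<in> carrier (H i)" "y \<in> carrier (H i)"
  shows "germ i x \<otimes>\<^bsub>limit\<^esub> germ i y = germ i (x \<otimes>\<^bsub>H i\<^esub> y)"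
proof -
  have mc: "x \<otimes>\<^bsub>H j\<^esub> y \<in> carrier (H j)" if "j \<in> I" "x \<in> carrier (H j)" "y \<in> carrier (H j)" for j x y
    using group_at[OF that(1)] that by (simp add: group.is_monoid monoid.m_closed)
  have "germ_rel I r H \<phi> `` {(i', x' \<otimes>\<^bsub>H i'\<^esub> y') | i' x' y'. (i', x') \<in> germ i x \<and> (i', y') \<in> germ i y} =
    germ i (x \<otimes>\<^bsub>H i\<^esub> y)"
  proof (rule Image_germ_rel)
    show "{(i', x' \<otimes>\<^bsub>H i'\<^esub> y') | i' x' y'. (i', x') \<in> germ i x \<and> (i', y') \<in> germ i y} \<noteq> {}"
      using assms by (auto simp: mem_germ_iff)
    fix p assume "p \<in> {(i', x' \<otimes>\<^bsub>H i'\<^esub> y') | i' x' y'. (i', x') \<in> germ i x \<and> (i', y') \<in> germ i y}"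
    then obtain j x' y' where p: "p = (j, x' \<otimes>\<^bsub>H j\<^esub> y')"
      and "(j, x') \<in> germ i x" "(j, y') \<in> germ i y"
      by blast
    then have j: "j \<in> I" "x' \<in> carrier (H j)" "y' \<in> carrier (H j)" "germ j x' = germ i x" "germ j y' = germ i y"
      using assms by (auto simp: mem_germ_iff)
    then obtain a b where a: "a \<in> I" "r j a" "r i a" "\<phi> j a x' = \<phi> i a x"
      and b: "b \<in> I" "r j b" "r i b" "\<phi> j b y' = \<phi> i b y"
      using assms by (auto simp: germ_eq_iff)
    \<comment> \<open>The stages witnessing the two equalities differ in general; both equalities
      persist at \<open>c\<close>, where the products can be compared.\<close>
    obtain c where c: "c \<in> I" "r a c" "r b c"
      using index_directed[OF a(1) b(1)] by blast
    have rc: "r j c" "r i c"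
      using a c index_trans by blast+
    have "\<phi> j c x' = \<phi> i c x"
      using trans_comp[OF j(1) a(1) c(1) a(2) c(2) j(2)] trans_comp[OF assms(1) a(1) c(1) a(3) c(2) assms(2)] a(4) by simp
    moreover have "\<phi> j c y' = \<phi> i c y"
      using trans_comp[OF j(1) b(1) c(1) b(2) c(3) j(3)] trans_comp[OF assms(1) b(1) c(1) b(3) c(3) assms(3)] b(4) by simp
    ultimately have "\<phi> j c (x' \<otimes>\<^bsub>H j\<^esub> y') = \<phi> i c (x \<otimes>\<^bsub>H i\<^esub> y)"
      using j c rc assms by (simp add: trans_mult)
    then show "germ (fst p) (snd p) = germ i (x \<otimes>\<^bsub>H i\<^esub> y)"
      using j c rc assms mc by (auto simp: p germ_eq_iff)
  qed
  then show ?thesis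
    by (simp add: direct_limit_def)
qed

lemma germ_one:
  assumes "i \<in> I"
  shows "germ i \<one>\<^bsub>H i\<^esub> = \<one>\<^bsub>limit\<^esub>"
proof -
  have oc: "\<one>\<^bsub>H j\<^esub> \<in> carrier (H j)" if "j \<in> I" for j
    using group_at[OF that] by (simp add: group.is_monoid)
  have "germ_rel I r H \<phi> `` {(j, \<one>\<^bsub>H j\<^esub>) | j. j \<in> I} = germ i \<one>\<^bsub>H i\<^esub>"
  proof (rule Image_germ_rel)
    fix p assume "p \<in> {(j, \<one>\<^bsub>H j\<^esub>) | j. j \<in> I}"
    then obtain j where j: "j \<in> I" "p = (j, \<one>\<^bsub>H j\<^esub>)" by blast
    obtain k where "k \<in> I" "r i k" "r j k"
      using index_directed[OF assms j(1)] by blast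
    then show "germ (fst p) (snd p) = germ i \<one>\<^bsub>H i\<^esub>"
      using j assms oc by (auto simp: germ_eq_iff trans_one)
  qed (use assms in auto)
  then show ?thesis
    by (simp add: direct_limit_def)
qed

text \<open>Turns vanishing in the limit into vanishing at a later stage, which is how exactness at
  single stages becomes exactness of the limit.\<close>

lemma germ_one_iff:
  assumes "i \<in> I" "x \<in> carrier (H i)"
  shows "germ i x = \<one>\<^bsub>limit\<^esub> \<longleftrightarrow> (\<exists>j\<in>I. r i j \<and> \<phi> i j x = \<one>\<^bsub>H j\<^esub>)"
proof -
  have oc: "\<one>\<^bsub>H i\<^esub> \<in> carrier (H i)"
    using group_at[OF assms(1)] by (simp add: group.is_monoid)
  have "germ i x = \<one>\<^bsub>limit\<^esub> \<longleftrightarrow> germ i x = germ i \<one>\<^bsub>H i\<^esub>"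
    using assms by (simp add: germ_one)
  then show ?thesis
    using assms oc by (auto simp: germ_eq_iff trans_one)
qed

lemma group_limit: "group limit"
proof (rule groupI)
  have mc: "x \<otimes>\<^bsub>H j\<^esub> y \<in> carrier (H j)" if "j \<in> I" "x \<in> carrier (H j)" "y \<in> carrier (H j)" for j x y
    using group_at[OF that(1)] that by (simp add: group.is_monoid monoid.m_closed)
  obtain i0 where i0: "i0 \<in> I"
    using index_nonempty by blast
  have "\<one>\<^bsub>H i0\<^esub> \<in> carrier (H i0)"
    using group_at[OF i0] by (simp add: group.is_monoid)
  then show "\<one>\<^bsub>limit\<^esub> \<in> carrier limit"
    using germ_carrier[OF i0] germ_one[OF i0] by metis
  show "z \<otimes>\<^bsub>limit\<^esub> w \<in> carrier limit" if zw: "z \<in> carrier limit" "w \<in> carrier limit" for z w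
  proof -
    obtain i x y where "i \<in> I" "x \<in> carrier (H i)" "y \<in> carrier (H i)" "z = germ i x" "w = germ i y"
      using limit_carrierE2[OF zw] .
    then show ?thesis
      by (simp add: limit_mult_germ germ_carrier mc)
  qed
  show "z \<otimes>\<^bsub>limit\<^esub> w \<otimes>\<^bsub>limit\<^esub> v = z \<otimes>\<^bsub>limit\<^esub> (w \<otimes>\<^bsub>limit\<^esub> v)"
    if zw: "z \<in> carrier limit" "w \<in> carrier limit" and v: "v \<in> carrier limit" for z w v
  proof -
    obtain i x y where x: "i \<in> I" "x \<in> carrier (H i)" "y \<in> carrier (H i)" "z = germ i x" "w = germ i y"
      using limit_carrierE2[OF zw] .
    obtain j u where u: "j \<in> I" "u \<in> carrier (H j)" "v = germ j u"
      using limit_carrierE[OF v] .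
    obtain k where k: "k \<in> I" "r i k" "r j k"
      using index_directed[OF x(1) u(1)] by blast
    define x' y' u' where "x' = \<phi> i k x" and "y' = \<phi> i k y" and "u' = \<phi> j k u"
    have c: "x' \<in> carrier (H k)" "y' \<in> carrier (H k)" "u' \<in> carrier (H k)"
      using x u k by (auto simp: x'_def y'_def u'_def trans_closed)
    have "z = germ k x'" "w = germ k y'" "v = germ k u'"
      using x u k by (auto simp: x'_def y'_def u'_def germ_trans)
    moreover have "x' \<otimes>\<^bsub>H k\<^esub> y' \<otimes>\<^bsub>H k\<^esub> u' = x' \<otimes>\<^bsub>H k\<^esub> (y' \<otimes>\<^bsub>H k\<^esub> u')"
      using group_at[OF k(1)] c by (simp add: group.is_monoid monoid.m_assoc)
    ultimately show ?thesis
      using k c by (simp add: limit_mult_germ mc)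
  qed
  show "\<one>\<^bsub>limit\<^esub> \<otimes>\<^bsub>limit\<^esub> z = z" if z: "z \<in> carrier limit" for z
  proof -
    obtain i x where x: "i \<in> I" "x \<in> carrier (H i)" "z = germ i x"
      using limit_carrierE[OF z] .
    then have "germ i \<one>\<^bsub>H i\<^esub> \<otimes>\<^bsub>limit\<^esub> z = z"
      using group_at[OF x(1)] by (simp add: limit_mult_germ group.is_monoid)
    with germ_one[OF x(1)] show ?thesis by simp
  qed
  show "\<exists>w\<in>carrier limit. w \<otimes>\<^bsub>limit\<^esub> z = \<one>\<^bsub>limit\<^esub>" if z: "z \<in> carrier limit" for z
  proof -
    obtain i x where x: "i \<in> I" "x \<in> carrier (H i)" "z = germ i x"
      using limit_carrierE[OF z] .
    note g = group_at[OF x(1)]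
    have ic: "inv\<^bsub>H i\<^esub> x \<in> carrier (H i)"
      using g x by simp
    then have "germ i (inv\<^bsub>H i\<^esub> x) \<otimes>\<^bsub>limit\<^esub> z = \<one>\<^bsub>limit\<^esub>"
      using g x by (simp add: limit_mult_germ group.l_inv germ_one)
    then show ?thesis
      using germ_carrier[OF x(1) ic] by blast
  qed
qed

end

text \<open>Covers the maps induced by \<open>f\<close>, with \<open>rel_maps f\<close> as
  \<open>\<rho>\<close>, and the connecting maps, with equality to a trace as \<open>\<rho>\<close>.
  The map \<open>m\<close> carries only the target index because both formulas are determined by the
  complexes at that index.\<close>

definition limit_map ::
  "'i set \<Rightarrow> ('i \<Rightarrow> 'i \<Rightarrow> bool) \<Rightarrow> ('i \<Rightarrow> 'h monoid) \<Rightarrow> ('i \<Rightarrow> 'i \<Rightarrow> 'h \<Rightarrow> 'h) \<Rightarrow>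
   ('i \<Rightarrow> 'j \<Rightarrow> bool) \<Rightarrow> ('i \<Rightarrow> 'k \<Rightarrow> 'h) \<Rightarrow> ('j \<times> 'k) set \<Rightarrow> ('i \<times> 'h) set" where
  "limit_map I r H \<phi> \<rho> m z = germ_rel I r H \<phi> `` {(i, m i h) | i j h. i \<in> I \<and> (j, h) \<in> z \<and> \<rho> i j}"

text \<open>
  The relation \<open>\<rho> i j\<close> says that the map \<open>m i\<close> is defined on the group with index \<open>j\<close>.
\<close>

locale limit_morphism = S: directed_system J s H' \<psi> + T: directed_system I r H \<phi>
  for J :: "'j set" and s and H' :: "'j \<Rightarrow> 'k monoid" and \<psi>
    and I :: "'i set" and r and H :: "'i \<Rightarrow> 'h monoid" and \<phi> +
  fixes \<rho> :: "'i \<Rightarrow> 'j \<Rightarrow> bool" and m :: "'i \<Rightarrow> 'k \<Rightarrow> 'h"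
  assumes ex_index: "\<And>j. j \<in> J \<Longrightarrow> \<exists>i\<in>I. \<rho> i j"
    and map_hom: "\<And>i j. i \<in> I \<Longrightarrow> j \<in> J \<Longrightarrow> \<rho> i j \<Longrightarrow> m i \<in> hom (H' j) (H i)"
    and map_compat: "\<And>i i' j j'. i \<in> I \<Longrightarrow> i' \<in> I \<Longrightarrow> j \<in> J \<Longrightarrow> j' \<in> J \<Longrightarrow> \<rho> i j \<Longrightarrow> \<rho> i' j' \<Longrightarrow> s j j' \<Longrightarrow>
      \<exists>k\<in>I. r i k \<and> r i' k \<and> (\<forall>h\<in>carrier (H' j). \<phi> i k (m i h) = \<phi> i' k (m i' (\<psi> j j' h)))"
begin

lemma map_closed: "i \<in> I \<Longrightarrow> j \<in> J \<Longrightarrow> \<rho> i j \<Longrightarrow> h \<in> carrier (H' j) \<Longrightarrow> m i h \<in> carrier (H i)"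
  using map_hom by (auto simp: hom_def)

lemma germ_map_trans:
  assumes "i \<in> I" "i' \<in> I" "j \<in> J" "j' \<in> J" "\<rho> i j" "\<rho> i' j'" "s j j'" "h \<in> carrier (H' j)"
  shows "T.germ i (m i h) = T.germ i' (m i' (\<psi> j j' h))"
proof (rule iffD2[OF T.germ_eq_iff])
  have "\<psi> j j' h \<in> carrier (H' j')"
    using assms by (intro S.trans_closed)
  then show "m i' (\<psi> j j' h) \<in> carrier (H i')"
    by (rule map_closed[OF assms(2,4,6)])
  show "m i h \<in> carrier (H i)"
    by (rule map_closed[OF assms(1,3,5,8)])
  show "\<exists>k\<in>I. r i k \<and> r i' k \<and> \<phi> i k (m i h) = \<phi> i' k (m i' (\<psi> j j' h))"
    using map_compat[OF assms(1-7)] assms(8) by blast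
qed (use assms in auto)

text \<open>Two representatives of a germ agree at some later stage \<open>k\<close>, and a target
  index admissible for \<open>k\<close> links the two results.\<close>

lemma limit_map_germ:
  assumes "i \<in> I" "j \<in> J" "\<rho> i j" "h \<in> carrier (H' j)"
  shows "limit_map I r H \<phi> \<rho> m (S.germ j h) = T.germ i (m i h)"
  unfolding limit_map_def
proof (rule T.Image_germ_rel)
  show "{(i, m i h') | i j' h'. i \<in> I \<and> (j', h') \<in> S.germ j h \<and> \<rho> i j'} \<noteq> {}"
    using assms by (auto simp: S.mem_germ_iff)
  fix p assume "p \<in> {(i, m i h') | i j' h'. i \<in> I \<and> (j', h') \<in> S.germ j h \<and> \<rho> i j'}"
  then obtain i' j' h' where p: "p = (i', m i' h')" "i' \<in> I" "(j', h') \<in> S.germ j h" "\<rho> i' j'"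
    by blast
  then have j': "j' \<in> J" "h' \<in> carrier (H' j')" "S.germ j' h' = S.germ j h"
    using assms by (auto simp: S.mem_germ_iff)
  then obtain k where k: "k \<in> J" "s j' k" "s j k" "\<psi> j' k h' = \<psi> j k h"
    using assms by (auto simp: S.germ_eq_iff)
  obtain i'' where i'': "i'' \<in> I" "\<rho> i'' k"
    using ex_index[OF k(1)] by blast
  show "T.germ (fst p) (snd p) = T.germ i (m i h)"
    using germ_map_trans[of i' i'' j' k h'] germ_map_trans[of i i'' j k h] assms p j' k i'' by simp
qed

lemma limit_map_hom: "limit_map I r H \<phi> \<rho> m \<in> hom S.limit T.limit"
proof (rule homI)
  fix z assume "z \<in> carrier S.limit"
  then obtain j h where h: "j \<in> J" "h \<in> carrier (H' j)" "z = S.germ j h"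
    by (rule S.limit_carrierE)
  obtain i where "i \<in> I" "\<rho> i j"
    using ex_index[OF h(1)] by blast
  with h show "limit_map I r H \<phi> \<rho> m z \<in> carrier T.limit"
    by (simp add: limit_map_germ T.germ_carrier map_closed)
next
  fix z w assume "z \<in> carrier S.limit" "w \<in> carrier S.limit"
  then obtain j h k where h: "j \<in> J" "h \<in> carrier (H' j)" "k \<in> carrier (H' j)" "z = S.germ j h" "w = S.germ j k"
    by (rule S.limit_carrierE2)
  obtain i where i: "i \<in> I" "\<rho> i j"
    using ex_index[OF h(1)] by blast
  have "h \<otimes>\<^bsub>H' j\<^esub> k \<in> carrier (H' j)"
    using S.group_at[OF h(1)] h by (simp add: group.is_monoid monoid.m_closed)
  moreover have "m i (h \<otimes>\<^bsub>H' j\<^esub> k) = m i h \<otimes>\<^bsub>H i\<^esub> m i k"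
    using map_hom[OF i(1) h(1) i(2)] h by (auto simp: hom_def)
  ultimately show "limit_map I r H \<phi> \<rho> m (z \<otimes>\<^bsub>S.limit\<^esub> w) =
      limit_map I r H \<phi> \<rho> m z \<otimes>\<^bsub>T.limit\<^esub> limit_map I r H \<phi> \<rho> m w"
    using h i by (simp add: S.limit_mult_germ T.limit_mult_germ limit_map_germ map_closed)
qed

end

section \<open>Inverse limits\<close>

lemma inverse_limit_simps:
  "carrier (inverse_limit I r H \<phi>) =
     {z \<in> \<Pi>\<^sub>E i\<in>I. carrier (H i). \<forall>i\<in>I. \<forall>j\<in>I. r i j \<longrightarrow> \<phi> i j (z i) = z j}"
  "x \<otimes>\<^bsub>inverse_limit I r H \<phi>\<^esub> y = (\<lambda>i\<in>I. x i \<otimes>\<^bsub>H i\<^esub> y i)"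
  "\<one>\<^bsub>inverse_limit I r H \<phi>\<^esub> = (\<lambda>i\<in>I. \<one>\<^bsub>H i\<^esub>)"
  by (simp_all add: inverse_limit_def product_group_def)

text \<open>Compatible families form a subgroup of the product because all transition maps are
  homomorphisms.\<close>

lemma group_inverse_limit:
  assumes grp: "\<And>i. i \<in> I \<Longrightarrow> group (H i)"
    and hom: "\<And>i j. i \<in> I \<Longrightarrow> j \<in> I \<Longrightarrow> r i j \<Longrightarrow> \<phi> i j \<in> hom (H i) (H j)"
  shows "group (inverse_limit I r H \<phi>)"
proof -
  have P: "group (product_group I H)"
    using grp by simp
  have h: "group_hom (H i) (H j) (\<phi> i j)" if "i \<in> I" "j \<in> I" "r i j" for i j
    using that grp hom by (simp add: group_hom_def group_hom_axioms_def)
  have "subgroup {z \<in> carrier (product_group I H). \<forall>i\<in>I. \<forall>j\<in>I. r i j \<longrightarrow> \<phi> i j (z i) = z j} (product_group I H)"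
  proof (rule group.subgroupI[OF P])
    show "{z \<in> carrier (product_group I H). \<forall>i\<in>I. \<forall>j\<in>I. r i j \<longrightarrow> \<phi> i j (z i) = z j} \<noteq> {}"
    proof -
      have "\<one>\<^bsub>product_group I H\<^esub> \<in> {z \<in> carrier (product_group I H). \<forall>i\<in>I. \<forall>j\<in>I. r i j \<longrightarrow> \<phi> i j (z i) = z j}"
        using monoid.one_closed[OF group.is_monoid[OF P]] h[THEN group_hom.hom_one] by auto
      then show ?thesis by blast
    qed
    fix a assume a: "a \<in> {z \<in> carrier (product_group I H). \<forall>i\<in>I. \<forall>j\<in>I. r i j \<longrightarrow> \<phi> i j (z i) = z j}"
    then have ai: "a i \<in> carrier (H i)" if "i \<in> I" for i
      using that by auto
    have "inv\<^bsub>product_group I H\<^esub> a = (\<lambda>i\<in>I. inv\<^bsub>H i\<^esub> a i)"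
      using a grp by (intro inv_product_group) auto
    moreover have "inv\<^bsub>product_group I H\<^esub> a \<in> carrier (product_group I H)"
      using a P by (intro group.inv_closed) auto
    ultimately show "inv\<^bsub>product_group I H\<^esub> a \<in>
        {z \<in> carrier (product_group I H). \<forall>i\<in>I. \<forall>j\<in>I. r i j \<longrightarrow> \<phi> i j (z i) = z j}"
      using a ai h[THEN group_hom.hom_inv] by simp
    fix b assume b: "b \<in> {z \<in> carrier (product_group I H). \<forall>i\<in>I. \<forall>j\<in>I. r i j \<longrightarrow> \<phi> i j (z i) = z j}"
    then have bi: "b i \<in> carrier (H i)" if "i \<in> I" for i
      using that by auto
    have "a \<otimes>\<^bsub>product_group I H\<^esub> b \<in> carrier (product_group I H)"
      using a b group.is_monoid[OF P] by (intro monoid.m_closed) auto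
    moreover have "\<phi> i j (a i \<otimes>\<^bsub>H i\<^esub> b i) = a j \<otimes>\<^bsub>H j\<^esub> b j" if "i \<in> I" "j \<in> I" "r i j" for i j
      using hom[OF that] a b ai bi that by (simp add: hom_def)
    ultimately show "a \<otimes>\<^bsub>product_group I H\<^esub> b \<in>
        {z \<in> carrier (product_group I H). \<forall>i\<in>I. \<forall>j\<in>I. r i j \<longrightarrow> \<phi> i j (z i) = z j}"
      by simp
  qed auto
  then show ?thesis
    unfolding inverse_limit_def by (rule subgroup.subgroup_is_group[OF _ P])
qed

text \<open>\<open>\<sigma>\<close> picks a source index for each target index and need not be
  monotone; compatibility is therefore formulated for the values of a compatible family, not for
  arbitrary elements at one index.\<close>

lemma inverse_limit_map_hom:
  assumes \<sigma>: "\<And>j. j \<in> J \<Longrightarrow> \<sigma> j \<in> I"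
    and hom: "\<And>j. j \<in> J \<Longrightarrow> m j \<in> hom (H (\<sigma> j)) (H' j)"
    and compat: "\<And>z j j'. z \<in> carrier (inverse_limit I r H \<phi>) \<Longrightarrow> j \<in> J \<Longrightarrow> j' \<in> J \<Longrightarrow> s j j' \<Longrightarrow>
      \<psi> j j' (m j (z (\<sigma> j))) = m j' (z (\<sigma> j'))"
  shows "(\<lambda>z. \<lambda>j\<in>J. m j (z (\<sigma> j))) \<in> hom (inverse_limit I r H \<phi>) (inverse_limit J s H' \<psi>)"
proof (rule homI)
  fix z assume z: "z \<in> carrier (inverse_limit I r H \<phi>)"
  have "m j (z (\<sigma> j)) \<in> carrier (H' j)" if "j \<in> J" for j
    using hom[OF that] \<sigma>[OF that] z by (auto simp: hom_def inverse_limit_simps)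
  then show "(\<lambda>j\<in>J. m j (z (\<sigma> j))) \<in> carrier (inverse_limit J s H' \<psi>)"
    using compat[OF z] by (simp add: inverse_limit_simps)
next
  fix z w assume z: "z \<in> carrier (inverse_limit I r H \<phi>)" and w: "w \<in> carrier (inverse_limit I r H \<phi>)"
  have "m j (z (\<sigma> j) \<otimes>\<^bsub>H (\<sigma> j)\<^esub> w (\<sigma> j)) = m j (z (\<sigma> j)) \<otimes>\<^bsub>H' j\<^esub> m j (w (\<sigma> j))" if "j \<in> J" for j
    using \<sigma>[OF that] z w by (intro hom_mult[OF hom[OF that]]) (auto simp: inverse_limit_simps)
  then show "(\<lambda>j\<in>J. m j ((z \<otimes>\<^bsub>inverse_limit I r H \<phi>\<^esub> w) (\<sigma> j))) =
      (\<lambda>j\<in>J. m j (z (\<sigma> j))) \<otimes>\<^bsub>inverse_limit J s H' \<psi>\<^esub> (\<lambda>j\<in>J. m j (w (\<sigma> j)))"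
    using \<sigma> by (auto simp: inverse_limit_simps intro!: restrict_ext)
qed

section \<open>Vietoris-Rips complexes of pairs\<close>

lemma VR_complex_empty [simp]: "VR_complex {} U = {}"
  by (auto simp: VR_complex_def)

text \<open>Deleting entries from an admissible ordering of a simplex leaves an admissible ordering
  of the face.\<close>

lemma down_closed_VR: "down_closed (VR_complex X U)"
  unfolding down_closed_def
proof (intro ballI allI impI)
  fix s t assume "s \<in> VR_complex X U" and t: "t \<subseteq> s" "t \<noteq> {}"
  then obtain xs where xs: "s = set xs" "set xs \<subseteq> X" "distinct xs" "sorted_wrt (\<lambda>x y. (x, y) \<in> U) xs"
    by (auto simp: VR_complex_def)
  let ?ys = "filter (\<lambda>x. x \<in> t) xs"
  have "set ?ys = t"
    using xs t by auto
  moreover from this t have "?ys \<noteq> []"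
    by (metis set_empty2)
  ultimately show "t \<in> VR_complex X U"
    using xs t sorted_wrt_filter[OF xs(4)] unfolding VR_complex_def
    by (intro CollectI exI[of _ ?ys]) auto
qed

lemma sorted_wrt_remdups: "sorted_wrt R xs \<Longrightarrow> sorted_wrt R (remdups xs)"
  by (induction xs) auto

text \<open>The images of an admissible ordering, with repetitions deleted, order the image simplex
  admissibly.\<close>

lemma simp_map_VR_complex:
  assumes "f \<in> X \<rightarrow> Y" "rel_maps f U V"
  shows "simp_map f (VR_complex X U) (VR_complex Y V)"
  unfolding simp_map_def
proof
  fix s assume "s \<in> VR_complex X U"
  then obtain xs where xs: "s = set xs" "xs \<noteq> []" "set xs \<subseteq> X" "sorted_wrt (\<lambda>x y. (x, y) \<in> U) xs"
    by (auto simp: VR_complex_def)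
  have "sorted_wrt (\<lambda>x y. (f x, f y) \<in> V) xs"
    using assms(2) by (intro sorted_wrt_mono_rel[OF _ xs(4)]) (auto simp: rel_maps_def)
  then have "sorted_wrt (\<lambda>x y. (x, y) \<in> V) (remdups (map f xs))"
    by (intro sorted_wrt_remdups) (simp add: sorted_wrt_map)
  moreover have "set (remdups (map f xs)) = f ` s" "f ` s \<subseteq> Y" "remdups (map f xs) \<noteq> []"
    using xs assms(1) by auto
  ultimately show "f ` s \<in> VR_complex Y V"
    unfolding VR_complex_def by (intro CollectI exI[of _ "remdups (map f xs)"]) auto
qed

text \<open>With this and the following accessors, statements about a pair \<open>P\<close> apply
  verbatim to \<open>total_space P\<close> and \<open>subspace P\<close>, without taking triples
  apart.\<close>

fun VR_index :: "'a upair \<Rightarrow> ('a \<times> 'a) set set" where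
  "VR_index (X, A, F) = indices F"

fun VR_big :: "'a upair \<Rightarrow> ('a \<times> 'a) set \<Rightarrow> 'a set set" where
  "VR_big (X, A, F) U = VR_complex X U"

fun VR_small :: "'a upair \<Rightarrow> ('a \<times> 'a) set \<Rightarrow> 'a set set" where
  "VR_small (X, A, F) U = VR_sub A U"

fun VR_trace :: "'a upair \<Rightarrow> ('a \<times> 'a) set \<Rightarrow> ('a \<times> 'a) set" where
  "VR_trace (X, A, F) U = trace_rel A U"

text \<open>
  The part of the axioms on which limits over \<open>VR_index P\<close> depend; unlike
  \<open>semi_uniform_pair\<close>, it also covers the pair with empty total space.
\<close>

definition filtered_pair :: "'a upair \<Rightarrow> bool" where
  "filtered_pair P \<longleftrightarrow> fst (snd P) \<subseteq> fst P \<and> VR_index P \<noteq> {} \<and>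
     (\<forall>U\<in>VR_index P. \<forall>V\<in>VR_index P. U \<inter> V \<in> VR_index P)"

text \<open>Phrased with \<open>VR_index\<close> in order to include the empty subspace, whose index
  set is \<open>{{}}\<close> although its trace family is empty. Uniformly continuous maps of pairs
  and the inclusions of the sequences are all of this kind.\<close>

definition filtered_map :: "'a upair \<Rightarrow> 'b upair \<Rightarrow> ('a \<Rightarrow> 'b) \<Rightarrow> bool" where
  "filtered_map P Q f \<longleftrightarrow> f \<in> fst P \<rightarrow> fst Q \<and> f ` fst (snd P) \<subseteq> fst (snd Q) \<and>
     (\<forall>V\<in>VR_index Q. \<exists>U\<in>VR_index P. rel_maps f U V)"

lemma rel_maps_id [simp]: "rel_maps id U V \<longleftrightarrow> U \<subseteq> V"
  by (auto simp: rel_maps_def)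

lemma rel_maps_mono: "rel_maps f U V \<Longrightarrow> U' \<subseteq> U \<Longrightarrow> V \<subseteq> V' \<Longrightarrow> rel_maps f U' V'"
  unfolding rel_maps_def by fast

lemma rel_maps_comp: "rel_maps f U V \<Longrightarrow> rel_maps g V W \<Longrightarrow> rel_maps (g \<circ> f) U W"
  by (fastforce simp: rel_maps_def)

text \<open>For nonempty \<open>A\<close> every trace contains diagonal points and so belongs to
  \<open>trace_family\<close>. For empty \<open>A\<close> that family is empty, but all traces equal
  \<open>{}\<close>, which is the index supplied by \<open>indices\<close>. Either way the indices
  of the subspace are the traces.\<close>

lemma VR_index_semi_uniform:
  assumes "semi_uniform_pair (X, A, F)"
  shows "VR_index (X, A, F) = F" "VR_index (subspace (X, A, F)) = trace_rel A ` F"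
proof -
  have F: "F \<noteq> {}" "\<And>U. U \<in> F \<Longrightarrow> Id_on X \<subseteq> U" "A \<subseteq> X"
    using assms by (auto simp: semi_uniform_def)
  show "VR_index (X, A, F) = F"
    using F by (simp add: indices_def)
  show "VR_index (subspace (X, A, F)) = trace_rel A ` F"
  proof (cases "A = {}")
    case True
    then have "trace_rel A U = {}" for U
      by (simp add: trace_rel_def)
    then show ?thesis
      using F(1) by (auto simp: indices_def trace_family_def)
  next
    case False
    then have "trace_rel A U \<noteq> {}" if "U \<in> F" for U
      using F(2)[OF that] F(3) by (auto simp: trace_rel_def)
    then have "trace_family A F = trace_rel A ` F"
      by (auto simp: trace_family_def)
    then show ?thesis
      using F(1) by (simp add: indices_def)
  qed
qed

lemma VR_index_total [simp]: "VR_index (total_space P) = VR_index P"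
  by (cases P) simp

lemma VR_index_subspace: "semi_uniform_pair P \<Longrightarrow> VR_index (subspace P) = VR_trace P ` VR_index P"
proof (cases P)
  case (fields X A F)
  assume "semi_uniform_pair P"
  then show ?thesis
    using VR_index_semi_uniform[of X A F] by (simp add: fields image_def)
qed

text \<open>The complex of the subspace at a trace is literally the subcomplex of the pair at
  \<open>U\<close>, so the sequence of one simplicial pair is a stage of the sequence of
  limits.\<close>

lemma VR_simps [simp]:
  "VR_big (total_space P) U = VR_big P U"
  "VR_small (total_space P) U = {}"
  "VR_big (subspace P) (VR_trace P U) = VR_small P U"
  "VR_small (subspace P) W = {}"
  by (cases P; simp)+

lemma VR_trace_Int: "VR_trace P (U \<inter> V) = VR_trace P U \<inter> VR_trace P V"
  by (cases P) (auto simp: trace_rel_def)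

lemma VR_trace_subset: "VR_trace P U \<subseteq> U"
  by (cases P) (auto simp: trace_rel_def)

lemma rel_maps_VR_trace:
  "filtered_map P Q f \<Longrightarrow> rel_maps f U V \<Longrightarrow> rel_maps f (VR_trace P U) (VR_trace Q V)"
  by (cases P; cases Q) (auto simp: filtered_map_def trace_rel_def rel_maps_def)

lemma filtered_pairs:
  assumes "semi_uniform_pair P"
  shows "filtered_pair P" "filtered_pair (total_space P)" "filtered_pair (subspace P)"
proof -
  obtain X A F where P: "P = (X, A, F)"
    by (cases P)
  have su: "semi_uniform X F" and A: "A \<subseteq> X"
    using assms by (simp_all add: P)
  then have F: "F \<noteq> {}" "\<And>U V. U \<in> F \<Longrightarrow> V \<in> F \<Longrightarrow> U \<inter> V \<in> F" "A \<subseteq> X"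
    unfolding semi_uniform_def by blast+
  have i: "VR_index P = F"
    using VR_index_semi_uniform assms by (simp add: P)
  show "filtered_pair P" "filtered_pair (total_space P)"
    using F by (auto simp: filtered_pair_def i) (auto simp: P)
  show "filtered_pair (subspace P)"
    using F unfolding filtered_pair_def VR_index_subspace[OF assms] i
    by (auto simp: VR_trace_Int[symmetric]) (auto simp: P)
qed

lemma filtered_maps:
  assumes "semi_uniform_pair P" "semi_uniform_pair Q" "unif_cont_pair P Q f"
  shows "filtered_map P Q f" "filtered_map (total_space P) (total_space Q) f"
    "filtered_map (subspace P) (subspace Q) f"
proof -
  obtain X A F where P: "P = (X, A, F)"
    by (cases P)
  obtain Y B F' where Q: "Q = (Y, B, F')"
    by (cases Q)
  have i: "VR_index P = F" "VR_index Q = F'"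
    using VR_index_semi_uniform assms by (simp_all add: P Q)
  have f: "f \<in> X \<rightarrow> Y" "f ` A \<subseteq> B" "\<And>V. V \<in> F' \<Longrightarrow> \<exists>U\<in>F. rel_maps f U V"
    using assms(3) by (auto simp: P Q unif_cont_def)
  show PQ: "filtered_map P Q f" and "filtered_map (total_space P) (total_space Q) f"
    using f by (auto simp: filtered_map_def i) (auto simp: P Q)
  have "\<exists>U\<in>VR_index (subspace P). rel_maps f U V" if V: "V \<in> VR_index (subspace Q)" for V
  proof -
    obtain V' where V': "V' \<in> F'" "V = VR_trace Q V'"
      using V by (auto simp: VR_index_subspace assms i)
    obtain U where "U \<in> F" "rel_maps f U V'"
      using f(3)[OF V'(1)] by blast
    then show ?thesis
      using rel_maps_VR_trace[OF PQ] by (auto simp: VR_index_subspace assms i V'(2))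
  qed
  then show "filtered_map (subspace P) (subspace Q) f"
    using f(2) by (auto simp: filtered_map_def) (auto simp: P Q)
qed

lemma filtered_map_id: "filtered_map P P id"
  by (auto simp: filtered_map_def)

lemma filtered_map_total: "filtered_map (total_space P) P id"
  by (cases P) (auto simp: filtered_map_def)

text \<open>The trace of \<open>U\<close> is an index of the subspace and is contained in
  \<open>U\<close>.\<close>

lemma filtered_map_subspace:
  assumes "semi_uniform_pair P"
  shows "filtered_map (subspace P) (total_space P) id"
proof -
  have "\<exists>W\<in>VR_index (subspace P). W \<subseteq> U" if "U \<in> VR_index P" for U
    using that VR_trace_subset[of P U] by (auto simp: VR_index_subspace[OF assms] simp del: VR_trace.simps)
  then show ?thesis
    using assms by (cases P) (auto simp: filtered_map_def)
qed

lemma filtered_map_comp: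
  assumes "filtered_map P Q f" "filtered_map Q R g"
  shows "filtered_map P R (g \<circ> f)"
proof -
  have "\<exists>U\<in>VR_index P. rel_maps (g \<circ> f) U W" if "W \<in> VR_index R" for W
    using assms that rel_maps_comp[of f _ _ g W] unfolding filtered_map_def by meson
  then show ?thesis
    using assms by (fastforce simp: filtered_map_def)
qed

lemma filtered_pair_Int: "filtered_pair P \<Longrightarrow> U \<in> VR_index P \<Longrightarrow> V \<in> VR_index P \<Longrightarrow> U \<inter> V \<in> VR_index P"
  by (simp add: filtered_pair_def)

lemma simp_pair_VR: "filtered_pair P \<Longrightarrow> simp_pair (VR_big P U) (VR_small P U)"
proof (cases P)
  case (fields X A F)
  assume "filtered_pair P"
  then have "A \<subseteq> X"
    by (simp add: filtered_pair_def fields)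
  then have "simp_map id (VR_sub A U) (VR_complex X U)"
    by (intro simp_map_VR_complex) (auto simp: trace_rel_def)
  then show ?thesis
    by (simp add: fields simp_pair_def down_closed_VR)
qed

lemma simp_map_VR:
  assumes "filtered_map P Q f" "rel_maps f U V"
  shows "simp_map f (VR_big P U) (VR_big Q V)" "simp_map f (VR_small P U) (VR_small Q V)"
proof -
  obtain X A F where P: "P = (X, A, F)"
    by (cases P)
  obtain Y B F' where Q: "Q = (Y, B, F')"
    by (cases Q)
  have f: "f \<in> X \<rightarrow> Y" "f \<in> A \<rightarrow> B"
    using assms(1) by (auto simp: P Q filtered_map_def)
  show "simp_map f (VR_big P U) (VR_big Q V)"
    using f assms(2) by (auto simp: P Q intro: simp_map_VR_complex)
  have "rel_maps f (trace_rel A U) (trace_rel B V)"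
    using rel_maps_VR_trace[OF assms] by (simp add: P Q)
  then show "simp_map f (VR_small P U) (VR_small Q V)"
    using f by (auto simp: P Q intro: simp_map_VR_complex)
qed

section \<open>Vietoris-Rips cohomology\<close>

context comm_group
begin

abbreviation coh where "coh n P U \<equiv> cohomology_group G n (VR_big P U) (VR_small P U)"

abbreviation cohm where "cohm n P U \<equiv> cohomology_map G n (VR_big P U) (VR_small P U)"

abbreviation conn where "conn n P U \<equiv> cohomology_connecting G n (VR_big P U) (VR_small P U)"

lemma cohm_hom:
  assumes "filtered_pair P" "filtered_pair Q" "filtered_map P Q f" "rel_maps f U V"
  shows "cohm n P U f \<in> hom (coh n Q V) (coh n P U)"
  using assms by (intro cohomology_map_hom simp_pair_VR simp_map_VR)

lemma cohm_closed:
  assumes "filtered_pair P" "filtered_pair Q" "filtered_map P Q f" "rel_maps f U V" "h \<in> carrier (coh n Q V)"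
  shows "cohm n P U f h \<in> carrier (coh n P U)"
  by (rule hom_in_carrier[OF cohm_hom[OF assms(1-4)] assms(5)])

lemma cohm_id: "filtered_pair P \<Longrightarrow> h \<in> carrier (coh n P U) \<Longrightarrow> cohm n P U id h = h"
  by (intro cohomology_map_id simp_pair_VR)

lemma cohm_comp:
  assumes "filtered_pair P" "filtered_pair Q" "filtered_pair R" "filtered_map P Q f" "filtered_map Q R g"
    and "rel_maps f U V" "rel_maps g V W" "h \<in> carrier (coh n R W)"
  shows "cohm n P U f (cohm n Q V g h) = cohm n P U (g \<circ> f) h"
  using assms
  by (intro cohomology_map_comp[symmetric, of _ _ "VR_big Q V" "VR_small Q V" "VR_big R W" "VR_small R W"]
      simp_pair_VR simp_map_VR)

lemma directed_system_VR:
  assumes P: "filtered_pair P"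
  shows "directed_system (VR_index P) (\<supseteq>) (coh n P) (\<lambda>U U'. cohm n P U' id)"
proof (rule directed_system.intro)
  show "VR_index P \<noteq> {}"
    using P by (simp add: filtered_pair_def)
next
  fix i assume i: "i \<in> VR_index P"
  show "i \<subseteq> i" by simp
  show "group (coh n P i)"
    using P by (intro group_cohomology simp_pair_VR)
  fix x assume "x \<in> carrier (coh n P i)"
  then show "cohm n P i id x = x"
    using P by (intro cohm_id)
next
  fix i j k :: "('c \<times> 'c) set" assume "j \<subseteq> i" "k \<subseteq> j"
  then show "k \<subseteq> i" by simp
next
  fix i j assume "i \<in> VR_index P" "j \<in> VR_index P"
  then show "\<exists>k\<in>VR_index P. k \<subseteq> i \<and> k \<subseteq> j"
    using filtered_pair_Int[OF P] by (intro bexI[of _ "i \<inter> j"]) auto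
next
  fix i j :: "('c \<times> 'c) set" assume "j \<subseteq> i"
  then show "cohm n P j id \<in> hom (coh n P i) (coh n P j)"
    using P by (intro cohm_hom filtered_map_id) auto
next
  fix i j k x assume "j \<subseteq> i" "k \<subseteq> j" "x \<in> carrier (coh n P i)"
  then show "cohm n P k id (cohm n P j id x) = cohm n P k id x"
    using cohm_comp[OF P P P filtered_map_id filtered_map_id, of k j i x n] by simp
qed

lemma VR_cohomology_eq:
  "VR_cohomology G n P = direct_limit (VR_index P) (\<supseteq>) (coh n P) (\<lambda>U U'. cohm n P U' id)"
  by (cases P) simp

lemma VR_germ_rel_eq:
  "VR_germ_rel G n P = germ_rel (VR_index P) (\<supseteq>) (coh n P) (\<lambda>U U'. cohm n P U' id)"
  by (cases P) simp

definition VR_germ where "VR_germ n P U h = VR_germ_rel G n P `` {(U, h)}"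

lemma VR_germ_eq:
  assumes "filtered_pair P"
  shows "directed_system.germ (VR_index P) (\<supseteq>) (coh n P) (\<lambda>U U'. cohm n P U' id) = VR_germ n P"
  using directed_system.germ_def[OF directed_system_VR[OF assms]]
  by (auto simp: VR_germ_def VR_germ_rel_eq fun_eq_iff)

lemma group_VR_cohomology: "filtered_pair P \<Longrightarrow> group (VR_cohomology G n P)"
  unfolding VR_cohomology_eq by (intro directed_system.group_limit directed_system_VR)

lemma VR_cohomologyE:
  assumes "filtered_pair P" "z \<in> carrier (VR_cohomology G n P)"
  obtains U h where "U \<in> VR_index P" "h \<in> carrier (coh n P U)" "z = VR_germ n P U h"
  using directed_system.limit_carrierE[OF directed_system_VR[OF assms(1)] assms(2)[unfolded VR_cohomology_eq]]
  unfolding VR_germ_eq[OF assms(1)] by blast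

lemma VR_germ_carrier:
  assumes "filtered_pair P" "U \<in> VR_index P" "h \<in> carrier (coh n P U)"
  shows "VR_germ n P U h \<in> carrier (VR_cohomology G n P)"
  using directed_system.germ_carrier[OF directed_system_VR[OF assms(1)] assms(2,3)]
  unfolding VR_cohomology_eq VR_germ_eq[OF assms(1)] .

lemma VR_germ_restrict:
  assumes "filtered_pair P" "U \<in> VR_index P" "U' \<in> VR_index P" "U' \<subseteq> U" "h \<in> carrier (coh n P U)"
  shows "VR_germ n P U' (cohm n P U' id h) = VR_germ n P U h"
  using directed_system.germ_trans[OF directed_system_VR[OF assms(1)] assms(2,3) _ assms(5)] assms(4)
  unfolding VR_germ_eq[OF assms(1)] by simp

lemma VR_germ_one:
  assumes "filtered_pair P" "U \<in> VR_index P"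
  shows "VR_germ n P U \<one>\<^bsub>coh n P U\<^esub> = \<one>\<^bsub>VR_cohomology G n P\<^esub>"
  using directed_system.germ_one[OF directed_system_VR[OF assms(1)] assms(2)]
  unfolding VR_germ_eq[OF assms(1)] VR_cohomology_eq .

lemma VR_germ_one_iff:
  assumes "filtered_pair P" "U \<in> VR_index P" "h \<in> carrier (coh n P U)"
  shows "VR_germ n P U h = \<one>\<^bsub>VR_cohomology G n P\<^esub> \<longleftrightarrow>
    (\<exists>U'\<in>VR_index P. U' \<subseteq> U \<and> cohm n P U' id h = \<one>\<^bsub>coh n P U'\<^esub>)"
  using directed_system.germ_one_iff[OF directed_system_VR[OF assms(1)] assms(2,3)]
  unfolding VR_germ_eq[OF assms(1)] VR_cohomology_eq .

lemma VR_cohomology_map_eq: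
  "VR_cohomology_map G n P Q f = limit_map (VR_index P) (\<supseteq>) (coh n P) (\<lambda>U U'. cohm n P U' id)
     (rel_maps f) (\<lambda>U. cohm n P U f)"
  by (cases P; cases Q) (simp add: limit_map_def fun_eq_iff del: VR_germ_rel.simps add: VR_germ_rel_eq)

text \<open>Any two stages of the induced map agree over \<open>U \<inter> U'\<close>: by
  functoriality both composites are the map that \<open>f\<close> induces from the group at
  \<open>V\<close> to the group at that intersection.\<close>

lemma limit_morphism_VR:
  assumes P: "filtered_pair P" and Q: "filtered_pair Q" and f: "filtered_map P Q f"
  shows "limit_morphism (VR_index Q) (\<supseteq>) (coh n Q) (\<lambda>U U'. cohm n Q U' id)
    (VR_index P) (\<supseteq>) (coh n P) (\<lambda>U U'. cohm n P U' id) (rel_maps f) (\<lambda>U. cohm n P U f)"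
proof (intro limit_morphism.intro limit_morphism_axioms.intro directed_system_VR P Q)
  show "\<exists>U\<in>VR_index P. rel_maps f U V" if "V \<in> VR_index Q" for V
    using f that by (simp add: filtered_map_def)
  show "cohm n P U f \<in> hom (coh n Q V) (coh n P U)" if "rel_maps f U V" for U V
    using cohm_hom[OF P Q f that] .
  fix U U' V V'
  assume U: "U \<in> VR_index P" "U' \<in> VR_index P" and V: "V' \<subseteq> V"
    and UV: "rel_maps f U V" "rel_maps f U' V'"
  let ?W = "U \<inter> U'"
  have "cohm n P ?W id (cohm n P U f h) = cohm n P ?W id (cohm n P U' f (cohm n Q V' id h))"
    if h: "h \<in> carrier (coh n Q V)" for h
  proof -
    have "cohm n P ?W id (cohm n P U f h) = cohm n P ?W f h"
      using cohm_comp[OF P P Q filtered_map_id f _ UV(1) h, of ?W] by simp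
    moreover have "cohm n P U' f (cohm n Q V' id h) = cohm n P U' f h"
      using cohm_comp[OF P Q Q f filtered_map_id UV(2) _ h] V by simp
    moreover have "cohm n P ?W id (cohm n P U' f h) = cohm n P ?W f h"
      using cohm_comp[OF P P Q filtered_map_id f _ rel_maps_mono[OF UV(2) subset_refl V] h, of ?W] by simp
    ultimately show ?thesis by simp
  qed
  then show "\<exists>k\<in>VR_index P. k \<subseteq> U \<and> k \<subseteq> U' \<and>
      (\<forall>h\<in>carrier (coh n Q V). cohm n P k id (cohm n P U f h) = cohm n P k id (cohm n P U' f (cohm n Q V' id h)))"
    using filtered_pair_Int[OF P U] by (intro bexI[of _ ?W]) auto
qed

lemma VR_cohomology_map_hom:
  assumes "filtered_pair P" "filtered_pair Q" "filtered_map P Q f"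
  shows "VR_cohomology_map G n P Q f \<in> hom (VR_cohomology G n Q) (VR_cohomology G n P)"
  unfolding VR_cohomology_map_eq VR_cohomology_eq
  by (rule limit_morphism.limit_map_hom[OF limit_morphism_VR[OF assms]])

lemma VR_cohomology_map_germ:
  assumes "filtered_pair P" "filtered_pair Q" "filtered_map P Q f"
    and "U \<in> VR_index P" "V \<in> VR_index Q" "rel_maps f U V" "h \<in> carrier (coh n Q V)"
  shows "VR_cohomology_map G n P Q f (VR_germ n Q V h) = VR_germ n P U (cohm n P U f h)"
  using limit_morphism.limit_map_germ[OF limit_morphism_VR[OF assms(1-3)] assms(4-7)]
  unfolding VR_germ_eq[OF assms(1)] VR_germ_eq[OF assms(2)] VR_cohomology_map_eq .

lemma VR_cohomology_map_id:
  assumes P: "filtered_pair P" and z: "z \<in> carrier (VR_cohomology G n P)"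
  shows "VR_cohomology_map G n P P id z = z"
proof -
  obtain U h where "U \<in> VR_index P" "h \<in> carrier (coh n P U)" "z = VR_germ n P U h"
    using VR_cohomologyE[OF assms] .
  then show ?thesis
    using VR_cohomology_map_germ[OF P P filtered_map_id, of U U h n] P by (simp add: cohm_id)
qed

lemma VR_cohomology_map_comp:
  assumes PQR: "filtered_pair P" "filtered_pair Q" "filtered_pair R"
    and fg: "filtered_map P Q f" "filtered_map Q R g" and z: "z \<in> carrier (VR_cohomology G n R)"
  shows "VR_cohomology_map G n P R (g \<circ> f) z = VR_cohomology_map G n P Q f (VR_cohomology_map G n Q R g z)"
proof -
  obtain W h where h: "W \<in> VR_index R" "h \<in> carrier (coh n R W)" "z = VR_germ n R W h"
    using VR_cohomologyE[OF PQR(3) z] .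
  obtain V where V: "V \<in> VR_index Q" "rel_maps g V W"
    using fg(2) h(1) by (auto simp: filtered_map_def)
  obtain U where U: "U \<in> VR_index P" "rel_maps f U V"
    using fg(1) V(1) by (auto simp: filtered_map_def)
  have "VR_cohomology_map G n P R (g \<circ> f) z = VR_germ n P U (cohm n P U (g \<circ> f) h)"
    unfolding h(3) using PQR fg h U V
    by (intro VR_cohomology_map_germ filtered_map_comp rel_maps_comp[of f U V g W])
  moreover have "VR_cohomology_map G n Q R g z = VR_germ n Q V (cohm n Q V g h)"
    unfolding h(3) using PQR fg h U V by (intro VR_cohomology_map_germ)
  moreover have "cohm n Q V g h \<in> carrier (coh n Q V)"
    using PQR fg h V by (intro cohm_closed)
  ultimately show ?thesis
    using VR_cohomology_map_germ[OF PQR(1,2) fg(1) U(1) V(1) U(2)] cohm_comp[OF PQR fg U(2) V(2) h(2)]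
    by simp
qed

section \<open>The connecting homomorphism in the direct limit\<close>

lemma conn_hom:
  "filtered_pair P \<Longrightarrow> conn n P U \<in> hom (coh n (subspace P) (VR_trace P U)) (coh (n + 1) P U)"
  using cohomology_connecting_hom[OF simp_pair_VR[of P U], of n] by simp

lemma conn_closed:
  "filtered_pair P \<Longrightarrow> h \<in> carrier (coh n (subspace P) (VR_trace P U)) \<Longrightarrow> conn n P U h \<in> carrier (coh (n + 1) P U)"
  by (rule hom_in_carrier[OF conn_hom])

lemma conn_natural:
  assumes "filtered_pair P" "filtered_pair Q" "filtered_map P Q f" "rel_maps f U V"
    and "h \<in> carrier (coh n (subspace Q) (VR_trace Q V))"
  shows "conn n P U (cohm n (subspace P) (VR_trace P U) f h) = cohm (n + 1) P U f (conn n Q V h)"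
  using assms cohomology_connecting_natural[OF simp_pair_VR[OF assms(1)] simp_pair_VR[OF assms(2)]
      simp_map_VR[OF assms(3,4)]]
  by simp

text \<open>The definition ranges over \<open>F\<close> and the limit over
  \<open>VR_index P\<close>; for a semi-uniform pair these agree.\<close>

lemma VR_cohomology_connecting_eq:
  assumes "semi_uniform_pair P"
  shows "VR_cohomology_connecting G n P = limit_map (VR_index P) (\<supseteq>) (coh (n + 1) P)
     (\<lambda>U U'. cohm (n + 1) P U' id) (\<lambda>U W. W = VR_trace P U) (conn n P)"
proof -
  obtain X A F where P: "P = (X, A, F)"
    by (cases P)
  have i: "VR_index P = F"
    using VR_index_semi_uniform assms by (simp add: P)
  have "{(U, conn n P U h) | U h. U \<in> F \<and> (VR_trace P U, h) \<in> z} =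
      {(U, conn n P U h) | U W h. U \<in> F \<and> (W, h) \<in> z \<and> W = VR_trace P U}" for z
    by blast
  moreover have "VR_cohomology_connecting G n P z =
      VR_germ_rel G (n + 1) P `` {(U, conn n P U h) | U h. U \<in> F \<and> (VR_trace P U, h) \<in> z}" for z
    by (simp add: P)
  ultimately show ?thesis
    by (simp add: fun_eq_iff limit_map_def VR_germ_rel_eq i)
qed

lemma limit_morphism_connecting:
  assumes sP: "semi_uniform_pair P"
  shows "limit_morphism (VR_index (subspace P)) (\<supseteq>) (coh n (subspace P)) (\<lambda>U U'. cohm n (subspace P) U' id)
    (VR_index P) (\<supseteq>) (coh (n + 1) P) (\<lambda>U U'. cohm (n + 1) P U' id) (\<lambda>U W. W = VR_trace P U) (conn n P)"
proof (intro limit_morphism.intro limit_morphism_axioms.intro directed_system_VR filtered_pairs[OF sP])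
  note P = filtered_pairs(1)[OF sP] and S = filtered_pairs(3)[OF sP]
  show "\<exists>U\<in>VR_index P. W = VR_trace P U" if "W \<in> VR_index (subspace P)" for W
    using that by (auto simp: VR_index_subspace[OF sP])
  show "conn n P U \<in> hom (coh n (subspace P) W) (coh (n + 1) P U)" if "W = VR_trace P U" for U W
    unfolding that using conn_hom[OF P] .
  fix U U' W W'
  assume U: "U \<in> VR_index P" "U' \<in> VR_index P" and W: "W' \<subseteq> W"
    and UW: "W = VR_trace P U" "W' = VR_trace P U'"
  let ?V = "U \<inter> U'"
  \<comment> \<open>The trace of the intersection is \<open>W \<inter> W'\<close>, hence the smaller
    \<open>W'\<close>. So over \<open>U \<inter> U'\<close> both connecting maps can be compared
    with the one that starts from the group at \<open>W'\<close>.\<close>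
  have tV: "VR_trace P ?V = W'"
    using W by (auto simp: VR_trace_Int UW)
  have "cohm (n + 1) P ?V id (conn n P U h) = cohm (n + 1) P ?V id (conn n P U' (cohm n (subspace P) W' id h))"
    if h: "h \<in> carrier (coh n (subspace P) W)" for h
  proof -
    let ?h = "cohm n (subspace P) W' id h"
    have h': "?h \<in> carrier (coh n (subspace P) W')"
      using cohm_closed[OF S S filtered_map_id _ h] W by simp
    have "cohm (n + 1) P ?V id (conn n P U h) = conn n P ?V ?h"
      using conn_natural[OF P P filtered_map_id, of ?V U h n] h tV by (simp add: UW(1))
    moreover have "cohm (n + 1) P ?V id (conn n P U' ?h) = conn n P ?V (cohm n (subspace P) W' id ?h)"
      using conn_natural[OF P P filtered_map_id, of ?V U' ?h n] h' tV by (simp add: UW(2))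
    moreover have "cohm n (subspace P) W' id ?h = ?h"
      by (rule cohm_id[OF S h'])
    ultimately show ?thesis by simp
  qed
  then show "\<exists>k\<in>VR_index P. k \<subseteq> U \<and> k \<subseteq> U' \<and> (\<forall>h\<in>carrier (coh n (subspace P) W).
      cohm (n + 1) P k id (conn n P U h) = cohm (n + 1) P k id (conn n P U' (cohm n (subspace P) W' id h)))"
    using filtered_pair_Int[OF P U] by (intro bexI[of _ ?V]) auto
qed

lemma VR_cohomology_connecting_hom:
  assumes "semi_uniform_pair P"
  shows "VR_cohomology_connecting G n P \<in> hom (VR_cohomology G n (subspace P)) (VR_cohomology G (n + 1) P)"
  unfolding VR_cohomology_connecting_eq[OF assms] VR_cohomology_eq
  by (rule limit_morphism.limit_map_hom[OF limit_morphism_connecting[OF assms]])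

lemma VR_cohomology_connecting_germ:
  assumes "semi_uniform_pair P" "U \<in> VR_index P" "h \<in> carrier (coh n (subspace P) (VR_trace P U))"
  shows "VR_cohomology_connecting G n P (VR_germ n (subspace P) (VR_trace P U) h) =
    VR_germ (n + 1) P U (conn n P U h)"
proof -
  have "VR_trace P U \<in> VR_index (subspace P)"
    using assms by (simp add: VR_index_subspace)
  then show ?thesis
    using limit_morphism.limit_map_germ[OF limit_morphism_connecting[OF assms(1)] assms(2) _ refl assms(3)]
    unfolding VR_germ_eq[OF filtered_pairs(1)[OF assms(1)]] VR_germ_eq[OF filtered_pairs(3)[OF assms(1)]]
      VR_cohomology_connecting_eq[OF assms(1)] by simp
qed

text \<open>Indices of the subspace are traces, so a representative can be chosen where the
  connecting map of the pair at some \<open>U\<close> is defined.\<close>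

lemma VR_cohomology_subspaceE:
  assumes "semi_uniform_pair P" "z \<in> carrier (VR_cohomology G n (subspace P))"
  obtains U h where "U \<in> VR_index P" "h \<in> carrier (coh n (subspace P) (VR_trace P U))"
    "z = VR_germ n (subspace P) (VR_trace P U) h"
proof -
  obtain W h where W: "W \<in> VR_index (subspace P)" "h \<in> carrier (coh n (subspace P) W)"
    "z = VR_germ n (subspace P) W h"
    using VR_cohomologyE[OF filtered_pairs(3)[OF assms(1)] assms(2)] .
  obtain U where "U \<in> VR_index P" "W = VR_trace P U"
    using W(1) unfolding VR_index_subspace[OF assms(1)] by blast
  with W show thesis
    by (intro that[of U h]) simp_all
qed

lemma VR_cohomology_connecting_natural:
  assumes P: "semi_uniform_pair P" and Q: "semi_uniform_pair Q" and f: "unif_cont_pair P Q f"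
    and z: "z \<in> carrier (VR_cohomology G n (subspace Q))"
  shows "VR_cohomology_connecting G n P (VR_cohomology_map G n (subspace P) (subspace Q) f z) =
    VR_cohomology_map G (n + 1) P Q f (VR_cohomology_connecting G n Q z)"
proof -
  note p = filtered_pairs[OF P] and q = filtered_pairs[OF Q] and ff = filtered_maps[OF P Q f]
  obtain V h where V: "V \<in> VR_index Q" "h \<in> carrier (coh n (subspace Q) (VR_trace Q V))"
    "z = VR_germ n (subspace Q) (VR_trace Q V) h"
    using VR_cohomology_subspaceE[OF Q z] .
  obtain U where U: "U \<in> VR_index P" "rel_maps f U V"
    using ff(1) V(1) by (auto simp: filtered_map_def)
  have t: "VR_trace P U \<in> VR_index (subspace P)" "VR_trace Q V \<in> VR_index (subspace Q)"
    "rel_maps f (VR_trace P U) (VR_trace Q V)"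
    using U V P Q rel_maps_VR_trace[OF ff(1)] by (auto simp: VR_index_subspace)
  have "VR_cohomology_connecting G n P (VR_cohomology_map G n (subspace P) (subspace Q) f z) =
      VR_germ (n + 1) P U (conn n P U (cohm n (subspace P) (VR_trace P U) f h))"
    unfolding V(3) VR_cohomology_map_germ[OF p(3) q(3) ff(3) t V(2)]
    by (rule VR_cohomology_connecting_germ[OF P U(1) cohm_closed[OF p(3) q(3) ff(3) t(3) V(2)]])
  also have "\<dots> = VR_germ (n + 1) P U (cohm (n + 1) P U f (conn n Q V h))"
    using conn_natural[OF p(1) q(1) ff(1) U(2) V(2)] by simp
  also have "\<dots> = VR_cohomology_map G (n + 1) P Q f (VR_cohomology_connecting G n Q z)"
    unfolding V(3) VR_cohomology_connecting_germ[OF Q V(1,2)]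
    by (rule VR_cohomology_map_germ[OF p(1) q(1) ff(1) U(1) V(1) U(2) conn_closed[OF q(1) V(2)], symmetric])
  finally show ?thesis .
qed

section \<open>Exactness of the cohomology sequence in the limit\<close>

lemma VR_cohomology_exact_total:
  assumes sP: "semi_uniform_pair P"
  shows "kernel (VR_cohomology G n (total_space P)) (VR_cohomology G n (subspace P))
      (VR_cohomology_map G n (subspace P) (total_space P) id) =
    VR_cohomology_map G n (total_space P) P id ` carrier (VR_cohomology G n P)"
proof -
  note p = filtered_pairs[OF sP] and i = filtered_map_total[of P] and j = filtered_map_subspace[OF sP]
  have iv: "VR_cohomology_map G n (total_space P) P id (VR_germ n P U h) =
      VR_germ n (total_space P) U (cohm n (total_space P) U id h)"
    if "U \<in> VR_index P" "h \<in> carrier (coh n P U)" for U h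
    using that by (intro VR_cohomology_map_germ p i) auto
  have jv: "VR_cohomology_map G n (subspace P) (total_space P) id (VR_germ n (total_space P) U h) =
      VR_germ n (subspace P) (VR_trace P U) (cohm n (subspace P) (VR_trace P U) id h)"
    if "U \<in> VR_index P" "h \<in> carrier (coh n (total_space P) U)" for U h
    using that VR_trace_subset[of P U] by (intro VR_cohomology_map_germ p j) (auto simp: VR_index_subspace[OF sP])
  have cl: "cohm n (total_space P) U id h \<in> carrier (coh n (total_space P) U)"
    if "h \<in> carrier (coh n P U)" for U h
    using that by (intro cohm_closed[OF _ p(1) i]) (auto simp: p)
  show ?thesis
  proof (intro equalityI subsetI)
    fix z assume "z \<in> VR_cohomology_map G n (total_space P) P id ` carrier (VR_cohomology G n P)"
    then obtain U h where U: "U \<in> VR_index P" "h \<in> carrier (coh n P U)"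
      and z: "z = VR_cohomology_map G n (total_space P) P id (VR_germ n P U h)"
      using VR_cohomologyE[OF p(1)] by blast
    have "cohm n (subspace P) (VR_trace P U) id (cohm n (total_space P) U id h) =
        \<one>\<^bsub>coh n (subspace P) (VR_trace P U)\<^esub>"
      using cohomology_rel_total_sub[OF simp_pair_VR[OF p(1)] U(2)] by simp
    then have "VR_cohomology_map G n (subspace P) (total_space P) id z = \<one>\<^bsub>VR_cohomology G n (subspace P)\<^esub>"
      using U VR_germ_one[OF p(3), of "VR_trace P U" n]
      unfolding z iv[OF U] jv[OF U(1) cl[OF U(2)]] by (simp add: VR_index_subspace[OF sP])
    moreover have "z \<in> carrier (VR_cohomology G n (total_space P))"
      unfolding z iv[OF U] using U cl by (intro VR_germ_carrier p) auto
    ultimately show "z \<in> kernel (VR_cohomology G n (total_space P)) (VR_cohomology G n (subspace P))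
        (VR_cohomology_map G n (subspace P) (total_space P) id)"
      by (simp add: kernel_def)
  next
    fix z assume z: "z \<in> kernel (VR_cohomology G n (total_space P)) (VR_cohomology G n (subspace P))
        (VR_cohomology_map G n (subspace P) (total_space P) id)"
    then have zc: "z \<in> carrier (VR_cohomology G n (total_space P))"
      by (simp add: kernel_def)
    obtain U h where U: "U \<in> VR_index P" "h \<in> carrier (coh n (total_space P) U)"
      and zU: "z = VR_germ n (total_space P) U h"
      using VR_cohomologyE[OF p(2) zc] by (metis VR_index_total)
    have tU: "VR_trace P U \<in> VR_index (subspace P)"
      using U by (simp add: VR_index_subspace[OF sP])
    have hc: "cohm n (subspace P) (VR_trace P U) id h \<in> carrier (coh n (subspace P) (VR_trace P U))"
      using U VR_trace_subset[of P U] by (intro cohm_closed[OF p(3,2) j]) auto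
    have "VR_germ n (subspace P) (VR_trace P U) (cohm n (subspace P) (VR_trace P U) id h) =
        \<one>\<^bsub>VR_cohomology G n (subspace P)\<^esub>"
      using z jv[OF U] by (simp add: kernel_def zU)
    then obtain W where W: "W \<in> VR_index (subspace P)" "W \<subseteq> VR_trace P U"
        "cohm n (subspace P) W id (cohm n (subspace P) (VR_trace P U) id h) = \<one>\<^bsub>coh n (subspace P) W\<^esub>"
      using VR_germ_one_iff[OF p(3) tU hc] by blast
    \<comment> \<open>Vanishing is only known at an index \<open>W\<close> of the subspace. It is
      the trace of some \<open>U'\<close>, which need not be contained in \<open>U\<close>.\<close>
    obtain U' where U': "U' \<in> VR_index P" "W = VR_trace P U'"
      using W(1) by (auto simp: VR_index_subspace[OF sP])
    let ?V = "U \<inter> U'"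
    \<comment> \<open>Intersecting with \<open>U\<close> keeps the trace \<open>W\<close>, so at
      this stage the restriction to the subspace is trivial and simplicial exactness
      applies.\<close>
    have V: "?V \<in> VR_index P" "VR_trace P ?V = W"
      using filtered_pair_Int[OF p(1) U(1) U'(1)] W(2) by (auto simp: VR_trace_Int U'(2))
    have WV: "W \<subseteq> ?V"
      using VR_trace_subset[of P ?V] V(2) by simp
    let ?h = "cohm n (total_space P) ?V id h"
    have h: "?h \<in> carrier (coh n (total_space P) ?V)"
      using U by (intro cohm_closed[OF p(2,2) filtered_map_id]) auto
    \<comment> \<open>All routes from the total space at \<open>U\<close> to the subspace at
      \<open>W\<close> are induced by the identity on vertices and therefore agree.\<close>
    have "cohm n (subspace P) W id ?h = cohm n (subspace P) W id h"
      using cohm_comp[OF p(3,2,2) j filtered_map_id, of W ?V U h n] U WV by simp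
    also have "\<dots> = \<one>\<^bsub>coh n (subspace P) W\<^esub>"
      using cohm_comp[OF p(3,3,2) filtered_map_id j, of W "VR_trace P U" U h n] U W VR_trace_subset[of P U] by simp
    finally have "cohm n (subspace P) (VR_trace P ?V) id ?h = \<one>\<^bsub>coh n (subspace P) (VR_trace P ?V)\<^esub>"
      by (simp add: V(2))
    then obtain k where k: "k \<in> carrier (coh n P ?V)" "?h = cohm n (total_space P) ?V id k"
      using cohomology_exact_total[OF simp_pair_VR[OF p(1)], of ?h n ?V] h by auto
    have "z = VR_germ n (total_space P) ?V ?h"
      unfolding zU using U V by (intro VR_germ_restrict[symmetric] p) auto
    also have "\<dots> = VR_cohomology_map G n (total_space P) P id (VR_germ n P ?V k)"
      using iv[OF V(1) k(1)] k(2) by simp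
    finally show "z \<in> VR_cohomology_map G n (total_space P) P id ` carrier (VR_cohomology G n P)"
      using VR_germ_carrier[OF p(1) V(1) k(1)] by blast
  qed
qed

lemma VR_cohomology_exact_subspace:
  assumes sP: "semi_uniform_pair P"
  shows "kernel (VR_cohomology G n (subspace P)) (VR_cohomology G (n + 1) P) (VR_cohomology_connecting G n P) =
    VR_cohomology_map G n (subspace P) (total_space P) id ` carrier (VR_cohomology G n (total_space P))"
proof -
  note p = filtered_pairs[OF sP] and j = filtered_map_subspace[OF sP]
  have jv: "VR_cohomology_map G n (subspace P) (total_space P) id (VR_germ n (total_space P) U h) =
      VR_germ n (subspace P) (VR_trace P U) (cohm n (subspace P) (VR_trace P U) id h)"
    if "U \<in> VR_index P" "h \<in> carrier (coh n (total_space P) U)" for U h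
    using that VR_trace_subset[of P U] by (intro VR_cohomology_map_germ p j) (auto simp: VR_index_subspace[OF sP])
  have cl: "cohm n (subspace P) (VR_trace P U) id h \<in> carrier (coh n (subspace P) (VR_trace P U))"
    if "h \<in> carrier (coh n (total_space P) U)" for U h
    using that VR_trace_subset[of P U] by (intro cohm_closed[OF p(3,2) j]) auto
  show ?thesis
  proof (intro equalityI subsetI)
    fix z assume "z \<in> VR_cohomology_map G n (subspace P) (total_space P) id ` carrier (VR_cohomology G n (total_space P))"
    then obtain U h where U: "U \<in> VR_index P" "h \<in> carrier (coh n (total_space P) U)"
      and z: "z = VR_cohomology_map G n (subspace P) (total_space P) id (VR_germ n (total_space P) U h)"
      by (auto elim!: VR_cohomologyE[OF p(2)])
    have "conn n P U (cohm n (subspace P) (VR_trace P U) id h) = \<one>\<^bsub>coh (n + 1) P U\<^esub>"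
      using cohomology_total_sub_connecting[OF simp_pair_VR[OF p(1)], of h n U] U(2) by simp
    then have "VR_cohomology_connecting G n P z = \<one>\<^bsub>VR_cohomology G (n + 1) P\<^esub>"
      unfolding z jv[OF U] VR_cohomology_connecting_germ[OF sP U(1) cl[OF U(2)]]
      using VR_germ_one[OF p(1) U(1)] by simp
    moreover have "z \<in> carrier (VR_cohomology G n (subspace P))"
      unfolding z jv[OF U] using U cl by (intro VR_germ_carrier p) (auto simp: VR_index_subspace[OF sP])
    ultimately show "z \<in> kernel (VR_cohomology G n (subspace P)) (VR_cohomology G (n + 1) P) (VR_cohomology_connecting G n P)"
      by (simp add: kernel_def)
  next
    fix z assume z: "z \<in> kernel (VR_cohomology G n (subspace P)) (VR_cohomology G (n + 1) P) (VR_cohomology_connecting G n P)"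
    then have zc: "z \<in> carrier (VR_cohomology G n (subspace P))"
      by (simp add: kernel_def)
    obtain U h where U: "U \<in> VR_index P" "h \<in> carrier (coh n (subspace P) (VR_trace P U))"
      and zU: "z = VR_germ n (subspace P) (VR_trace P U) h"
      using VR_cohomology_subspaceE[OF sP zc] .
    have "VR_germ (n + 1) P U (conn n P U h) = \<one>\<^bsub>VR_cohomology G (n + 1) P\<^esub>"
      using z VR_cohomology_connecting_germ[OF sP U] by (simp add: kernel_def zU)
    then obtain V where V: "V \<in> VR_index P" "V \<subseteq> U" "cohm (n + 1) P V id (conn n P U h) = \<one>\<^bsub>coh (n + 1) P V\<^esub>"
      using VR_germ_one_iff[OF p(1) U(1) conn_closed[OF p(1) U(2)]] by blast
    have t: "VR_trace P V \<subseteq> VR_trace P U" "VR_trace P V \<in> VR_index (subspace P)" "VR_trace P U \<in> VR_index (subspace P)"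
      using V U rel_maps_VR_trace[OF filtered_map_id, of V U P] by (auto simp: VR_index_subspace[OF sP])
    let ?h = "cohm n (subspace P) (VR_trace P V) id h"
    have h: "?h \<in> carrier (coh n (subspace P) (VR_trace P V))"
      using U t by (intro cohm_closed[OF p(3,3) filtered_map_id]) auto
    \<comment> \<open>Naturality for \<open>V \<subseteq> U\<close> turns the vanishing of the
      restricted connecting class into the vanishing of the connecting class of the restricted
      element.\<close>
    have "conn n P V ?h = \<one>\<^bsub>coh (n + 1) P V\<^esub>"
      using conn_natural[OF p(1,1) filtered_map_id _ U(2), of V] V by simp
    then obtain k where k: "k \<in> carrier (coh n (total_space P) V)" "?h = cohm n (subspace P) (VR_trace P V) id k"
      using cohomology_exact_sub[OF simp_pair_VR[OF p(1)], of ?h n V] h by auto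
    have "z = VR_germ n (subspace P) (VR_trace P V) ?h"
      unfolding zU using U t by (intro VR_germ_restrict[symmetric] p) auto
    also have "\<dots> = VR_cohomology_map G n (subspace P) (total_space P) id (VR_germ n (total_space P) V k)"
      using jv[OF V(1) k(1)] k(2) by simp
    finally show "z \<in> VR_cohomology_map G n (subspace P) (total_space P) id ` carrier (VR_cohomology G n (total_space P))"
      using VR_germ_carrier[OF p(2) _ k(1)] V(1) by auto
  qed
qed

lemma VR_cohomology_exact_rel:
  assumes sP: "semi_uniform_pair P"
  shows "kernel (VR_cohomology G (n + 1) P) (VR_cohomology G (n + 1) (total_space P))
      (VR_cohomology_map G (n + 1) (total_space P) P id) =
    VR_cohomology_connecting G n P ` carrier (VR_cohomology G n (subspace P))"
proof -
  note p = filtered_pairs[OF sP] and i = filtered_map_total[of P]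
  have iv: "VR_cohomology_map G (n + 1) (total_space P) P id (VR_germ (n + 1) P U h) =
      VR_germ (n + 1) (total_space P) U (cohm (n + 1) (total_space P) U id h)"
    if "U \<in> VR_index P" "h \<in> carrier (coh (n + 1) P U)" for U h
    using that by (intro VR_cohomology_map_germ p i) auto
  show ?thesis
  proof (intro equalityI subsetI)
    fix z assume "z \<in> VR_cohomology_connecting G n P ` carrier (VR_cohomology G n (subspace P))"
    then obtain y where y: "y \<in> carrier (VR_cohomology G n (subspace P))" "z = VR_cohomology_connecting G n P y"
      by blast
    obtain U h where U: "U \<in> VR_index P" "h \<in> carrier (coh n (subspace P) (VR_trace P U))"
      and "y = VR_germ n (subspace P) (VR_trace P U) h"
      using VR_cohomology_subspaceE[OF sP y(1)] .
    with y have z: "z = VR_cohomology_connecting G n P (VR_germ n (subspace P) (VR_trace P U) h)"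
      by simp
    have "cohm (n + 1) (total_space P) U id (conn n P U h) = \<one>\<^bsub>coh (n + 1) (total_space P) U\<^esub>"
      using cohomology_connecting_total[OF simp_pair_VR[OF p(1)], of h n U] U(2) by simp
    then have "VR_cohomology_map G (n + 1) (total_space P) P id z = \<one>\<^bsub>VR_cohomology G (n + 1) (total_space P)\<^esub>"
      unfolding z VR_cohomology_connecting_germ[OF sP U] iv[OF U(1) conn_closed[OF p(1) U(2)]]
      using VR_germ_one[OF p(2), of U "n + 1"] U(1) by simp
    moreover have "z \<in> carrier (VR_cohomology G (n + 1) P)"
      unfolding z VR_cohomology_connecting_germ[OF sP U] by (rule VR_germ_carrier[OF p(1) U(1) conn_closed[OF p(1) U(2)]])
    ultimately show "z \<in> kernel (VR_cohomology G (n + 1) P) (VR_cohomology G (n + 1) (total_space P))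
        (VR_cohomology_map G (n + 1) (total_space P) P id)"
      by (simp add: kernel_def)
  next
    fix z assume z: "z \<in> kernel (VR_cohomology G (n + 1) P) (VR_cohomology G (n + 1) (total_space P))
        (VR_cohomology_map G (n + 1) (total_space P) P id)"
    then have zc: "z \<in> carrier (VR_cohomology G (n + 1) P)"
      by (simp add: kernel_def)
    obtain U h where U: "U \<in> VR_index P" "h \<in> carrier (coh (n + 1) P U)" and zU: "z = VR_germ (n + 1) P U h"
      using VR_cohomologyE[OF p(1) zc] .
    have hc: "cohm (n + 1) (total_space P) U id h \<in> carrier (coh (n + 1) (total_space P) U)"
      using U by (intro cohm_closed[OF p(2,1) i]) auto
    have U': "U \<in> VR_index (total_space P)"
      using U by simp
    have "VR_germ (n + 1) (total_space P) U (cohm (n + 1) (total_space P) U id h) =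
        \<one>\<^bsub>VR_cohomology G (n + 1) (total_space P)\<^esub>"
      using z iv[OF U] by (simp add: kernel_def zU)
    then obtain V where V: "V \<in> VR_index P" "V \<subseteq> U"
      "cohm (n + 1) (total_space P) V id (cohm (n + 1) (total_space P) U id h) = \<one>\<^bsub>coh (n + 1) (total_space P) V\<^esub>"
      unfolding VR_germ_one_iff[OF p(2) U' hc] VR_index_total by blast
    let ?h = "cohm (n + 1) P V id h"
    have h: "?h \<in> carrier (coh (n + 1) P V)"
      using U V by (intro cohm_closed[OF p(1,1) filtered_map_id]) auto
    \<comment> \<open>The pair and its total space share their indices. Restricting to
      \<open>V\<close> commutes with passing from relative to absolute classes, so exactness at
      \<open>V\<close> applies to the restricted class.\<close>
    have "cohm (n + 1) (total_space P) V id ?h = cohm (n + 1) (total_space P) V id h"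
      using cohm_comp[OF p(2,1,1) i filtered_map_id, of V V U h "n + 1"] U V by simp
    also have "\<dots> = \<one>\<^bsub>coh (n + 1) (total_space P) V\<^esub>"
      using cohm_comp[OF p(2,2,1) filtered_map_id i, of V U U h "n + 1"] U V by simp
    finally have one: "cohomology_map G (n + 1) (VR_big P V) {} id ?h = \<one>\<^bsub>cohomology_group G (n + 1) (VR_big P V) {}\<^esub>"
      by simp
    obtain k where "k \<in> carrier (cohomology_group G n (VR_small P V) {})" "?h = conn n P V k"
      by (rule cohomology_exact_rel[OF simp_pair_VR[OF p(1)] h one])
    then have k: "k \<in> carrier (coh n (subspace P) (VR_trace P V))" "?h = conn n P V k"
      by simp_all
    have "z = VR_germ (n + 1) P V ?h"
      unfolding zU using U V by (intro VR_germ_restrict[symmetric] p) auto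
    also have "\<dots> = VR_cohomology_connecting G n P (VR_germ n (subspace P) (VR_trace P V) k)"
      using VR_cohomology_connecting_germ[OF sP V(1) k(1)] k(2) by simp
    finally show "z \<in> VR_cohomology_connecting G n P ` carrier (VR_cohomology G n (subspace P))"
      using VR_germ_carrier[OF p(3) _ k(1)] V(1) by (auto simp: VR_index_subspace[OF sP])
  qed
qed

end

section \<open>Vietoris-Rips homology\<close>

context comm_group
begin

abbreviation homol where "homol n P U \<equiv> homology_group G n (VR_big P U) (VR_small P U)"

abbreviation homm where "homm n P U \<equiv> homology_map G n (VR_big P U) (VR_small P U)"

lemma homm_hom:
  assumes "filtered_pair P" "filtered_pair Q" "filtered_map P Q f" "rel_maps f U V"
  shows "homm n Q V f \<in> hom (homol n P U) (homol n Q V)"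
  using assms by (intro homology_map_hom simp_pair_VR simp_map_VR)

lemma homm_comp:
  assumes "filtered_pair P" "filtered_pair Q" "filtered_pair R" "filtered_map P Q f" "filtered_map Q R g"
    and "rel_maps f U V" "rel_maps g V W" "h \<in> carrier (homol n P U)"
  shows "homm n R W g (homm n Q V f h) = homm n R W (g \<circ> f) h"
  using assms
  by (intro homology_map_comp[symmetric, of "VR_big P U" "VR_small P U" "VR_big Q V" "VR_small Q V"]
      simp_pair_VR simp_map_VR)

lemma VR_homology_eq:
  "VR_homology G n P = inverse_limit (VR_index P) (\<subseteq>) (homol n P) (\<lambda>U U'. homm n P U' id)"
  by (cases P) simp

lemma group_VR_homology:
  assumes "filtered_pair P"
  shows "group (VR_homology G n P)"
  unfolding VR_homology_eq
proof (rule group_inverse_limit)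
  show "group (homol n P U)" for U
    using assms by (intro group_homology simp_pair_VR)
  show "homm n P V id \<in> hom (homol n P U) (homol n P V)" if "U \<subseteq> V" for U V
    using assms that by (intro homm_hom filtered_map_id) auto
qed

lemma VR_homologyD:
  assumes "z \<in> carrier (VR_homology G n P)"
  shows "\<And>U. U \<in> VR_index P \<Longrightarrow> z U \<in> carrier (homol n P U)"
    "\<And>U V. U \<in> VR_index P \<Longrightarrow> V \<in> VR_index P \<Longrightarrow> U \<subseteq> V \<Longrightarrow> homm n P V id (z U) = z V"
    "z \<in> extensional (VR_index P)"
  using assms by (auto simp: VR_homology_eq inverse_limit_simps PiE_iff)

lemma VR_homology_eqI:
  assumes "z \<in> extensional (VR_index P)" "w \<in> extensional (VR_index P)"
    and "\<And>U. U \<in> VR_index P \<Longrightarrow> z U = w U"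
  shows "z = w"
  using assms by (rule extensionalityI)

lemma VR_homology_map_eq:
  "VR_homology_map G n P Q f = (\<lambda>z. \<lambda>V\<in>VR_index Q. homm n Q V f (z (SOME U. U \<in> VR_index P \<and> rel_maps f U V)))"
  by (cases P; cases Q) (simp add: fun_eq_iff)

text \<open>Both values are images of the component at \<open>U \<inter> U'\<close>. This makes the
  choice operator in \<open>VR_homology_map\<close> harmless.\<close>

lemma homm_index_irrelevant:
  assumes P: "filtered_pair P" and Q: "filtered_pair Q" and f: "filtered_map P Q f"
    and z: "z \<in> carrier (VR_homology G n P)"
    and U: "U \<in> VR_index P" "rel_maps f U V" "U' \<in> VR_index P" "rel_maps f U' V"
  shows "homm n Q V f (z U) = homm n Q V f (z U')"
proof -
  let ?W = "U \<inter> U'"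
  have W: "?W \<in> VR_index P"
    using filtered_pair_Int[OF P U(1,3)] .
  note zW = VR_homologyD(1)[OF z W]
  have "homm n Q V f (z U) = homm n Q V f (homm n P U id (z ?W))"
    using VR_homologyD(2)[OF z W U(1)] by simp
  also have "\<dots> = homm n Q V f (z ?W)"
    using homm_comp[OF P P Q filtered_map_id f _ U(2) zW] by simp
  also have "\<dots> = homm n Q V f (homm n P U' id (z ?W))"
    using homm_comp[OF P P Q filtered_map_id f _ U(4) zW] by simp
  also have "\<dots> = homm n Q V f (z U')"
    using VR_homologyD(2)[OF z W U(3)] by simp
  finally show ?thesis .
qed

lemma some_index:
  assumes "filtered_map P Q f" "V \<in> VR_index Q"
  shows "(SOME U. U \<in> VR_index P \<and> rel_maps f U V) \<in> VR_index P"
    "rel_maps f (SOME U. U \<in> VR_index P \<and> rel_maps f U V) V"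
proof -
  have "\<exists>U. U \<in> VR_index P \<and> rel_maps f U V"
    using assms by (auto simp: filtered_map_def)
  from someI_ex[OF this] show "(SOME U. U \<in> VR_index P \<and> rel_maps f U V) \<in> VR_index P"
    "rel_maps f (SOME U. U \<in> VR_index P \<and> rel_maps f U V) V"
    by auto
qed

lemma VR_homology_map_at:
  assumes "filtered_pair P" "filtered_pair Q" "filtered_map P Q f" "z \<in> carrier (VR_homology G n P)"
    and "U \<in> VR_index P" "V \<in> VR_index Q" "rel_maps f U V"
  shows "VR_homology_map G n P Q f z V = homm n Q V f (z U)"
  using homm_index_irrelevant[OF assms(1-4) some_index[OF assms(3,6)] assms(5,7)] assms(6)
  by (simp add: VR_homology_map_eq)

lemma VR_homology_map_extensional: "VR_homology_map G n P Q f z \<in> extensional (VR_index Q)"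
  by (simp add: VR_homology_map_eq)

lemma VR_homology_map_hom:
  assumes P: "filtered_pair P" and Q: "filtered_pair Q" and f: "filtered_map P Q f"
  shows "VR_homology_map G n P Q f \<in> hom (VR_homology G n P) (VR_homology G n Q)"
  unfolding VR_homology_map_eq unfolding VR_homology_eq
proof (rule inverse_limit_map_hom[where \<sigma> = "\<lambda>V. SOME U. U \<in> VR_index P \<and> rel_maps f U V"])
  fix V assume V: "V \<in> VR_index Q"
  note s = some_index[OF f V]
  show "(SOME U. U \<in> VR_index P \<and> rel_maps f U V) \<in> VR_index P"
    by (rule s(1))
  show "homm n Q V f \<in> hom (homol n P (SOME U. U \<in> VR_index P \<and> rel_maps f U V)) (homol n Q V)"
    by (rule homm_hom[OF P Q f s(2)])
  fix z V'
  assume z: "z \<in> carrier (inverse_limit (VR_index P) (\<subseteq>) (homol n P) (\<lambda>U U'. homm n P U' id))"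
    and V': "V' \<in> VR_index Q" "V \<subseteq> V'"
  then have z': "z \<in> carrier (VR_homology G n P)"
    by (simp add: VR_homology_eq)
  let ?U = "SOME U. U \<in> VR_index P \<and> rel_maps f U V"
  have "homm n Q V' id (homm n Q V f (z ?U)) = homm n Q V' f (z ?U)"
    using homm_comp[OF P Q Q f filtered_map_id s(2) _ VR_homologyD(1)[OF z' s(1)]] V' by simp
  \<comment> \<open>The indices chosen for \<open>V\<close> and for \<open>V'\<close> need not be
    comparable, but both are admissible for the larger \<open>V'\<close>.\<close>
  also have "\<dots> = homm n Q V' f (z (SOME U. U \<in> VR_index P \<and> rel_maps f U V'))"
    by (rule homm_index_irrelevant[OF P Q f z' s(1) rel_maps_mono[OF s(2) subset_refl V'(2)] some_index[OF f V'(1)]])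
  finally show "homm n Q V' id (homm n Q V f (z ?U)) =
      homm n Q V' f (z (SOME U. U \<in> VR_index P \<and> rel_maps f U V'))" .
qed

lemma VR_homology_map_id:
  assumes P: "filtered_pair P" and z: "z \<in> carrier (VR_homology G n P)"
  shows "VR_homology_map G n P P id z = z"
proof (rule VR_homology_eqI[OF VR_homology_map_extensional VR_homologyD(3)[OF z]])
  fix U assume U: "U \<in> VR_index P"
  then show "VR_homology_map G n P P id z U = z U"
    using VR_homology_map_at[OF P P filtered_map_id z U U] VR_homologyD(2)[OF z U U] by simp
qed

lemma VR_homology_map_comp:
  assumes PQR: "filtered_pair P" "filtered_pair Q" "filtered_pair R"
    and fg: "filtered_map P Q f" "filtered_map Q R g" and z: "z \<in> carrier (VR_homology G n P)"
  shows "VR_homology_map G n P R (g \<circ> f) z = VR_homology_map G n Q R g (VR_homology_map G n P Q f z)"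
proof (rule VR_homology_eqI[OF VR_homology_map_extensional VR_homology_map_extensional])
  fix W assume W: "W \<in> VR_index R"
  obtain V where V: "V \<in> VR_index Q" "rel_maps g V W"
    using fg(2) W by (auto simp: filtered_map_def)
  obtain U where U: "U \<in> VR_index P" "rel_maps f U V"
    using fg(1) V(1) by (auto simp: filtered_map_def)
  have fz: "VR_homology_map G n P Q f z \<in> carrier (VR_homology G n Q)"
    by (rule hom_in_carrier[OF VR_homology_map_hom[OF PQR(1,2) fg(1)] z])
  have "VR_homology_map G n Q R g (VR_homology_map G n P Q f z) W = homm n R W g (homm n Q V f (z U))"
    using VR_homology_map_at[OF PQR(2,3) fg(2) fz V(1) W V(2)]
      VR_homology_map_at[OF PQR(1,2) fg(1) z U(1) V(1) U(2)] by simp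
  also have "\<dots> = homm n R W (g \<circ> f) (z U)"
    by (rule homm_comp[OF PQR fg U(2) V(2) VR_homologyD(1)[OF z U(1)]])
  also have "\<dots> = VR_homology_map G n P R (g \<circ> f) z W"
    by (rule VR_homology_map_at[OF PQR(1,3) filtered_map_comp[OF fg] z U(1) W rel_maps_comp[OF U(2) V(2)], symmetric])
  finally show "VR_homology_map G n P R (g \<circ> f) z W = VR_homology_map G n Q R g (VR_homology_map G n P Q f z) W"
    by simp
qed

section \<open>The connecting homomorphism in the inverse limit\<close>

lemma VR_homology_connecting_eq:
  assumes "semi_uniform_pair P"
  shows "VR_homology_connecting G P =
    (\<lambda>z. \<lambda>W\<in>VR_index (subspace P). homology_connecting G (z (SOME U. U \<in> VR_index P \<and> VR_trace P U = W)))"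
proof -
  obtain X A F where P: "P = (X, A, F)"
    by (cases P)
  then show ?thesis
    using VR_index_semi_uniform(1)[of X A F] assms by (simp add: fun_eq_iff)
qed

lemma connecting_hom:
  "filtered_pair P \<Longrightarrow> homology_connecting G \<in> hom (homol n P U) (homol (n - 1) (subspace P) (VR_trace P U))"
  using homology_connecting_hom[OF simp_pair_VR[of P U], of n] by simp

lemma connecting_natural:
  assumes "filtered_pair P" "filtered_pair Q" "filtered_map P Q f" "rel_maps f U V"
    and "h \<in> carrier (homol n P U)"
  shows "homology_connecting G (homm n Q V f h) =
    homm (n - 1) (subspace Q) (VR_trace Q V) f (homology_connecting G h)"
  using homology_connecting_natural[OF simp_pair_VR[OF assms(1)] simp_pair_VR[OF assms(2)]
      simp_map_VR[OF assms(3,4)] assms(5)]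
  by simp

text \<open>Only the trace of \<open>U\<close> is contained in that of \<open>V\<close>, not
  \<open>U\<close> in \<open>V\<close>. The intersection lies below both and has the trace of
  \<open>U\<close>, so by naturality both sides come from the component there.\<close>

lemma connecting_index_irrelevant:
  assumes sP: "semi_uniform_pair P" and z: "z \<in> carrier (VR_homology G n P)"
    and U: "U \<in> VR_index P" "V \<in> VR_index P" "VR_trace P U \<subseteq> VR_trace P V"
  shows "homm (n - 1) (subspace P) (VR_trace P V) id (homology_connecting G (z U)) = homology_connecting G (z V)"
proof -
  note p = filtered_pairs[OF sP]
  let ?W = "U \<inter> V"
  have W: "?W \<in> VR_index P" "VR_trace P ?W = VR_trace P U"
    using filtered_pair_Int[OF p(1) U(1,2)] U(3) by (auto simp: VR_trace_Int)
  note zW = VR_homologyD(1)[OF z W(1)]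
  have cW: "homology_connecting G (z ?W) \<in> carrier (homol (n - 1) (subspace P) (VR_trace P U))"
    using hom_in_carrier[OF connecting_hom[OF p(1)] zW] unfolding W(2) .
  have "homology_connecting G (z U) = homology_connecting G (homm n P U id (z ?W))"
    using VR_homologyD(2)[OF z W(1) U(1)] by simp
  also have "\<dots> = homm (n - 1) (subspace P) (VR_trace P U) id (homology_connecting G (z ?W))"
    by (rule connecting_natural[OF p(1,1) filtered_map_id _ zW]) simp
  finally have 1: "homology_connecting G (z U) = homm (n - 1) (subspace P) (VR_trace P U) id (homology_connecting G (z ?W))" .
  have "homm (n - 1) (subspace P) (VR_trace P V) id (homology_connecting G (z U)) =
      homm (n - 1) (subspace P) (VR_trace P V) id (homology_connecting G (z ?W))"
    unfolding 1
    using homm_comp[OF p(3,3,3) filtered_map_id filtered_map_id _ _ cW, of "VR_trace P U" "VR_trace P V"] U(3)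
    by simp
  also have "\<dots> = homology_connecting G (homm n P V id (z ?W))"
    by (rule connecting_natural[OF p(1,1) filtered_map_id _ zW, symmetric]) simp
  also have "\<dots> = homology_connecting G (z V)"
    using VR_homologyD(2)[OF z W(1) U(2)] by simp
  finally show ?thesis .
qed

lemma some_trace_index:
  assumes "semi_uniform_pair P" "W \<in> VR_index (subspace P)"
  shows "(SOME U. U \<in> VR_index P \<and> VR_trace P U = W) \<in> VR_index P"
    "VR_trace P (SOME U. U \<in> VR_index P \<and> VR_trace P U = W) = W"
proof -
  have "\<exists>U. U \<in> VR_index P \<and> VR_trace P U = W"
    using assms(2) unfolding VR_index_subspace[OF assms(1)] by blast
  from someI_ex[OF this] show "(SOME U. U \<in> VR_index P \<and> VR_trace P U = W) \<in> VR_index P"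
    "VR_trace P (SOME U. U \<in> VR_index P \<and> VR_trace P U = W) = W"
    by auto
qed

text \<open>For relations with equal traces the transition map of the subspace is the identity, so
  the relation chosen in the definition may be replaced by \<open>U\<close>.\<close>

lemma VR_homology_connecting_at:
  assumes sP: "semi_uniform_pair P" and z: "z \<in> carrier (VR_homology G n P)" and U: "U \<in> VR_index P"
  shows "VR_homology_connecting G P z (VR_trace P U) = homology_connecting G (z U)"
proof -
  note p = filtered_pairs[OF sP]
  have t: "VR_trace P U \<in> VR_index (subspace P)"
    using U unfolding VR_index_subspace[OF sP] by blast
  let ?V = "SOME V. V \<in> VR_index P \<and> VR_trace P V = VR_trace P U"
  note s = some_trace_index[OF sP t]
  have c: "homology_connecting G (z ?V) \<in> carrier (homol (n - 1) (subspace P) (VR_trace P U))"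
    using hom_in_carrier[OF connecting_hom[OF p(1)] VR_homologyD(1)[OF z s(1)]] unfolding s(2) .
  have "homology_connecting G (z ?V) = homm (n - 1) (subspace P) (VR_trace P U) id (homology_connecting G (z ?V))"
    by (rule homology_map_id[OF simp_pair_VR[OF p(3)] c, symmetric])
  also have "\<dots> = homology_connecting G (z U)"
    by (rule connecting_index_irrelevant[OF sP z s(1) U]) (simp add: s(2))
  finally show ?thesis
    using t by (simp add: VR_homology_connecting_eq[OF sP])
qed

lemma VR_homology_connecting_extensional:
  "semi_uniform_pair P \<Longrightarrow> VR_homology_connecting G P z \<in> extensional (VR_index (subspace P))"
  by (simp add: VR_homology_connecting_eq)

lemma VR_homology_connecting_hom:
  assumes sP: "semi_uniform_pair P"
  shows "VR_homology_connecting G P \<in> hom (VR_homology G n P) (VR_homology G (n - 1) (subspace P))"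
  unfolding VR_homology_connecting_eq[OF sP] unfolding VR_homology_eq
proof (rule inverse_limit_map_hom[where \<sigma> = "\<lambda>W. SOME U. U \<in> VR_index P \<and> VR_trace P U = W"])
  note p = filtered_pairs[OF sP]
  fix W assume W: "W \<in> VR_index (subspace P)"
  note s = some_trace_index[OF sP W]
  let ?U = "SOME U. U \<in> VR_index P \<and> VR_trace P U = W"
  show "?U \<in> VR_index P"
    by (rule s(1))
  show "homology_connecting G \<in> hom (homol n P ?U) (homol (n - 1) (subspace P) W)"
    using connecting_hom[OF p(1), of n ?U] unfolding s(2) .
  fix z W'
  assume z: "z \<in> carrier (inverse_limit (VR_index P) (\<subseteq>) (homol n P) (\<lambda>U U'. homm n P U' id))"
    and W': "W' \<in> VR_index (subspace P)" "W \<subseteq> W'"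
  then have z': "z \<in> carrier (VR_homology G n P)"
    by (simp add: VR_homology_eq)
  note s' = some_trace_index[OF sP W'(1)]
  show "homm (n - 1) (subspace P) W' id (homology_connecting G (z ?U)) =
      homology_connecting G (z (SOME U. U \<in> VR_index P \<and> VR_trace P U = W'))"
    using connecting_index_irrelevant[OF sP z' s(1) s'(1)] W'(2) unfolding s(2) s'(2) by simp
qed

lemma VR_homology_connecting_natural:
  assumes P: "semi_uniform_pair P" and Q: "semi_uniform_pair Q" and f: "unif_cont_pair P Q f"
    and z: "z \<in> carrier (VR_homology G n P)"
  shows "VR_homology_connecting G Q (VR_homology_map G n P Q f z) =
    VR_homology_map G (n - 1) (subspace P) (subspace Q) f (VR_homology_connecting G P z)"
proof (rule VR_homology_eqI[OF VR_homology_connecting_extensional[OF Q] VR_homology_map_extensional])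
  note p = filtered_pairs[OF P] and q = filtered_pairs[OF Q] and ff = filtered_maps[OF P Q f]
  fix W assume W: "W \<in> VR_index (subspace Q)"
  then obtain V where V: "V \<in> VR_index Q" "W = VR_trace Q V"
    unfolding VR_index_subspace[OF Q] by blast
  obtain U where U: "U \<in> VR_index P" "rel_maps f U V"
    using ff(1) V(1) by (auto simp: filtered_map_def)
  have t: "VR_trace P U \<in> VR_index (subspace P)"
    using U unfolding VR_index_subspace[OF P] by blast
  have fz: "VR_homology_map G n P Q f z \<in> carrier (VR_homology G n Q)"
    by (rule hom_in_carrier[OF VR_homology_map_hom[OF p(1) q(1) ff(1)] z])
  have cz: "VR_homology_connecting G P z \<in> carrier (VR_homology G (n - 1) (subspace P))"
    by (rule hom_in_carrier[OF VR_homology_connecting_hom[OF P] z])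
  have "VR_homology_connecting G Q (VR_homology_map G n P Q f z) W = homology_connecting G (homm n Q V f (z U))"
    unfolding V(2) VR_homology_connecting_at[OF Q fz V(1)]
    using VR_homology_map_at[OF p(1) q(1) ff(1) z U(1) V(1) U(2)] by simp
  also have "\<dots> = homm (n - 1) (subspace Q) W f (homology_connecting G (z U))"
    unfolding V(2) by (rule connecting_natural[OF p(1) q(1) ff(1) U(2) VR_homologyD(1)[OF z U(1)]])
  also have "\<dots> = VR_homology_map G (n - 1) (subspace P) (subspace Q) f (VR_homology_connecting G P z) W"
    using VR_homology_map_at[OF p(3) q(3) ff(3) cz t W] rel_maps_VR_trace[OF ff(1) U(2)]
      VR_homology_connecting_at[OF P z U(1)] by (simp add: V(2))
  finally show "VR_homology_connecting G Q (VR_homology_map G n P Q f z) W =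
      VR_homology_map G (n - 1) (subspace P) (subspace Q) f (VR_homology_connecting G P z) W" .
qed

section \<open>Vanishing compositions in the inverse limit\<close>

lemma VR_homology_one: "\<one>\<^bsub>VR_homology G n P\<^esub> = (\<lambda>U\<in>VR_index P. \<one>\<^bsub>homol n P U\<^esub>)"
  by (simp add: VR_homology_eq inverse_limit_simps)

text \<open>Families are compared component by component; at \<open>U\<close> the claim is the one
  for the simplicial pair at \<open>U\<close>.\<close>

lemma VR_homology_sub_total_rel:
  assumes sP: "semi_uniform_pair P" and z: "z \<in> carrier (VR_homology G n (subspace P))"
  shows "VR_homology_map G n (total_space P) P id (VR_homology_map G n (subspace P) (total_space P) id z) =
    \<one>\<^bsub>VR_homology G n P\<^esub>"
proof (rule VR_homology_eqI[OF VR_homology_map_extensional])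
  note p = filtered_pairs[OF sP] and i = filtered_map_total[of P] and j = filtered_map_subspace[OF sP]
  show "\<one>\<^bsub>VR_homology G n P\<^esub> \<in> extensional (VR_index P)"
    by (simp add: VR_homology_one)
  fix U assume U: "U \<in> VR_index P"
  have t: "VR_trace P U \<in> VR_index (subspace P)" "U \<in> VR_index (total_space P)" "rel_maps id (VR_trace P U) U"
    using U VR_trace_subset[of P U] by (simp_all add: VR_index_subspace[OF sP])
  have jz: "VR_homology_map G n (subspace P) (total_space P) id z \<in> carrier (VR_homology G n (total_space P))"
    by (rule hom_in_carrier[OF VR_homology_map_hom[OF p(3,2) j] z])
  have "VR_homology_map G n (total_space P) P id (VR_homology_map G n (subspace P) (total_space P) id z) U =
      homm n P U id (homm n (total_space P) U id (z (VR_trace P U)))"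
    using VR_homology_map_at[OF p(2,1) i jz t(2) U] VR_homology_map_at[OF p(3,2) j z t] by simp
  also have "\<dots> = \<one>\<^bsub>homol n P U\<^esub>"
    using homology_sub_total_rel[OF simp_pair_VR[OF p(1)]] VR_homologyD(1)[OF z t(1)] by simp
  finally show "VR_homology_map G n (total_space P) P id (VR_homology_map G n (subspace P) (total_space P) id z) U =
      \<one>\<^bsub>VR_homology G n P\<^esub> U"
    using U by (simp add: VR_homology_one)
qed

lemma VR_homology_total_rel_connecting:
  assumes sP: "semi_uniform_pair P" and z: "z \<in> carrier (VR_homology G n (total_space P))"
  shows "VR_homology_connecting G P (VR_homology_map G n (total_space P) P id z) =
    \<one>\<^bsub>VR_homology G (n - 1) (subspace P)\<^esub>"
proof (rule VR_homology_eqI[OF VR_homology_connecting_extensional[OF sP]])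
  note p = filtered_pairs[OF sP] and i = filtered_map_total[of P]
  show "\<one>\<^bsub>VR_homology G (n - 1) (subspace P)\<^esub> \<in> extensional (VR_index (subspace P))"
    by (simp add: VR_homology_one)
  fix W assume W: "W \<in> VR_index (subspace P)"
  \<comment> \<open>Every index of the subspace is a trace, so each component is computed by the
    connecting map at some \<open>U\<close>.\<close>
  then obtain U where U: "U \<in> VR_index P" "W = VR_trace P U"
    unfolding VR_index_subspace[OF sP] by blast
  have t: "U \<in> VR_index (total_space P)"
    using U by simp
  have iz: "VR_homology_map G n (total_space P) P id z \<in> carrier (VR_homology G n P)"
    by (rule hom_in_carrier[OF VR_homology_map_hom[OF p(2,1) i] z])
  have "VR_homology_connecting G P (VR_homology_map G n (total_space P) P id z) W =
      homology_connecting G (homm n P U id (z U))"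
    unfolding U(2) VR_homology_connecting_at[OF sP iz U(1)]
    using VR_homology_map_at[OF p(2,1) i z t U(1)] by simp
  also have "\<dots> = \<one>\<^bsub>homol (n - 1) (subspace P) W\<^esub>"
    using homology_total_rel_connecting[OF simp_pair_VR[OF p(1)]] VR_homologyD(1)[OF z t] by (simp add: U(2))
  finally show "VR_homology_connecting G P (VR_homology_map G n (total_space P) P id z) W =
      \<one>\<^bsub>VR_homology G (n - 1) (subspace P)\<^esub> W"
    using W by (simp add: VR_homology_one)
qed

lemma VR_homology_connecting_sub:
  assumes sP: "semi_uniform_pair P" and z: "z \<in> carrier (VR_homology G n P)"
  shows "VR_homology_map G (n - 1) (subspace P) (total_space P) id (VR_homology_connecting G P z) =
    \<one>\<^bsub>VR_homology G (n - 1) (total_space P)\<^esub>"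
proof (rule VR_homology_eqI[OF VR_homology_map_extensional])
  note p = filtered_pairs[OF sP] and j = filtered_map_subspace[OF sP]
  show "\<one>\<^bsub>VR_homology G (n - 1) (total_space P)\<^esub> \<in> extensional (VR_index (total_space P))"
    by (simp add: VR_homology_one)
  fix U assume t0: "U \<in> VR_index (total_space P)"
  then have U: "U \<in> VR_index P"
    by simp
  have t: "VR_trace P U \<in> VR_index (subspace P)" "rel_maps id (VR_trace P U) U"
    using U VR_trace_subset[of P U] by (simp_all add: VR_index_subspace[OF sP])
  have cz: "VR_homology_connecting G P z \<in> carrier (VR_homology G (n - 1) (subspace P))"
    by (rule hom_in_carrier[OF VR_homology_connecting_hom[OF sP] z])
  have "VR_homology_map G (n - 1) (subspace P) (total_space P) id (VR_homology_connecting G P z) U =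
      homm (n - 1) (total_space P) U id (homology_connecting G (z U))"
    using VR_homology_map_at[OF p(3,2) j cz t(1) t0 t(2)] VR_homology_connecting_at[OF sP z U] by simp
  also have "\<dots> = \<one>\<^bsub>homol (n - 1) (total_space P) U\<^esub>"
    using homology_connecting_sub[OF simp_pair_VR[OF p(1)] VR_homologyD(1)[OF z U]] by simp
  finally show "VR_homology_map G (n - 1) (subspace P) (total_space P) id (VR_homology_connecting G P z) U =
      \<one>\<^bsub>VR_homology G (n - 1) (total_space P)\<^esub> U"
    using t0 by (simp add: VR_homology_one)
qed

section \<open>The sequences of a pair\<close>

text \<open>The five terms give exactness at the three inner ones. The windows for \<open>n\<close>
  and \<open>n + 1\<close> overlap in one map, so together they cover every position of the long
  sequence.\<close>

lemma VR_cohomology_exact_seq: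
  assumes P: "semi_uniform_pair P"
  shows "exact_seq
       ([VR_cohomology G (n + 1) (total_space P), VR_cohomology G (n + 1) P,
         VR_cohomology G n (subspace P), VR_cohomology G n (total_space P), VR_cohomology G n P],
        [VR_cohomology_map G (n + 1) (total_space P) P id,
         VR_cohomology_connecting G n P,
         VR_cohomology_map G n (subspace P) (total_space P) id,
         VR_cohomology_map G n (total_space P) P id])"
proof -
  note p = filtered_pairs[OF P] and i = filtered_map_total[of P] and j = filtered_map_subspace[OF P]
  show ?thesis
  proof (intro exact_seq.extension exact_seq.unity)
    show "group_hom (VR_cohomology G n P) (VR_cohomology G n (total_space P))
        (VR_cohomology_map G n (total_space P) P id)"
      by (intro group_hom.intro group_hom_axioms.intro p[THEN group_VR_cohomology] VR_cohomology_map_hom[OF p(2,1) i])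
  qed (use P p i j in \<open>simp_all add: group_VR_cohomology VR_cohomology_map_hom VR_cohomology_connecting_hom
        VR_cohomology_exact_total VR_cohomology_exact_subspace VR_cohomology_exact_rel\<close>)
qed

lemma VR_homology_order_two_seq:
  assumes P: "semi_uniform_pair P"
  shows "order_two_seq
       ([VR_homology G (n - 1) (total_space P), VR_homology G (n - 1) (subspace P),
         VR_homology G n P, VR_homology G n (total_space P), VR_homology G n (subspace P)],
        [VR_homology_map G (n - 1) (subspace P) (total_space P) id,
         VR_homology_connecting G P,
         VR_homology_map G n (total_space P) P id,
         VR_homology_map G n (subspace P) (total_space P) id])"
proof -
  note p = filtered_pairs[OF P] and i = filtered_map_total[of P] and j = filtered_map_subspace[OF P]
  note homs = VR_homology_map_hom[OF p(3,2) j] VR_homology_map_hom[OF p(2,1) i] VR_homology_connecting_hom[OF P]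
  show ?thesis
  proof (intro order_two_seq.extension order_two_seq.unity)
    show "group_hom (VR_homology G n (subspace P)) (VR_homology G n (total_space P))
        (VR_homology_map G n (subspace P) (total_space P) id)"
      by (intro group_hom.intro group_hom_axioms.intro p[THEN group_VR_homology] homs)
    show "VR_homology_map G n (subspace P) (total_space P) id ` carrier (VR_homology G n (subspace P)) \<subseteq>
        kernel (VR_homology G n (total_space P)) (VR_homology G n P) (VR_homology_map G n (total_space P) P id)"
      using hom_in_carrier[OF homs(1)] VR_homology_sub_total_rel[OF P] by (auto simp: kernel_def)
    show "VR_homology_map G n (total_space P) P id ` carrier (VR_homology G n (total_space P)) \<subseteq>
        kernel (VR_homology G n P) (VR_homology G (n - 1) (subspace P)) (VR_homology_connecting G P)"
      using hom_in_carrier[OF homs(2)] VR_homology_total_rel_connecting[OF P] by (auto simp: kernel_def)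
    show "VR_homology_connecting G P ` carrier (VR_homology G n P) \<subseteq>
        kernel (VR_homology G (n - 1) (subspace P)) (VR_homology G (n - 1) (total_space P))
          (VR_homology_map G (n - 1) (subspace P) (total_space P) id)"
      using hom_in_carrier[OF homs(3)] VR_homology_connecting_sub[OF P] by (auto simp: kernel_def)
  qed (use p homs in \<open>simp_all add: group_VR_homology\<close>)
qed

text \<open>Both composites are induced by the same map of vertices, so commutativity is
  functoriality applied twice.\<close>

lemma VR_cohomology_square:
  assumes "filtered_pair P" "filtered_pair P'" "filtered_pair Q" "filtered_pair Q'"
    and "filtered_map P' P i" "filtered_map P Q f" "filtered_map P' Q' f'" "filtered_map Q' Q i'"
    and "f \<circ> i = i' \<circ> f'" "z \<in> carrier (VR_cohomology G n Q)"
  shows "VR_cohomology_map G n P' P i (VR_cohomology_map G n P Q f z) =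
    VR_cohomology_map G n P' Q' f' (VR_cohomology_map G n Q' Q i' z)"
  using VR_cohomology_map_comp[OF assms(2,1,3,5,6,10)] VR_cohomology_map_comp[OF assms(2,4,3,7,8,10)] assms(9)
  by simp

lemma VR_homology_square:
  assumes "filtered_pair P" "filtered_pair P'" "filtered_pair Q" "filtered_pair Q'"
    and "filtered_map P' P i" "filtered_map P Q f" "filtered_map P' Q' f'" "filtered_map Q' Q i'"
    and "i' \<circ> f' = f \<circ> i" "z \<in> carrier (VR_homology G n P')"
  shows "VR_homology_map G n Q' Q i' (VR_homology_map G n P' Q' f' z) =
    VR_homology_map G n P Q f (VR_homology_map G n P' P i z)"
  using VR_homology_map_comp[OF assms(2,1,3,5,6,10)] VR_homology_map_comp[OF assms(2,4,3,7,8,10)] assms(9)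
  by simp

end

theorem theorem4p5:
  fixes G :: "('g, 'm) monoid_scheme" and P :: "'a upair"
  assumes "comm_group G" and "semi_uniform_pair P"
  shows "\<comment> \<open>the long exact sequence in cohomology\<close>
    (\<forall>n::int. exact_seq
       ([VR_cohomology G (n + 1) (total_space P), VR_cohomology G (n + 1) P,
         VR_cohomology G n (subspace P), VR_cohomology G n (total_space P), VR_cohomology G n P],
        [VR_cohomology_map G (n + 1) (total_space P) P id,
         VR_cohomology_connecting G n P,
         VR_cohomology_map G n (subspace P) (total_space P) id,
         VR_cohomology_map G n (total_space P) P id])) \<and>

    \<comment> \<open>the sequence of order two in homology\<close>
    (\<forall>n::int. order_two_seq
       ([VR_homology G (n - 1) (total_space P), VR_homology G (n - 1) (subspace P),
         VR_homology G n P, VR_homology G n (total_space P), VR_homology G n (subspace P)],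
        [VR_homology_map G (n - 1) (subspace P) (total_space P) id,
         VR_homology_connecting G P,
         VR_homology_map G n (total_space P) P id,
         VR_homology_map G n (subspace P) (total_space P) id])) \<and>

    \<comment> \<open>uniformly continuous maps of pairs induce morphisms of these sequences\<close>
    (\<forall>(Q :: 'b upair) f. semi_uniform_pair Q \<and> unif_cont_pair P Q f \<longrightarrow> (\<forall>n::int.
       (\<forall>(S, T) \<in> {(P, Q), (total_space P, total_space Q), (subspace P, subspace Q)}.
          VR_cohomology_map G n S T f \<in> hom (VR_cohomology G n T) (VR_cohomology G n S) \<and>
          VR_homology_map G n S T f \<in> hom (VR_homology G n S) (VR_homology G n T)) \<and>
       (\<forall>z \<in> carrier (VR_cohomology G n Q).
          VR_cohomology_map G n (total_space P) P id (VR_cohomology_map G n P Q f z) =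
          VR_cohomology_map G n (total_space P) (total_space Q) f
            (VR_cohomology_map G n (total_space Q) Q id z)) \<and>
       (\<forall>z \<in> carrier (VR_cohomology G n (total_space Q)).
          VR_cohomology_map G n (subspace P) (total_space P) id
            (VR_cohomology_map G n (total_space P) (total_space Q) f z) =
          VR_cohomology_map G n (subspace P) (subspace Q) f
            (VR_cohomology_map G n (subspace Q) (total_space Q) id z)) \<and>
       (\<forall>z \<in> carrier (VR_cohomology G n (subspace Q)).
          VR_cohomology_connecting G n P (VR_cohomology_map G n (subspace P) (subspace Q) f z) =
          VR_cohomology_map G (n + 1) P Q f (VR_cohomology_connecting G n Q z)) \<and>
       (\<forall>z \<in> carrier (VR_homology G n (subspace P)).
          VR_homology_map G n (subspace Q) (total_space Q) id
            (VR_homology_map G n (subspace P) (subspace Q) f z) =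
          VR_homology_map G n (total_space P) (total_space Q) f
            (VR_homology_map G n (subspace P) (total_space P) id z)) \<and>
       (\<forall>z \<in> carrier (VR_homology G n (total_space P)).
          VR_homology_map G n (total_space Q) Q id
            (VR_homology_map G n (total_space P) (total_space Q) f z) =
          VR_homology_map G n P Q f (VR_homology_map G n (total_space P) P id z)) \<and>
       (\<forall>z \<in> carrier (VR_homology G n P).
          VR_homology_connecting G Q (VR_homology_map G n P Q f z) =
          VR_homology_map G (n - 1) (subspace P) (subspace Q) f (VR_homology_connecting G P z)))) \<and>

    \<comment> \<open>these morphisms respect identities and compositions\<close>
    (\<forall>n::int. \<forall>S \<in> {P, total_space P, subspace P}.
       (\<forall>z \<in> carrier (VR_cohomology G n S). VR_cohomology_map G n S S id z = z) \<and>
       (\<forall>z \<in> carrier (VR_homology G n S). VR_homology_map G n S S id z = z)) \<and>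

    (\<forall>(Q :: 'b upair) (R :: 'c upair) f g.
       semi_uniform_pair Q \<and> semi_uniform_pair R \<and> unif_cont_pair P Q f \<and> unif_cont_pair Q R g \<longrightarrow>
       (\<forall>n::int. \<forall>(S, T, W) \<in> {(P, Q, R), (total_space P, total_space Q, total_space R),
                                (subspace P, subspace Q, subspace R)}.
          (\<forall>z \<in> carrier (VR_cohomology G n W).
             VR_cohomology_map G n S W (g \<circ> f) z =
             VR_cohomology_map G n S T f (VR_cohomology_map G n T W g z)) \<and>
          (\<forall>z \<in> carrier (VR_homology G n S).
             VR_homology_map G n S W (g \<circ> f) z =
             VR_homology_map G n T W g (VR_homology_map G n S T f z))))"
proof -
  interpret comm_group G by fact
  note sP = assms(2)
  note p = filtered_pairs[OF sP]
  have mor: "(\<forall>(S, T) \<in> {(P, Q), (total_space P, total_space Q), (subspace P, subspace Q)}.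
          VR_cohomology_map G n S T f \<in> hom (VR_cohomology G n T) (VR_cohomology G n S) \<and>
          VR_homology_map G n S T f \<in> hom (VR_homology G n S) (VR_homology G n T)) \<and>
       (\<forall>z \<in> carrier (VR_cohomology G n Q).
          VR_cohomology_map G n (total_space P) P id (VR_cohomology_map G n P Q f z) =
          VR_cohomology_map G n (total_space P) (total_space Q) f
            (VR_cohomology_map G n (total_space Q) Q id z)) \<and>
       (\<forall>z \<in> carrier (VR_cohomology G n (total_space Q)).
          VR_cohomology_map G n (subspace P) (total_space P) id
            (VR_cohomology_map G n (total_space P) (total_space Q) f z) =
          VR_cohomology_map G n (subspace P) (subspace Q) f
            (VR_cohomology_map G n (subspace Q) (total_space Q) id z)) \<and>
       (\<forall>z \<in> carrier (VR_cohomology G n (subspace Q)).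
          VR_cohomology_connecting G n P (VR_cohomology_map G n (subspace P) (subspace Q) f z) =
          VR_cohomology_map G (n + 1) P Q f (VR_cohomology_connecting G n Q z)) \<and>
       (\<forall>z \<in> carrier (VR_homology G n (subspace P)).
          VR_homology_map G n (subspace Q) (total_space Q) id
            (VR_homology_map G n (subspace P) (subspace Q) f z) =
          VR_homology_map G n (total_space P) (total_space Q) f
            (VR_homology_map G n (subspace P) (total_space P) id z)) \<and>
       (\<forall>z \<in> carrier (VR_homology G n (total_space P)).
          VR_homology_map G n (total_space Q) Q id
            (VR_homology_map G n (total_space P) (total_space Q) f z) =
          VR_homology_map G n P Q f (VR_homology_map G n (total_space P) P id z)) \<and>
       (\<forall>z \<in> carrier (VR_homology G n P).
          VR_homology_connecting G Q (VR_homology_map G n P Q f z) =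
          VR_homology_map G (n - 1) (subspace P) (subspace Q) f (VR_homology_connecting G P z))"
    if sQ: "semi_uniform_pair Q" and f: "unif_cont_pair P Q f" for Q :: "'b upair" and f n
  proof -
    note q = filtered_pairs[OF sQ] and ff = filtered_maps[OF sP sQ f]
    note iP = filtered_map_total[of P] and iQ = filtered_map_total[of Q]
    note jP = filtered_map_subspace[OF sP] and jQ = filtered_map_subspace[OF sQ]
    \<comment> \<open>All inclusions are the identity on vertices, so the squares formed with
      inclusions commute already for the underlying functions; only the squares with connecting maps
      need an argument of their own.\<close>
    have id: "f \<circ> id = id \<circ> f" by simp
    show ?thesis
      using p q ff VR_cohomology_square[OF p(1,2) q(1,2) iP ff(1,2) iQ id]
        VR_cohomology_square[OF p(2,3) q(2,3) jP ff(2,3) jQ id]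
        VR_homology_square[OF p(2,3) q(2,3) jP ff(2,3) jQ id[symmetric]]
        VR_homology_square[OF p(1,2) q(1,2) iP ff(1,2) iQ id[symmetric]]
        VR_cohomology_connecting_natural[OF sP sQ f] VR_homology_connecting_natural[OF sP sQ f]
      by (simp add: VR_cohomology_map_hom VR_homology_map_hom)
  qed
  have ident: "(\<forall>z \<in> carrier (VR_cohomology G n S). VR_cohomology_map G n S S id z = z) \<and>
       (\<forall>z \<in> carrier (VR_homology G n S). VR_homology_map G n S S id z = z)"
    if "S \<in> {P, total_space P, subspace P}" for S n
    using that p by (auto simp: VR_cohomology_map_id VR_homology_map_id simp del: id_apply)
  have comp: "\<forall>(S, T, W) \<in> {(P, Q, R), (total_space P, total_space Q, total_space R),
                                (subspace P, subspace Q, subspace R)}.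
          (\<forall>z \<in> carrier (VR_cohomology G n W).
             VR_cohomology_map G n S W (g \<circ> f) z =
             VR_cohomology_map G n S T f (VR_cohomology_map G n T W g z)) \<and>
          (\<forall>z \<in> carrier (VR_homology G n S).
             VR_homology_map G n S W (g \<circ> f) z =
             VR_homology_map G n T W g (VR_homology_map G n S T f z))"
    if sQ: "semi_uniform_pair Q" and sR: "semi_uniform_pair R"
      and f: "unif_cont_pair P Q f" and g: "unif_cont_pair Q R g" for Q :: "'b upair" and R :: "'c upair" and f g n
  proof -
    note q = filtered_pairs[OF sQ] and r = filtered_pairs[OF sR]
    note ff = filtered_maps[OF sP sQ f] and gg = filtered_maps[OF sQ sR g]
    show ?thesis
      using VR_cohomology_map_comp[OF p(1) q(1) r(1) ff(1) gg(1)] VR_homology_map_comp[OF p(1) q(1) r(1) ff(1) gg(1)]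
        VR_cohomology_map_comp[OF p(2) q(2) r(2) ff(2) gg(2)] VR_homology_map_comp[OF p(2) q(2) r(2) ff(2) gg(2)]
        VR_cohomology_map_comp[OF p(3) q(3) r(3) ff(3) gg(3)] VR_homology_map_comp[OF p(3) q(3) r(3) ff(3) gg(3)]
      by simp
  qed
  show ?thesis
    by (rule conjI, rule allI, rule VR_cohomology_exact_seq[OF sP], rule conjI, rule allI,
      rule VR_homology_order_two_seq[OF sP], rule conjI, rule allI, rule allI, rule impI, rule allI,
      rule mor, erule conjunct1, erule conjunct2, rule conjI, rule allI, rule ballI, erule ident,
      (rule allI)+, rule impI, rule allI, rule comp, (elim conjE, assumption)+)
qed

end
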